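(* Let $\mu$ be a finite measure in $\mathbb{R}^N$ such that for every Borel set $A \subset \mathbb{R}^N$, $\mathcal{H}^{N-1}(A) < +\infty$ implies $\mu(A) = 0$. Then for every $\epsilon > 0$ there exist $V \in C^0(\mathbb{R}^N; \mathbb{R}^N)$ and $f \in L^1(\mathbb{R}^N)$ such that $$\mu = \operatorname{div} V + f \quad \text{in } \mathbb{R}^N$$ and $\|f\|_{L^1(\mathbb{R}^N)} \le \epsilon$.
   Context: $N\ge1$ is an integer. A finite measure in $\mathbb{R}^N$ is a finite signed Borel measure (not necessarily nonnegative). $C^0(\mathbb{R}^N;\mathbb{R}^N)$ is the space of continuous vector fields. The equation is understood in the sense of distributions: $\int_{\mathbb{R}^N} \varphi \, d\mu = -\int_{\mathbb{R}^N} V\cdot\nabla\varphi + \int_{\mathbb{R}^N} f\varphi$ for every $\varphi \in C_c^\infty(\mathbb{R}^N)$. $\mathcal{H}^{N-1}$ is the (spherical) Hausdorff measure of dimension $s=N-1$: $\mathcal{H}^{s}(A) = \lim_{\delta\to 0} \inf\{\sum_{n=0}^\infty \omega_s r_n^s : A \subset \bigcup_{n=0}^\infty B(x_n;r_n),\ 0\le r_n \le \delta\}$ with $\omega_s = \pi^{s/2}/\Gamma(\frac{s}{2}+1)$ and $B(x;r)$ the ball of center $x$ and radius $r$ (for $s=0$, $\mathcal{H}^0$ is the counting measure). *)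

theory Defs
  imports "HOL-Analysis.Analysis"
begin

section \<open>Spherical Hausdorff measure\<close>

text \<open>
  The balls are open, so a ball of radius \<open>0\<close> is empty.  Since \<open>0 powr 0 = 0\<close>, such a ball
  costs nothing even for \<open>s = 0\<close>: finite covers are then admitted, and the \<open>0\<close>-dimensional
  measure is the counting measure.  The normalisation \<open>unit_ball_vol s\<close> is
  \<open>pi powr (s/2) / Gamma (s/2 + 1)\<close>.
\<close>

definition hausdorff_content :: "real \<Rightarrow> real \<Rightarrow> 'a::metric_space set \<Rightarrow> ennreal" where
  "hausdorff_content s \<delta> A =
     (INF (x, r) \<in> {(x :: nat \<Rightarrow> 'a, r :: nat \<Rightarrow> real).
                      (\<forall>n. 0 \<le> r n \<and> r n \<le> \<delta>) \<and> A \<subseteq> (\<Union>n. ball (x n) (r n))}.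
        (\<Sum>n. ennreal (unit_ball_vol s * r n powr s)))"

definition hausdorff_measure :: "real \<Rightarrow> 'a::metric_space set \<Rightarrow> ennreal" where
  "hausdorff_measure s A = Lim (at_right 0) (\<lambda>\<delta>. hausdorff_content s \<delta> A)"

text \<open>The limit always exists, by monotonicity.\<close>

lemma hausdorff_content_antimono:
  assumes "\<delta> \<le> \<delta>'"
  shows "hausdorff_content s \<delta>' A \<le> hausdorff_content s \<delta> A"
  unfolding hausdorff_content_def
proof (rule INF_superset_mono)
  show "{(x, r). (\<forall>n. 0 \<le> r n \<and> r n \<le> \<delta>) \<and> A \<subseteq> (\<Union>n. ball (x n) (r n))}
        \<subseteq> {(x, r). (\<forall>n. 0 \<le> r n \<and> r n \<le> \<delta>') \<and> A \<subseteq> (\<Union>n. ball (x n) (r n))}"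
    using assms by (auto intro: order_trans)
qed simp

lemma hausdorff_content_tendsto:
  "((\<lambda>\<delta>. hausdorff_content s \<delta> A) \<longlongrightarrow> (SUP \<delta>\<in>{0<..}. hausdorff_content s \<delta> A)) (at_right 0)"
proof (rule order_tendstoI)
  fix a assume "a < (SUP \<delta>\<in>{0<..}. hausdorff_content s \<delta> A)"
  then obtain d where d: "d > 0" "a < hausdorff_content s d A"
    by (auto simp: less_SUP_iff)
  have "a < hausdorff_content s \<delta> A" if "0 < \<delta>" "\<delta> < d" for \<delta>
    using d(2) hausdorff_content_antimono[of \<delta> d s A] that by (meson less_le_trans less_imp_le)
  then show "eventually (\<lambda>\<delta>. a < hausdorff_content s \<delta> A) (at_right 0)"
    unfolding eventually_at_right_field using d(1) by blast
next
  fix a assume a: "(SUP \<delta>\<in>{0<..}. hausdorff_content s \<delta> A) < a"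
  have "hausdorff_content s \<delta> A < a" if "0 < \<delta>" for \<delta>
    using that by (intro le_less_trans[OF SUP_upper a]) auto
  then show "eventually (\<lambda>\<delta>. hausdorff_content s \<delta> A < a) (at_right 0)"
    unfolding eventually_at_right_field by (auto intro: exI[of _ 1])
qed

lemma hausdorff_measure_eq_SUP:
  "hausdorff_measure s A = (SUP \<delta>\<in>{0<..}. hausdorff_content s \<delta> A)"
  unfolding hausdorff_measure_def
  by (intro tendsto_Lim hausdorff_content_tendsto) simp


section \<open>Finite signed Borel measures\<close>

text \<open>
  A real-valued countably additive set function on the Borel sets; its values on other sets
  are irrelevant.
\<close>

definition finite_signed_measure :: "('a::topological_space set \<Rightarrow> real) \<Rightarrow> bool" where
  "finite_signed_measure \<mu> \<longleftrightarrow>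
     \<mu> {} = 0 \<and>
     (\<forall>A :: nat \<Rightarrow> 'a set. range A \<subseteq> sets borel \<longrightarrow> disjoint_family A \<longrightarrow>
        (\<lambda>n. \<mu> (A n)) sums \<mu> (\<Union>n. A n))"

text \<open>
  The upper variation \<open>\<mu>\<^sup>+(A) = sup {\<mu>(B) | B \<subseteq> A Borel}\<close>.  The coercion \<open>ennreal\<close> truncates
  negative values to \<open>0\<close>, which is harmless as \<open>B = {}\<close> is allowed.  The lower variation is the
  upper variation of \<open>- \<mu>\<close>.
\<close>

definition upper_variation :: "('a::topological_space set \<Rightarrow> real) \<Rightarrow> 'a measure" where
  "upper_variation \<mu> =
     measure_of UNIV (sets borel) (\<lambda>A. SUP B \<in> {B \<in> sets borel. B \<subseteq> A}. ennreal (\<mu> B))"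

text \<open>The set function above is indeed a measure, so \<open>measure_of\<close> does not degenerate.\<close>

lemma emeasure_upper_variation:
  fixes \<mu> :: "'a::topological_space set \<Rightarrow> real"
  assumes \<mu>: "finite_signed_measure \<mu>" and A: "A \<in> sets borel"
  shows "emeasure (upper_variation \<mu>) A = (SUP B \<in> {B \<in> sets borel. B \<subseteq> A}. ennreal (\<mu> B))"
proof -
  define \<nu> where "\<nu> A = (SUP B \<in> {B \<in> sets borel. B \<subseteq> A}. ennreal (\<mu> B))" for A
  have \<mu>0: "\<mu> {} = 0"
    using \<mu> unfolding finite_signed_measure_def by simp
  have sums: "(\<lambda>n. \<mu> (A n)) sums \<mu> (\<Union>n. A n)"
    if "range A \<subseteq> sets borel" "disjoint_family A" for A :: "nat \<Rightarrow> 'a set"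
    using \<mu> that unfolding finite_signed_measure_def by blast
  have add: "\<mu> (B \<union> C) = \<mu> B + \<mu> C"
    if "B \<in> sets borel" "C \<in> sets borel" "B \<inter> C = {}" for B C
  proof -
    let ?D = "binaryset B C"
    have "(\<lambda>n. \<mu> (?D n)) sums \<mu> (\<Union>n. ?D n)"
      using that by (intro sums) (auto simp: binaryset_def disjoint_family_on_def)
    moreover have "(\<lambda>n. \<mu> (?D n)) sums (\<mu> B + \<mu> C)"
      using \<mu>0 by (rule binaryset_sums)
    ultimately show ?thesis
      by (simp add: UN_binaryset_eq sums_unique2)
  qed
  have upper: "ennreal (\<mu> B) \<le> \<nu> A" if "B \<in> sets borel" "B \<subseteq> A" for A B
    unfolding \<nu>_def using that by (intro SUP_upper) auto
  have \<nu>0: "\<nu> {} = 0"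
    unfolding \<nu>_def using \<mu>0 by (intro antisym SUP_least) auto
  have mono: "\<nu> A \<le> \<nu> B" if "A \<subseteq> B" for A B
    unfolding \<nu>_def using that by (intro SUP_subset_mono) auto
  have super: "\<nu> A + \<nu> B \<le> \<nu> (A \<union> B)" if "A \<inter> B = {}" for A B
  proof -
    have *: "ennreal (\<mu> C) + ennreal (\<mu> D) \<le> \<nu> (A \<union> B)"
      if C: "C \<in> sets borel" "C \<subseteq> A" and D: "D \<in> sets borel" "D \<subseteq> B" for C D
    proof -
      have "ennreal (\<mu> (C \<union> D)) \<le> \<nu> (A \<union> B)" "ennreal (\<mu> C) \<le> \<nu> (A \<union> B)" "ennreal (\<mu> D) \<le> \<nu> (A \<union> B)"
        using C D by (auto intro!: upper)
      moreover have "\<mu> (C \<union> D) = \<mu> C + \<mu> D"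
        using C D \<open>A \<inter> B = {}\<close> by (intro add) auto
      ultimately show ?thesis
        by (cases "\<mu> C \<ge> 0"; cases "\<mu> D \<ge> 0") (auto simp: ennreal_plus ennreal_neg)
    qed
    have ne: "{B \<in> sets borel. B \<subseteq> A} \<noteq> {}" for A by auto
    have "\<nu> A + \<nu> B = (SUP C \<in> {C \<in> sets borel. C \<subseteq> A}. ennreal (\<mu> C) + \<nu> B)"
      unfolding \<nu>_def[of A] by (rule ennreal_SUP_add_left[symmetric]) (rule ne)
    also have "\<dots> \<le> \<nu> (A \<union> B)"
    proof (rule SUP_least)
      fix C assume C: "C \<in> {C \<in> sets borel. C \<subseteq> A}"
      have "ennreal (\<mu> C) + \<nu> B = (SUP D \<in> {D \<in> sets borel. D \<subseteq> B}. ennreal (\<mu> C) + ennreal (\<mu> D))"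
        unfolding \<nu>_def[of B]
        using ennreal_SUP_add_left[OF ne, of "\<lambda>D. ennreal (\<mu> D)" "ennreal (\<mu> C)" B] by (simp add: add.commute)
      also have "\<dots> \<le> \<nu> (A \<union> B)"
        using C * by (intro SUP_least) auto
      finally show "ennreal (\<mu> C) + \<nu> B \<le> \<nu> (A \<union> B)" .
    qed
    finally show ?thesis .
  qed
  have "countably_additive (sets borel) \<nu>"
  proof (rule countably_additiveI)
    fix A :: "nat \<Rightarrow> 'a set"
    assume A: "range A \<subseteq> sets borel" "disjoint_family A"
    have "(\<Sum>n<k. \<nu> (A n)) \<le> \<nu> (\<Union>n<k. A n)" for k
    proof (induction k)
      case (Suc k)
      have "(\<Sum>n<Suc k. \<nu> (A n)) \<le> \<nu> (\<Union>n<k. A n) + \<nu> (A k)"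
        using Suc by (simp add: add_right_mono)
      also have "\<dots> \<le> \<nu> ((\<Union>n<k. A n) \<union> A k)"
      proof (rule super)
        have "A n \<inter> A k = {}" if "n < k" for n
          using A(2) that unfolding disjoint_family_on_def by (metis UNIV_I less_irrefl)
        then show "(\<Union>n<k. A n) \<inter> A k = {}" by blast
      qed
      finally show ?case by (simp add: lessThan_Suc Un_commute)
    qed (simp add: \<nu>0)
    also have "\<nu> (\<Union>n<k. A n) \<le> \<nu> (\<Union>n. A n)" for k
      by (intro mono) auto
    finally have le: "(\<Sum>n. \<nu> (A n)) \<le> \<nu> (\<Union>n. A n)"
      by (intro suminf_le_const) auto
    have "ennreal (\<mu> B) \<le> (\<Sum>n. \<nu> (A n))" if B: "B \<in> sets borel" "B \<subseteq> (\<Union>n. A n)" for B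
    proof -
      have "(\<lambda>n. \<mu> (B \<inter> A n)) sums \<mu> (\<Union>n. B \<inter> A n)"
        using A B by (intro sums) (auto simp: disjoint_family_on_def)
      moreover have "(\<Union>n. B \<inter> A n) = B" using B by auto
      ultimately have "(\<lambda>k. \<Sum>n<k. \<mu> (B \<inter> A n)) \<longlonglongrightarrow> \<mu> B"
        by (simp add: sums_def)
      then have "(\<lambda>k. ennreal (\<Sum>n<k. \<mu> (B \<inter> A n))) \<longlonglongrightarrow> ennreal (\<mu> B)"
        by (rule tendsto_ennrealI)
      moreover have "ennreal (\<Sum>n<k. \<mu> (B \<inter> A n)) \<le> (\<Sum>n. \<nu> (A n))" for k
      proof -
        have "ennreal (\<Sum>n<k. \<mu> (B \<inter> A n)) \<le> ennreal (\<Sum>n<k. max 0 (\<mu> (B \<inter> A n)))"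
          by (intro ennreal_leI sum_mono) auto
        also have "\<dots> = (\<Sum>n<k. ennreal (max 0 (\<mu> (B \<inter> A n))))"
          by (simp add: sum_ennreal)
        also have "\<dots> \<le> (\<Sum>n<k. \<nu> (A n))"
        proof (rule sum_mono)
          fix n
          have "ennreal (\<mu> (B \<inter> A n)) \<le> \<nu> (A n)"
            using A B by (intro upper) auto
          then show "ennreal (max 0 (\<mu> (B \<inter> A n))) \<le> \<nu> (A n)"
            by (auto simp: max_def)
        qed
        also have "\<dots> \<le> (\<Sum>n. \<nu> (A n))"
          by (intro sum_le_suminf) auto
        finally show ?thesis .
      qed
      ultimately show ?thesis
        by (intro LIMSEQ_le_const2) auto
    qed
    then have "\<nu> (\<Union>n. A n) \<le> (\<Sum>n. \<nu> (A n))"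
      unfolding \<nu>_def[of "\<Union>n. A n"] by (intro SUP_least) auto
    with le show "(\<Sum>n. \<nu> (A n)) = \<nu> (\<Union>n. A n)" by (rule antisym)
  qed
  moreover have "positive (sets borel) \<nu>"
    by (simp add: positive_def \<nu>0)
  moreover have "upper_variation \<mu> = measure_of UNIV (sets borel) \<nu>"
    unfolding upper_variation_def \<nu>_def ..
  moreover have "sigma_algebra UNIV (sets (borel :: 'a measure))"
    using sets.sigma_algebra_axioms[of "borel :: 'a measure"] by simp
  ultimately show ?thesis
    using A by (simp add: emeasure_measure_of_sigma \<nu>_def)
qed

definition signed_integral ::
    "('a::topological_space set \<Rightarrow> real) \<Rightarrow> ('a \<Rightarrow> real) \<Rightarrow> real" where
  "signed_integral \<mu> g =
     (LINT x|upper_variation \<mu>. g x) - (LINT x|upper_variation (\<lambda>A. - \<mu> A). g x)"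


section \<open>Test functions and the equation \<open>\<mu> = div V + f\<close>\<close>

primrec Ck :: "nat \<Rightarrow> ('a::euclidean_space \<Rightarrow> real) \<Rightarrow> bool" where
  "Ck 0 g \<longleftrightarrow> continuous_on UNIV g"
| "Ck (Suc k) g \<longleftrightarrow>
     (\<forall>x. g differentiable (at x)) \<and>
     (\<forall>b\<in>Basis. Ck k (\<lambda>x. frechet_derivative g (at x) b))"

definition test_function :: "('a::euclidean_space \<Rightarrow> real) \<Rightarrow> bool" where
  "test_function g \<longleftrightarrow> (\<forall>k. Ck k g) \<and> compact (closure {x. g x \<noteq> 0})"

definition gradient :: "('a::euclidean_space \<Rightarrow> real) \<Rightarrow> 'a \<Rightarrow> 'a" where
  "gradient g x = (\<Sum>b\<in>Basis. frechet_derivative g (at x) b *\<^sub>R b)"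

definition eq_div_plus ::
    "('a::euclidean_space set \<Rightarrow> real) \<Rightarrow> ('a \<Rightarrow> 'a) \<Rightarrow> ('a \<Rightarrow> real) \<Rightarrow> bool" where
  "eq_div_plus \<mu> V f \<longleftrightarrow>
     (\<forall>\<phi>. test_function \<phi> \<longrightarrow>
        signed_integral \<mu> \<phi> =
          - (LINT x|lborel. V x \<bullet> gradient \<phi> x) + (LINT x|lborel. f x * \<phi> x))"

end

theory Submission
  imports Defs
begin

text \<open>
  Let \<open>P\<close> be one of the two variations of \<open>\<mu>\<close>.  By a covering argument the set of points where
  \<open>P (ball x r) > c * r ^ (N - 1)\<close> for arbitrarily small \<open>r\<close> has finite \<open>(N - 1)\<close>-dimensional
  measure, so it is \<open>P\<close>-null; hence there are sets \<open>E k\<close> with \<open>P (- E k)\<close> as small as we like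
  on which \<open>P\<close> grows at most like \<open>c k * r ^ (N - 1)\<close> at small scales, with \<open>c k\<close> tending to \<open>0\<close>.
  Under such a growth condition \<open>P\<close> restricted to \<open>E k\<close> satisfies a trace inequality of
  Meyers--Ziemer type, and therefore the difference of its mollifications at two small scales is a
  functional of the test function \<open>u\<close> of size at most \<open>(1/2) ^ k\<close> times the \<open>L\<^sup>1\<close> norm of the gradient.

  By the Hahn--Banach theorem this functional extends to all vector fields.  Evaluating the extension
  on translates of a mollifier gives a continuous field \<open>V k\<close> with \<open>norm (V k x) \<le> (1/2) ^ k\<close>, which
  represents the functional up to an arbitrarily small \<open>L\<^sup>1\<close> error; there is no need to represent the
  dual of \<open>L\<^sup>1\<close>.  The measure is the telescoping sum of these differences, and the first term is
  treated in the same way, since an average of \<open>u\<close> over a ball is also controlled by the \<open>L\<^sup>1\<close>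
  norm of its gradient.
\<close>

section \<open>Variations of a signed measure\<close>

text \<open>The hypothesis only makes \<open>P (ball x r) / r ^ (N - 1)\<close> tend to
  \<open>0\<close> at \<open>P\<close>-almost every point, without uniformity. Hence the exceptional
  sets: a small constant \<open>c k\<close> is bought by going to small scales, and the mass lost by
  truncation is charged to \<open>f\<close>. The trace inequality at scale \<open>\<Delta>\<close>
  carries a zeroth order term, \<open>1 / \<Delta>\<close> times the L1 norm of the function. A
  difference of two mollifications of \<open>u\<close> at scales at most \<open>\<Delta>\<close> has
  L1 norm at most \<open>2 * \<Delta>\<close> times that of the gradient, so this term is absorbed;
  this is why differences of mollifications, and not the truncated measures themselves, are
  represented. Only the first term of the telescoping sum lacks a small constant. This is harmless:
  the theorem bounds \<open>f\<close> and not \<open>V\<close>, and the decay of the other fields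
  serves their uniform convergence. Two kinds of error make up \<open>f\<close>: those of replacing
  a functional by a continuous field, and those of passing from \<open>E k\<close> to
  \<open>E (Suc k)\<close>.\<close>

lemma sets_upper_variation [simp, measurable_cong]: "sets (upper_variation \<mu>) = sets borel"
  and space_upper_variation [simp]: "space (upper_variation \<mu>) = UNIV"
  unfolding upper_variation_def
  using sets.space_closed[of borel] sets.sigma_sets_eq[of borel] by (auto simp: sets_measure_of space_measure_of_conv)

lemma finite_signed_measure_Un:
  assumes \<mu>: "finite_signed_measure \<mu>" and "B \<in> sets borel" "C \<in> sets borel" "B \<inter> C = {}"
  shows "\<mu> (B \<union> C) = \<mu> B + \<mu> C"
proof -
  let ?D = "binaryset B C"
  have "(\<lambda>n. \<mu> (?D n)) sums \<mu> (\<Union>n. ?D n)"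
  proof -
    have "range ?D \<subseteq> sets borel" "disjoint_family ?D"
      using assms by (auto simp: binaryset_def disjoint_family_on_def)
    then show ?thesis
      using \<mu> unfolding finite_signed_measure_def by blast
  qed
  moreover have "(\<lambda>n. \<mu> (?D n)) sums (\<mu> B + \<mu> C)"
    using \<mu> by (intro binaryset_sums) (auto simp: finite_signed_measure_def)
  ultimately show ?thesis
    by (simp add: UN_binaryset_eq sums_unique2)
qed

text \<open>A set of infinite upper variation splits into two pieces on which \<open>\<mu>\<close>
  has modulus at least \<open>1\<close>, and one piece again has infinite upper variation. Keeping
  that piece and discarding the other, over and over, gives disjoint sets whose values under
  \<open>\<mu>\<close> do not tend to \<open>0\<close>, against countable additivity.\<close>

lemma finite_measure_upper_variation:
  assumes \<mu>: "finite_signed_measure \<mu>"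
  shows "finite_measure (upper_variation \<mu>)"
proof (rule ccontr)
  let ?U = "emeasure (upper_variation \<mu>)"
  let ?bad = "\<lambda>A. A \<in> sets borel \<and> ?U A = \<infinity>"
  assume "\<not> finite_measure (upper_variation \<mu>)"
  then have bad: "?bad UNIV"
    using finite_measureI[of "upper_variation \<mu>"] by auto
  have step: "\<exists>B. ?bad B \<and> B \<subseteq> A \<and> 1 \<le> \<bar>\<mu> (A - B)\<bar>" if A: "?bad A" for A
  proof -
    have "(SUP B \<in> {B \<in> sets borel. B \<subseteq> A}. ennreal (\<mu> B)) = \<infinity>"
      using A emeasure_upper_variation[OF \<mu>, of A] by simp
    \<comment> \<open>With this threshold \<open>\<mu> C > \<bar>\<mu> A\<bar> + 1\<close> forces
      \<open>\<mu> (A - C) < - 1\<close> as well, so that either piece may be the discarded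
      one.\<close>
    then have "ennreal (\<bar>\<mu> A\<bar> + 1) < (SUP B \<in> {B \<in> sets borel. B \<subseteq> A}. ennreal (\<mu> B))"
      by (simp only: infinity_ennreal_def ennreal_less_top)
    then obtain C where C: "C \<in> sets borel" "C \<subseteq> A" "ennreal (\<bar>\<mu> A\<bar> + 1) < ennreal (\<mu> C)"
      by (auto simp: less_SUP_iff)
    have gt: "\<bar>\<mu> A\<bar> + 1 < \<mu> C"
      using C(3) by (subst (asm) ennreal_less_iff) auto
    have "\<mu> (C \<union> (A - C)) = \<mu> C + \<mu> (A - C)"
      using A C by (intro finite_signed_measure_Un[OF \<mu>]) auto
    moreover have "C \<union> (A - C) = A" using C by auto
    ultimately have eq: "\<mu> A = \<mu> C + \<mu> (A - C)" by simp
    have "?U C + ?U (A - C) = ?U (C \<union> (A - C))"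
      using A C by (intro plus_emeasure) auto
    then have "?U C + ?U (A - C) = \<infinity>"
      using A \<open>C \<union> (A - C) = A\<close> by simp
    then consider "?U C = \<infinity>" | "?U (A - C) = \<infinity>" by (auto simp: ennreal_add_eq_top)
    then show ?thesis
    proof cases
      case 1 then show ?thesis using C gt eq by (intro exI[of _ C]) auto
    next
      case 2
      moreover have "A - (A - C) = C" using C by auto
      ultimately show ?thesis using C gt eq A by (intro exI[of _ "A - C"]) auto
    qed
  qed
  obtain A where A: "\<And>n. ?bad (A n)" "\<And>n. A (Suc n) \<subseteq> A n" "\<And>n. 1 \<le> \<bar>\<mu> (A n - A (Suc n))\<bar>"
    using dependent_nat_choice[of "\<lambda>_ A. ?bad A" "\<lambda>_ A B. B \<subseteq> A \<and> 1 \<le> \<bar>\<mu> (A - B)\<bar>"] bad step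
    by (metis (no_types, lifting))
  have dec: "A n \<subseteq> A m" if "m \<le> n" for m n
    using lift_Suc_antimono_le[of A, OF A(2) that] .
  define D where "D n = A n - A (Suc n)" for n
  have "disjoint_family D"
    unfolding disjoint_family_on_def
  proof (intro ballI impI)
    fix m n :: nat assume "m \<noteq> n"
    then have "Suc m \<le> n \<or> Suc n \<le> m" by auto
    then show "D m \<inter> D n = {}" using dec unfolding D_def by blast
  qed
  moreover have "range D \<subseteq> sets borel" using A(1) by (auto simp: D_def)
  ultimately have "summable (\<lambda>n. \<mu> (D n))"
    using \<mu> unfolding finite_signed_measure_def by (auto simp: sums_iff)
  then have "(\<lambda>n. \<mu> (D n)) \<longlonglongrightarrow> 0" by (rule summable_LIMSEQ_zero)
  then have "\<forall>\<^sub>F n in sequentially. \<bar>\<mu> (D n)\<bar> < 1"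
    by (auto dest!: tendstoD[of _ _ _ 1])
  then obtain n where "\<bar>\<mu> (D n)\<bar> < 1" by (auto simp: eventually_sequentially)
  then show False using A(3)[of n] unfolding D_def by simp
qed

section \<open>Upper densities and Hausdorff measure\<close>

text \<open>The Vitali lemma yields a countable, possibly finite family; positions that carry no
  ball get radius \<open>0\<close>, hence an empty ball. A single sequence is the form that
  \<open>hausdorff_content\<close> and countable additivity ask for.\<close>

lemma Vitali_covering_sequence:
  fixes r :: "'a::euclidean_space \<Rightarrow> real"
  assumes r: "\<And>x. x \<in> Z \<Longrightarrow> 0 < r x \<and> r x \<le> B"
  obtains y :: "nat \<Rightarrow> 'a" and \<rho> :: "nat \<Rightarrow> real" where
    "\<And>n. \<rho> n = 0 \<or> y n \<in> Z \<and> \<rho> n = r (y n)"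
    "disjoint_family (\<lambda>n. ball (y n) (\<rho> n))"
    "Z \<subseteq> (\<Union>n. ball (y n) (5 * \<rho> n))"
proof -
  have "Z \<subseteq> (\<Union>i\<in>Z. ball i (r i))" using r by force
  then obtain C where C: "countable C" "C \<subseteq> Z"
     "pairwise (\<lambda>i j. disjnt (ball i (r i)) (ball j (r j))) C" "Z \<subseteq> (\<Union>i\<in>C. ball i (5 * r i))"
    using Vitali_covering_lemma_balls[where S = Z and K = Z and a = "\<lambda>x. x" and r = r and B = B] r
    by (metis (no_types, lifting))
  define S where "S = to_nat_on C ` C"
  define y where "y n = from_nat_into C n" for n
  define \<rho> where "\<rho> n = (if n \<in> S then r (y n) else 0)" for n
  have y: "y n \<in> C" if "n \<in> S" for n using that C(1) by (auto simp: S_def y_def)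
  show ?thesis
  proof
    show "\<rho> n = 0 \<or> y n \<in> Z \<and> \<rho> n = r (y n)" for n using y C(2) by (auto simp: \<rho>_def)
    show "disjoint_family (\<lambda>n. ball (y n) (\<rho> n))"
      unfolding disjoint_family_on_def
    proof (intro ballI impI)
      fix m n :: nat assume "m \<noteq> n"
      show "ball (y m) (\<rho> m) \<inter> ball (y n) (\<rho> n) = {}"
      proof (cases "m \<in> S \<and> n \<in> S")
        case True
        then have "y m \<noteq> y n" using \<open>m \<noteq> n\<close> C(1) by (auto simp: S_def y_def)
        then show ?thesis using True C(3) y unfolding pairwise_def disjnt_def \<rho>_def by auto
      qed (auto simp: \<rho>_def)
    qed
    show "Z \<subseteq> (\<Union>n. ball (y n) (5 * \<rho> n))"
    proof
      fix x assume "x \<in> Z"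
      then obtain i where i: "i \<in> C" "x \<in> ball i (5 * r i)" using C(4) by blast
      then show "x \<in> (\<Union>n. ball (y n) (5 * \<rho> n))"
        using C(1) by (intro UN_I[of "to_nat_on C i"]) (auto simp: y_def \<rho>_def S_def)
    qed
  qed
qed

text \<open>The intersection over all \<open>d > 0\<close> is the set where the inequality holds at
  arbitrarily small radii. The strict inequality is what makes the set open.\<close>

definition high_density :: "'a::euclidean_space measure \<Rightarrow> real \<Rightarrow> real \<Rightarrow> 'a set" where
  "high_density P c d = {x. \<exists>r. 0 < r \<and> r < d \<and> c * r ^ (DIM('a) - 1) < measure P (ball x r)}"

text \<open>The measure of an open ball is the limit of the measures of smaller concentric balls, so
  the strict inequality survives a slight shrinking of the radius; the shrunken ball lies in
  \<open>ball y r\<close> for all \<open>y\<close> near \<open>x\<close>.\<close>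

lemma open_high_density:
  fixes P :: "'a::euclidean_space measure"
  assumes "finite_measure P" and [measurable_cong]: "sets P = sets borel"
  shows "open (high_density P c d)"
  unfolding open_contains_ball
proof
  interpret finite_measure P by fact
  fix x assume "x \<in> high_density P c d"
  then obtain r where r: "0 < r" "r < d" "c * r ^ (DIM('a) - 1) < measure P (ball x r)"
    unfolding high_density_def by auto
  have "(\<lambda>n. measure P (ball x (r - 1 / Suc n))) \<longlonglongrightarrow> measure P (\<Union>n. ball x (r - 1 / Suc n))"
    by (intro finite_Lim_measure_incseq) (auto simp: incseq_def frac_le intro!: subset_ball)
  moreover have "(\<Union>n. ball x (r - 1 / Suc n)) = ball x r"
  proof (intro set_eqI iffI)
    fix y assume "y \<in> ball x r"
    then obtain n where "1 / Suc n < r - dist x y"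
      using nat_approx_posE[of "r - dist x y"] by auto
    then show "y \<in> (\<Union>n. ball x (r - 1 / Suc n))" by (auto intro!: exI[of _ n])
  qed (auto simp: less_diff_eq intro: le_less_trans[rotated])
  ultimately have "\<forall>\<^sub>F n in sequentially. c * r ^ (DIM('a) - 1) < measure P (ball x (r - 1 / Suc n))"
    using r(3) by (auto dest: order_tendstoD)
  then obtain n where n: "c * r ^ (DIM('a) - 1) < measure P (ball x (r - 1 / Suc n))"
    by (auto simp: eventually_sequentially)
  have "ball x (1 / Suc n) \<subseteq> high_density P c d"
  proof
    fix y assume y: "y \<in> ball x (1 / Suc n)"
    have "ball x (r - 1 / Suc n) \<subseteq> ball y r"
    proof
      fix z assume "z \<in> ball x (r - 1 / Suc n)"
      then show "z \<in> ball y r" using y dist_triangle[of y z x] by (auto simp: dist_commute)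
    qed
    then have "measure P (ball x (r - 1 / Suc n)) \<le> measure P (ball y r)"
      by (intro finite_measure_mono) auto
    with n r show "y \<in> high_density P c d" unfolding high_density_def by force
  qed
  then show "\<exists>e>0. ball x e \<subseteq> high_density P c d" by (intro exI[of _ "1 / Suc n"]) auto
qed

text \<open>Each disjoint Vitali ball satisfies \<open>r ^ (N - 1) < P (ball x r) / c\<close>, so
  the cost of the enlarged balls is summed against the total mass of \<open>P\<close>, with a bound
  independent of \<open>\<delta>\<close>.\<close>

lemma hausdorff_measure_high_density:
  fixes P :: "'a::euclidean_space measure"
  assumes "finite_measure P" and [measurable_cong]: "sets P = sets borel" and "c > 0"
  shows "hausdorff_measure (real DIM('a) - 1) (\<Inter>n. high_density P c (1 / Suc n)) < \<infinity>"
proof -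
  interpret finite_measure P by fact
  let ?Z = "\<Inter>n. high_density P c (1 / Suc n)"
  let ?s = "real DIM('a) - 1"
  \<comment> \<open>\<open>5 powr ?s\<close> pays for the enlargement of the Vitali balls,
    \<open>1 / c\<close> for the lower density bound.\<close>
  define w where "w = unit_ball_vol ?s * 5 powr ?s / c"
  have w: "0 \<le> w" unfolding w_def using \<open>c > 0\<close> DIM_positive[where 'a='a]
    by (auto intro!: divide_nonneg_pos mult_nonneg_nonneg unit_ball_vol_nonneg)
  have content: "hausdorff_content ?s \<delta> ?Z \<le> ennreal w * emeasure P UNIV" if \<delta>: "\<delta> > 0" for \<delta>
  proof -
    \<comment> \<open>Radii below \<open>\<delta> / 5\<close> keep the enlarged balls admissible in
      \<open>hausdorff_content\<close> at \<open>\<delta>\<close>.\<close>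
    have "\<exists>r. 0 < r \<and> r < \<delta> / 5 \<and> c * r ^ (DIM('a) - 1) < measure P (ball x r)" if "x \<in> ?Z" for x
    proof -
      obtain n where "1 / Suc n < \<delta> / 5" using nat_approx_posE[of "\<delta> / 5"] \<delta> by auto
      moreover have "x \<in> high_density P c (1 / Suc n)" using that by auto
      ultimately show ?thesis unfolding high_density_def by force
    qed
    then obtain r where r: "\<And>x. x \<in> ?Z \<Longrightarrow> 0 < r x \<and> r x < \<delta> / 5 \<and> c * r x ^ (DIM('a) - 1) < measure P (ball x (r x))"
      by metis
    obtain y :: "nat \<Rightarrow> 'a" and \<rho> where y: "\<And>n. \<rho> n = 0 \<or> y n \<in> ?Z \<and> \<rho> n = r (y n)"
      "disjoint_family (\<lambda>n. ball (y n) (\<rho> n))" "?Z \<subseteq> (\<Union>n. ball (y n) (5 * \<rho> n))"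
    proof (rule Vitali_covering_sequence[of ?Z r "\<delta> / 5"])
      show "0 < r x \<and> r x \<le> \<delta> / 5" if "x \<in> ?Z" for x using r[OF that] by simp
    qed blast
    have \<rho>: "\<rho> n = 0 \<or> 0 < \<rho> n \<and> \<rho> n < \<delta> / 5 \<and> c * \<rho> n ^ (DIM('a) - 1) < measure P (ball (y n) (\<rho> n))" for n
      using y(1)[of n] r[of "y n"] by auto
    have "hausdorff_content ?s \<delta> ?Z \<le> (\<Sum>n. ennreal (unit_ball_vol ?s * (5 * \<rho> n) powr ?s))"
      unfolding hausdorff_content_def
    proof (rule INF_lower2[of "(y, \<lambda>n. 5 * \<rho> n)"])
      have "0 \<le> 5 * \<rho> n \<and> 5 * \<rho> n \<le> \<delta>" for n using \<delta> \<rho>[of n] by auto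
      then show "(y, \<lambda>n. 5 * \<rho> n) \<in> {(x, r). (\<forall>n. 0 \<le> r n \<and> r n \<le> \<delta>) \<and> ?Z \<subseteq> (\<Union>n. ball (x n) (r n))}"
        using y(3) by blast
    qed simp
    also have "\<dots> \<le> (\<Sum>n. ennreal w * emeasure P (ball (y n) (\<rho> n)))"
    proof (rule suminf_le)
      fix n
      show "ennreal (unit_ball_vol ?s * (5 * \<rho> n) powr ?s) \<le> ennreal w * emeasure P (ball (y n) (\<rho> n))"
      \<comment> \<open>Padding terms cost nothing because \<open>0 powr 0 = 0\<close>, which
        matters when \<open>DIM('a) = 1\<close>.\<close>
      proof (cases "\<rho> n = 0")
        case False
        with \<rho>[of n] have rn: "0 < \<rho> n" "c * \<rho> n ^ (DIM('a) - 1) < measure P (ball (y n) (\<rho> n))" by auto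
        have "(5 * \<rho> n) powr ?s = 5 powr ?s * \<rho> n powr ?s"
          using rn by (simp add: powr_mult)
        also have "\<rho> n powr ?s = \<rho> n ^ (DIM('a) - 1)"
          using rn DIM_positive[where 'a='a] by (subst powr_realpow[symmetric]) (auto simp: of_nat_diff Suc_leI)
        also have "\<dots> \<le> measure P (ball (y n) (\<rho> n)) / c" using rn \<open>c > 0\<close> by (simp add: field_simps)
        finally have "unit_ball_vol ?s * (5 * \<rho> n) powr ?s \<le> unit_ball_vol ?s * (5 powr ?s * (measure P (ball (y n) (\<rho> n)) / c))"
          using DIM_positive[where 'a='a] by (intro mult_left_mono unit_ball_vol_nonneg) auto
        also have "\<dots> = w * measure P (ball (y n) (\<rho> n))" by (simp add: w_def)
        finally show ?thesis using w by (auto simp: emeasure_eq_measure ennreal_mult'[symmetric] intro!: ennreal_leI)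
      qed simp
    qed auto
    also have "\<dots> = ennreal w * (\<Sum>n. emeasure P (ball (y n) (\<rho> n)))" by simp
    also have "(\<Sum>n. emeasure P (ball (y n) (\<rho> n))) = emeasure P (\<Union>n. ball (y n) (\<rho> n))"
      by (intro suminf_emeasure y) auto
    also have "\<dots> \<le> emeasure P UNIV" by (intro emeasure_mono) auto
    finally show ?thesis by (simp add: mult_left_mono)
  qed
  have "hausdorff_measure ?s ?Z \<le> ennreal w * emeasure P UNIV"
    unfolding hausdorff_measure_eq_SUP using content by (auto intro!: SUP_least)
  also have "\<dots> < \<infinity>" using emeasure_eq_measure[of UNIV] by (auto simp: ennreal_mult_less_top)
  finally show ?thesis .
qed

text \<open>As \<open>d\<close> decreases to \<open>0\<close>, the sets
  \<open>high_density P c d\<close> shrink to a set of finite Hausdorff measure, which is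
  \<open>P\<close>-null; a finite measure is continuous along decreasing sequences.\<close>

lemma exists_high_density_small:
  fixes P :: "'a::euclidean_space measure"
  assumes P: "finite_measure P" and [measurable_cong]: "sets P = sets borel"
    and null: "\<And>A. A \<in> sets borel \<Longrightarrow> hausdorff_measure (real DIM('a) - 1) A < \<infinity> \<Longrightarrow> emeasure P A = 0"
    and "c > 0" "\<epsilon> > 0"
  shows "\<exists>d>0. measure P (high_density P c d) < \<epsilon>"
proof -
  interpret finite_measure P by fact
  let ?H = "\<lambda>n. high_density P c (1 / Suc n)"
  have [measurable]: "?H n \<in> sets P" for n
    using open_high_density[OF P assms(2), of c "1 / Suc n"] assms(2) by auto
  have "emeasure P (\<Inter>n. ?H n) = 0"
  proof (rule null)
    show "(\<Inter>n. ?H n) \<in> sets borel"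
      using open_high_density[OF P assms(2)] by (intro sets.countable_INT) auto
    show "hausdorff_measure (real DIM('a) - 1) (\<Inter>n. ?H n) < \<infinity>"
      by (rule hausdorff_measure_high_density[OF P assms(2) \<open>c > 0\<close>])
  qed
  moreover have "(\<lambda>n. measure P (?H n)) \<longlonglongrightarrow> measure P (\<Inter>n. ?H n)"
  proof (intro finite_Lim_measure_decseq)
    have "1 / real (Suc n) \<le> 1 / real (Suc m)" if "m \<le> n" for m n
      using that by (intro divide_left_mono) auto
    then show "decseq ?H" unfolding decseq_def high_density_def
      by (fastforce intro: less_le_trans)
  qed (use open_high_density[OF P assms(2)] assms(2) in auto)
  ultimately have "(\<lambda>n. measure P (?H n)) \<longlonglongrightarrow> 0" by (simp add: measure_def)
  then have "\<forall>\<^sub>F n in sequentially. measure P (?H n) < \<epsilon>"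
    using \<open>\<epsilon> > 0\<close> by (auto dest: order_tendstoD)
  then obtain n where "measure P (?H n) < \<epsilon>" by (auto simp: eventually_sequentially)
  then show ?thesis by (intro exI[of _ "1 / Suc n"]) auto
qed

section \<open>A trace inequality for measures of codimension one growth\<close>

text \<open>The gradient is an explicit argument, so that sums, compositions and correlations come
  with a formula for it.\<close>

definition C1_grad :: "('a::euclidean_space \<Rightarrow> real) \<Rightarrow> ('a \<Rightarrow> 'a) \<Rightarrow> bool" where
  "C1_grad u G \<longleftrightarrow> (\<forall>x. (u has_derivative (\<lambda>h. G x \<bullet> h)) (at x)) \<and> continuous_on UNIV G"

lemma C1_grad_continuous:
  assumes "C1_grad u G"
  shows "continuous_on UNIV u" "continuous_on UNIV G"
  using assms unfolding C1_grad_def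
  by (auto intro!: continuous_at_imp_continuous_on has_derivative_continuous)

lemma C1_grad_measurable:
  assumes "C1_grad u G"
  shows "u \<in> borel_measurable borel" "G \<in> borel_measurable borel"
  using C1_grad_continuous[OF assms] by (auto intro: borel_measurable_continuous_onI)

section \<open>Translation and Poincare estimates in L1\<close>

lemma nn_integral_lborel_translate:
  fixes f :: "'a::euclidean_space \<Rightarrow> ennreal"
  assumes [measurable]: "f \<in> borel_measurable borel"
  shows "(\<integral>\<^sup>+x. f (c + x) \<partial>lborel) = (\<integral>\<^sup>+x. f x \<partial>lborel)"
proof -
  have "(\<integral>\<^sup>+x. f x \<partial>lborel) = (\<integral>\<^sup>+x. f x \<partial>distr lborel borel ((+) c))"
    by (simp add: lborel_distr_plus)
  also have "\<dots> = (\<integral>\<^sup>+x. f (c + x) \<partial>lborel)"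
    by (rule nn_integral_distr) auto
  finally show ?thesis ..
qed

text \<open>Fundamental theorem of calculus on the segment from \<open>x\<close> to
  \<open>x + z\<close>. The bound is an extended integral over the whole line, ready for Tonelli's
  theorem.\<close>

lemma C1_grad_segment_le:
  assumes u: "C1_grad u G"
  shows "ennreal \<bar>u (x + z) - u x\<bar> \<le>
    (\<integral>\<^sup>+s. ennreal (norm z) * ennreal (norm (G (x + s *\<^sub>R z))) * indicator {0..1} s \<partial>lborel)"
proof -
  let ?f = "\<lambda>s::real. G (x + s *\<^sub>R z) \<bullet> z"
  have cont: "continuous_on UNIV ?f"
    by (intro continuous_intros continuous_on_compose2[OF C1_grad_continuous(2)[OF u]]) auto
  have "((\<lambda>s. u (x + s *\<^sub>R z)) has_vector_derivative ?f s) (at s within {0..1})" for s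
  proof -
    have 1: "(u has_derivative (\<lambda>h. G (x + s *\<^sub>R z) \<bullet> h)) (at (x + s *\<^sub>R z))"
      using u by (simp add: C1_grad_def)
    have 2: "((\<lambda>s. x + s *\<^sub>R z) has_derivative (\<lambda>h. h *\<^sub>R z)) (at s within {0..1})"
      by (auto intro!: derivative_eq_intros)
    from has_derivative_compose[OF 2 1] show ?thesis by (simp add: has_vector_derivative_def inner_commute)
  qed
  then have "u (x + z) - u x = (LINT s|lborel. indicator {0..1} s *\<^sub>R ?f s)"
    by (subst integral_FTC_atLeastAtMost) (auto intro: continuous_on_subset[OF cont])
  then have "ennreal \<bar>u (x + z) - u x\<bar> = ennreal (norm (LINT s|lborel. indicator {0..1} s *\<^sub>R ?f s))"
    by simp
  also have "\<dots> \<le> (\<integral>\<^sup>+s. norm (indicator {0..1} s *\<^sub>R ?f s) \<partial>lborel)"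
    by (intro integral_norm_bound_ennreal borel_integrable_compact continuous_on_subset[OF cont]) auto
  also have "\<dots> \<le> (\<integral>\<^sup>+s. ennreal (norm z) * ennreal (norm (G (x + s *\<^sub>R z))) * indicator {0..1} s \<partial>lborel)"
    by (intro nn_integral_mono)
      (auto simp: indicator_def ennreal_mult'[symmetric] intro!: ennreal_leI order_trans[OF Cauchy_Schwarz_ineq2])
  finally show ?thesis .
qed

text \<open>The segment bound is integrated over \<open>A\<close>; after exchanging the integrals,
  every slice in \<open>s\<close> is a translate of the integral over \<open>B\<close>, because the
  segments issuing from \<open>A\<close> stay in \<open>B\<close>.\<close>

lemma nn_integral_translate_diff_le:
  fixes u :: "'a::euclidean_space \<Rightarrow> real"
  assumes u: "C1_grad u G" and [measurable]: "A \<in> sets borel" "B \<in> sets borel"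
    and AB: "\<And>x s. x \<in> A \<Longrightarrow> 0 \<le> s \<Longrightarrow> s \<le> 1 \<Longrightarrow> x + s *\<^sub>R z \<in> B"
  shows "(\<integral>\<^sup>+x\<in>A. ennreal \<bar>u (x + z) - u x\<bar> \<partial>lborel) \<le> ennreal (norm z) * (\<integral>\<^sup>+x\<in>B. ennreal (norm (G x)) \<partial>lborel)"
proof -
  note [measurable] = C1_grad_measurable[OF u]
  let ?g = "\<lambda>x. ennreal (norm (G x)) * indicator B x"
  have "(\<integral>\<^sup>+x\<in>A. ennreal \<bar>u (x + z) - u x\<bar> \<partial>lborel)
      \<le> (\<integral>\<^sup>+x. (\<integral>\<^sup>+s. ennreal (norm z) * ?g (s *\<^sub>R z + x) * indicator {0..1} s \<partial>lborel) \<partial>lborel)"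
  proof (intro nn_integral_mono)
    fix x
    show "ennreal \<bar>u (x + z) - u x\<bar> * indicator A x
      \<le> (\<integral>\<^sup>+s. ennreal (norm z) * ?g (s *\<^sub>R z + x) * indicator {0..1} s \<partial>lborel)"
    proof (cases "x \<in> A")
      case True
      have "(\<integral>\<^sup>+s. ennreal (norm z) * ennreal (norm (G (x + s *\<^sub>R z))) * indicator {0..1} s \<partial>lborel)
         \<le> (\<integral>\<^sup>+s. ennreal (norm z) * ?g (s *\<^sub>R z + x) * indicator {0..1} s \<partial>lborel)"
        using AB[OF True] by (intro nn_integral_mono) (auto simp: indicator_def add.commute)
      from order_trans[OF C1_grad_segment_le[OF u] this] True show ?thesis by simp
    qed simp
  qed
  also have "\<dots> = (\<integral>\<^sup>+s. (\<integral>\<^sup>+x. ennreal (norm z) * ?g (s *\<^sub>R z + x) * indicator {0..1} s \<partial>lborel) \<partial>lborel)"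
    by (rule lborel_pair.Fubini') measurable
  also have "\<dots> = (\<integral>\<^sup>+(s::real). (ennreal (norm z) * (\<integral>\<^sup>+x. ?g x \<partial>lborel)) * indicator {0..1} s \<partial>lborel)"
  proof (intro nn_integral_cong)
    fix s :: real
    have "(\<integral>\<^sup>+x. ennreal (norm z) * ?g (s *\<^sub>R z + x) * indicator {0..1} s \<partial>lborel)
        = ennreal (norm z) * (\<integral>\<^sup>+x. ?g (s *\<^sub>R z + x) \<partial>lborel) * indicator {0..1} s"
      by (simp add: nn_integral_cmult nn_integral_multc)
    also have "(\<integral>\<^sup>+x. ?g (s *\<^sub>R z + x) \<partial>lborel) = (\<integral>\<^sup>+x. ?g x \<partial>lborel)"
      by (rule nn_integral_lborel_translate) measurable
    finally show "(\<integral>\<^sup>+x. ennreal (norm z) * ?g (s *\<^sub>R z + x) * indicator {0..1} s \<partial>lborel)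
      = ennreal (norm z) * (\<integral>\<^sup>+x. ?g x \<partial>lborel) * indicator {0..1} s" .
  qed
  also have "\<dots> = ennreal (norm z) * (\<integral>\<^sup>+x. ?g x \<partial>lborel)"
    by (subst nn_integral_cmult) auto
  finally show ?thesis .
qed

text \<open>With \<open>y = x + z\<close> only \<open>norm z < 2 * r\<close> matters, and each such
  \<open>z\<close> is handled by the translation estimate. Dropping the condition that
  \<open>x + z\<close> lies in the ball enlarges the domain to radius \<open>3 * r\<close>, a radius
  that reappears in the covering argument.\<close>

lemma Poincare_ball:
  fixes u :: "'a::euclidean_space \<Rightarrow> real"
  assumes u: "C1_grad u G" and r: "0 \<le> r"
  shows "(\<integral>\<^sup>+x\<in>ball a r. (\<integral>\<^sup>+y\<in>ball a r. ennreal \<bar>u x - u y\<bar> \<partial>lborel) \<partial>lborel)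
    \<le> emeasure lborel (ball (0::'a) (2 * r)) * ennreal (2 * r) * (\<integral>\<^sup>+x\<in>ball a (3 * r). ennreal (norm (G x)) \<partial>lborel)"
proof -
  note [measurable] = C1_grad_measurable[OF u]
  let ?B = "ball a r" and ?I = "\<integral>\<^sup>+x\<in>ball a (3 * r). ennreal (norm (G x)) \<partial>lborel"
  have [measurable]: "ball c r' \<in> sets borel" for c :: 'a and r' by simp
  have shift: "(\<integral>\<^sup>+z. ennreal \<bar>u x - u (x + z)\<bar> * indicator ?B (x + z) \<partial>lborel)
      = (\<integral>\<^sup>+y\<in>?B. ennreal \<bar>u x - u y\<bar> \<partial>lborel)" for x
    by (rule nn_integral_lborel_translate[where f = "\<lambda>y. ennreal \<bar>u x - u y\<bar> * indicator ?B y"]) measurable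
  have "(\<integral>\<^sup>+x\<in>?B. (\<integral>\<^sup>+y\<in>?B. ennreal \<bar>u x - u y\<bar> \<partial>lborel) \<partial>lborel)
     = (\<integral>\<^sup>+x\<in>?B. (\<integral>\<^sup>+z. ennreal \<bar>u x - u (x + z)\<bar> * indicator ?B (x + z) \<partial>lborel) \<partial>lborel)"
    by (simp only: shift)
  also have "\<dots> = (\<integral>\<^sup>+x. (\<integral>\<^sup>+z. ennreal \<bar>u x - u (x + z)\<bar> * indicator ?B (x + z) * indicator ?B x \<partial>lborel) \<partial>lborel)"
    by (simp add: nn_integral_multc)
  also have "\<dots> = (\<integral>\<^sup>+z. (\<integral>\<^sup>+x. ennreal \<bar>u x - u (x + z)\<bar> * indicator ?B (x + z) * indicator ?B x \<partial>lborel) \<partial>lborel)"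
    by (rule lborel_pair.Fubini') measurable
  also have "\<dots> \<le> (\<integral>\<^sup>+z. ennreal (2 * r) * ?I * indicator (ball (0::'a) (2 * r)) z \<partial>lborel)"
  proof (intro nn_integral_mono)
    fix z :: 'a
    show "(\<integral>\<^sup>+x. ennreal \<bar>u x - u (x + z)\<bar> * indicator ?B (x + z) * indicator ?B x \<partial>lborel)
       \<le> ennreal (2 * r) * ?I * indicator (ball 0 (2 * r)) z"
    proof (cases "norm z < 2 * r")
      case True
      have "(\<integral>\<^sup>+x. ennreal \<bar>u x - u (x + z)\<bar> * indicator ?B (x + z) * indicator ?B x \<partial>lborel)
         \<le> (\<integral>\<^sup>+x\<in>?B. ennreal \<bar>u (x + z) - u x\<bar> \<partial>lborel)"
        by (intro nn_integral_mono) (auto simp: indicator_def abs_minus_commute)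
      also have "\<dots> \<le> ennreal (norm z) * ?I"
      proof (rule nn_integral_translate_diff_le[OF u])
        fix x and s :: real assume "x \<in> ?B" "0 \<le> s" "s \<le> 1"
        moreover have "dist a (x + s *\<^sub>R z) \<le> dist a x + norm (s *\<^sub>R z)"
          using dist_triangle[of a "x + s *\<^sub>R z" x] by (simp add: dist_norm)
        moreover have "norm (s *\<^sub>R z) \<le> norm z"
          using \<open>0 \<le> s\<close> \<open>s \<le> 1\<close> by (simp add: mult_left_le_one_le)
        ultimately show "x + s *\<^sub>R z \<in> ball a (3 * r)" using True by simp
      qed auto
      also have "\<dots> \<le> ennreal (2 * r) * ?I"
        using True by (intro mult_right_mono ennreal_leI) auto
      finally show ?thesis using True by simp
    next
      case False
      have "ennreal \<bar>u x - u (x + z)\<bar> * indicator ?B (x + z) * indicator ?B x = 0" for x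
      proof -
        have "norm z \<le> dist a x + dist a (x + z)"
          using dist_triangle3[of x "x + z" a] by (simp add: dist_norm)
        then show ?thesis using False by (auto simp: indicator_def)
      qed
      then show ?thesis by (simp only: nn_integral_const mult_zero_left zero_le)
    qed
  qed
  also have "\<dots> = emeasure lborel (ball (0::'a) (2 * r)) * ennreal (2 * r) * ?I"
    by (subst nn_integral_cmult) (auto simp: mult_ac)
  finally show ?thesis .
qed

section \<open>Smooth steps and superlevel sets\<close>

lemma ennreal_liminf_cmult:
  fixes c :: ennreal
  assumes "c < \<infinity>"
  shows "liminf (\<lambda>n. c * f n) = c * liminf f"
  using assms
  by (intro Liminf_compose_continuous_mono[where f = "\<lambda>x. c * x"] ennreal_continuous_on_cmult)
     (auto simp: mono_def mult_left_mono continuous_on_id)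

lemma suminf_liminf_le:
  fixes a :: "nat \<Rightarrow> nat \<Rightarrow> ennreal"
  shows "(\<Sum>i. liminf (\<lambda>n. a n i)) \<le> liminf (\<lambda>n. \<Sum>i. a n i)"
  using nn_integral_liminf[of a "count_space UNIV"] by (simp add: nn_integral_count_space_nat)

lemma emeasure_lborel_ball_conv_unit_ball:
  assumes "0 \<le> r"
  shows "emeasure lborel (ball (a::'a::euclidean_space) r) = ennreal (r ^ DIM('a) * measure lborel (ball (0::'a) 1))"
  using emeasure_lborel_ball_finite[of a r] content_ball_conv_unit_ball[OF assms, of a]
  by (subst emeasure_eq_ennreal_measure) auto

text \<open>A smooth approximation, for large \<open>n\<close>, of the indicator of
  \<open>{t<..}\<close>; at \<open>t\<close> itself its value is \<open>1 / 2\<close> for every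
  \<open>n\<close>.\<close>

definition arctan_step :: "real \<Rightarrow> real \<Rightarrow> real \<Rightarrow> real" where
  "arctan_step n t y = 1 / 2 + arctan (n * (y - t)) / pi"

text \<open>Besides being the derivative in \<open>y\<close>, it is, as a function of
  \<open>t\<close> and for \<open>n > 0\<close>, the Cauchy probability density centred at
  \<open>y\<close>; hence its integral over all levels is at most \<open>1\<close>.\<close>

definition arctan_step_deriv :: "real \<Rightarrow> real \<Rightarrow> real \<Rightarrow> real" where
  "arctan_step_deriv n t y = n / (pi * (1 + (n * (y - t))\<^sup>2))"

lemma has_real_derivative_arctan_step:
  "((\<lambda>y. arctan_step n t y) has_real_derivative arctan_step_deriv n t y) (at y)"
proof -
  have "((\<lambda>y. arctan (n * (y - t))) has_real_derivative n / (1 + (n * (y - t))\<^sup>2)) (at y)"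
    by (auto intro!: derivative_eq_intros simp: inverse_eq_divide)
  from DERIV_add[OF DERIV_const[of "1 / 2"] DERIV_cdivide[OF this, of pi]] show ?thesis
    unfolding arctan_step_def arctan_step_deriv_def by (simp add: mult.commute)
qed

lemma add_1_sq_neq_0: "1 + (x::real)\<^sup>2 \<noteq> 0"
  using zero_le_power2[of x] by linarith

lemma C1_grad_arctan_step:
  assumes u: "C1_grad u G"
  shows "C1_grad (\<lambda>x. arctan_step n t (u x)) (\<lambda>x. arctan_step_deriv n t (u x) *\<^sub>R G x)"
  unfolding C1_grad_def
proof safe
  fix x
  have 1: "(u has_derivative (\<lambda>h. G x \<bullet> h)) (at x)" using u by (simp add: C1_grad_def)
  have 2: "((\<lambda>y. arctan_step n t y) has_derivative (\<lambda>h. h * arctan_step_deriv n t (u x))) (at (u x))"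
    using has_real_derivative_arctan_step[of n t "u x"] by (simp add: has_field_derivative_def mult_commute_abs)
  show "((\<lambda>x. arctan_step n t (u x)) has_derivative (\<lambda>h. (arctan_step_deriv n t (u x) *\<^sub>R G x) \<bullet> h)) (at x)"
    using has_derivative_compose[OF 1 2] by (simp add: mult.commute)
  show "continuous_on UNIV (\<lambda>x. arctan_step_deriv n t (u x) *\<^sub>R G x)"
    unfolding arctan_step_deriv_def
    by (intro continuous_intros C1_grad_continuous[OF u]) (auto simp: add_1_sq_neq_0)
qed

text \<open>The limits \<open>1\<close> above the level and at most \<open>1 / 2\<close> at or below
  it leave a gap of \<open>1 / 2\<close>, which is the factor on the left of
  \<open>superlevel_ball_le\<close>.\<close>

lemma arctan_step_tendsto:
  shows "t < y \<Longrightarrow> (\<lambda>n. arctan_step (real n) t y) \<longlonglongrightarrow> 1"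
    and "y \<le> t \<Longrightarrow> \<exists>l\<le>1/2. (\<lambda>n. arctan_step (real n) t y) \<longlonglongrightarrow> l"
proof -
  assume "t < y"
  have "filterlim (\<lambda>n. real n * (y - t)) at_top sequentially"
    using \<open>t < y\<close> by (intro filterlim_at_top_mult_tendsto_pos[OF tendsto_const] filterlim_real_sequentially) auto
  then have "(\<lambda>n. arctan (real n * (y - t))) \<longlonglongrightarrow> pi / 2"
    by (rule filterlim_compose[OF tendsto_arctan_at_top])
  then have "(\<lambda>n. arctan_step (real n) t y) \<longlonglongrightarrow> 1 / 2 + pi / 2 / pi"
    unfolding arctan_step_def by (intro tendsto_intros) auto
  then show "(\<lambda>n. arctan_step (real n) t y) \<longlonglongrightarrow> 1" by simp
next
  assume "y \<le> t"
  show "\<exists>l\<le>1/2. (\<lambda>n. arctan_step (real n) t y) \<longlonglongrightarrow> l"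
  proof (cases "y = t")
    case True then show ?thesis by (intro exI[of _ "1/2"]) (simp add: arctan_step_def)
  next
    case False
    with \<open>y \<le> t\<close> have "filterlim (\<lambda>n. real n * (t - y)) at_top sequentially"
      by (intro filterlim_at_top_mult_tendsto_pos[OF tendsto_const] filterlim_real_sequentially) auto
    then have "(\<lambda>n. arctan (real n * (t - y))) \<longlonglongrightarrow> pi / 2"
      by (rule filterlim_compose[OF tendsto_arctan_at_top])
    then have "(\<lambda>n. 1 / 2 - arctan (real n * (t - y)) / pi) \<longlonglongrightarrow> 1 / 2 - pi / 2 / pi"
      by (intro tendsto_intros) auto
    moreover have "arctan_step (real n) t y = 1 / 2 - arctan (real n * (t - y)) / pi" for n
      unfolding arctan_step_def using arctan_minus[of "real n * (t - y)"]
      by (simp add: algebra_simps)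
    ultimately show ?thesis by (intro exI[of _ 0]) simp
  qed
qed

text \<open>The relative isoperimetric inequality for superlevel sets, with the perimeter replaced by the
  limit inferior of the total variations of smooth approximations of the indicator; this avoids the
  coarea formula.\<close>

lemma superlevel_ball_le:
  fixes u :: "'a::euclidean_space \<Rightarrow> real"
  assumes u: "C1_grad u G" and r: "0 \<le> r" and U: "U = {x. t < u x}"
  shows "ennreal (1 / 2) * (emeasure lborel (U \<inter> ball a r) * emeasure lborel (ball a r - U))
    \<le> emeasure lborel (ball (0::'a) (2 * r)) * ennreal (2 * r) *
      liminf (\<lambda>n. \<integral>\<^sup>+x\<in>ball a (3 * r). ennreal (norm (arctan_step_deriv (real n) t (u x) *\<^sub>R G x)) \<partial>lborel)"
proof -
  note [measurable] = C1_grad_measurable[OF u]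
  let ?B = "ball a r" and ?c = "emeasure lborel (ball (0::'a) (2 * r)) * ennreal (2 * r)"
  let ?D = "\<lambda>n x. arctan_step_deriv (real n) t (u x) *\<^sub>R G x"
  have [measurable]: "ball c r' \<in> sets borel" for c :: 'a and r' by simp
  have Um[measurable]: "U \<in> sets borel" unfolding U by measurable
  define v where "v n x = arctan_step (real n) t (u x)" for n x
  have v: "C1_grad (v n) (?D n)" for n
    unfolding v_def by (rule C1_grad_arctan_step[OF u])
  note [measurable] = C1_grad_measurable[OF v]
  define S where "S = (U \<inter> ?B) \<times> (?B - U)"
  have Sm[measurable]: "S \<in> sets (lborel \<Otimes>\<^sub>M lborel)" unfolding S_def by measurable
  have "ennreal (1 / 2) * (emeasure lborel (U \<inter> ?B) * emeasure lborel (?B - U))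
      = ennreal (1 / 2) * emeasure (lborel \<Otimes>\<^sub>M lborel) S"
    unfolding S_def by (subst lborel.emeasure_pair_measure_Times) auto
  also have "\<dots> = (\<integral>\<^sup>+p\<in>S. ennreal (1 / 2) \<partial>(lborel \<Otimes>\<^sub>M lborel))"
    by (rule nn_integral_cmult_indicator[symmetric]) measurable
  \<comment> \<open>On \<open>S\<close> the first point is above the level and the second is not, so
    the differences tend to at least \<open>1 / 2\<close>; Fatou's lemma then takes the limit out of
    the integral.\<close>
  also have "\<dots> \<le> (\<integral>\<^sup>+p. liminf (\<lambda>n. ennreal \<bar>v n (fst p) - v n (snd p)\<bar> * indicator S p) \<partial>(lborel \<Otimes>\<^sub>M lborel))"
  proof (intro nn_integral_mono)
    fix p
    show "ennreal (1 / 2) * indicator S p \<le> liminf (\<lambda>n. ennreal \<bar>v n (fst p) - v n (snd p)\<bar> * indicator S p)"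
    proof (cases "p \<in> S")
      case True
      then have "t < u (fst p)" "u (snd p) \<le> t" unfolding S_def U by auto
      then obtain l where l: "l \<le> 1 / 2" "(\<lambda>n. v n (snd p)) \<longlonglongrightarrow> l" "(\<lambda>n. v n (fst p)) \<longlonglongrightarrow> 1"
        unfolding v_def using arctan_step_tendsto by blast
      then have "(\<lambda>n. ennreal \<bar>v n (fst p) - v n (snd p)\<bar>) \<longlonglongrightarrow> ennreal \<bar>1 - l\<bar>"
        by (intro tendsto_intros tendsto_ennrealI)
      then have "liminf (\<lambda>n. ennreal \<bar>v n (fst p) - v n (snd p)\<bar>) = ennreal \<bar>1 - l\<bar>"
        by (rule lim_imp_Liminf[rotated]) simp
      moreover have "ennreal (1 / 2) \<le> ennreal \<bar>1 - l\<bar>" using l(1) by (intro ennreal_leI) auto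
      ultimately show ?thesis using True by simp
    qed simp
  qed
  also have "\<dots> \<le> liminf (\<lambda>n. \<integral>\<^sup>+p. ennreal \<bar>v n (fst p) - v n (snd p)\<bar> * indicator S p \<partial>(lborel \<Otimes>\<^sub>M lborel))"
    by (rule nn_integral_liminf) measurable
  also have "\<dots> \<le> liminf (\<lambda>n. ?c * (\<integral>\<^sup>+x\<in>ball a (3 * r). ennreal (norm (?D n x)) \<partial>lborel))"
  proof (intro Liminf_mono always_eventually allI)
    fix n
    have "(\<integral>\<^sup>+p. ennreal \<bar>v n (fst p) - v n (snd p)\<bar> * indicator S p \<partial>(lborel \<Otimes>\<^sub>M lborel))
        = (\<integral>\<^sup>+x. (\<integral>\<^sup>+y. ennreal \<bar>v n x - v n y\<bar> * indicator S (x, y) \<partial>lborel) \<partial>lborel)"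
      by (subst lborel.nn_integral_fst[symmetric]) auto
    also have "\<dots> \<le> (\<integral>\<^sup>+x\<in>?B. (\<integral>\<^sup>+y\<in>?B. ennreal \<bar>v n x - v n y\<bar> \<partial>lborel) \<partial>lborel)"
    proof (intro nn_integral_mono)
      fix x
      have "(\<integral>\<^sup>+y. ennreal \<bar>v n x - v n y\<bar> * indicator S (x, y) \<partial>lborel)
          \<le> (\<integral>\<^sup>+y. (ennreal \<bar>v n x - v n y\<bar> * indicator ?B y) * indicator ?B x \<partial>lborel)"
        by (intro nn_integral_mono) (auto simp: S_def indicator_def)
      also have "\<dots> = (\<integral>\<^sup>+y\<in>?B. ennreal \<bar>v n x - v n y\<bar> \<partial>lborel) * indicator ?B x"
        by (rule nn_integral_multc) measurable
      finally show "(\<integral>\<^sup>+y. ennreal \<bar>v n x - v n y\<bar> * indicator S (x, y) \<partial>lborel)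
          \<le> (\<integral>\<^sup>+y\<in>?B. ennreal \<bar>v n x - v n y\<bar> \<partial>lborel) * indicator ?B x" .
    qed
    also have "\<dots> \<le> ?c * (\<integral>\<^sup>+x\<in>ball a (3 * r). ennreal (norm (?D n x)) \<partial>lborel)"
      by (rule Poincare_ball[OF v r])
    finally show "(\<integral>\<^sup>+p. ennreal \<bar>v n (fst p) - v n (snd p)\<bar> * indicator S p \<partial>(lborel \<Otimes>\<^sub>M lborel))
      \<le> ?c * (\<integral>\<^sup>+x\<in>ball a (3 * r). ennreal (norm (?D n x)) \<partial>lborel)" .
  qed
  also have "\<dots> = ?c * liminf (\<lambda>n. \<integral>\<^sup>+x\<in>ball a (3 * r). ennreal (norm (?D n x)) \<partial>lborel)"
    using emeasure_lborel_ball_finite[of "0::'a" "2 * r"]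
    by (intro ennreal_liminf_cmult) (auto simp: ennreal_mult_less_top)
  finally show ?thesis .
qed

section \<open>Balls of intermediate density and the boxing inequality\<close>

lemma exists_radius_half_density:
  fixes U :: "'a::euclidean_space set"
  assumes U: "open U" "x \<in> U" and R: "0 < R"
  defines "K \<equiv> measure lborel (ball (0::'a) 1)"
  shows "\<exists>r. 0 < r \<and> r \<le> R \<and> K * r ^ DIM('a) / (2 * 2 ^ DIM('a)) \<le> measure lborel (U \<inter> ball x r) \<and>
    (r = R \<or> measure lborel (U \<inter> ball x r) \<le> K * r ^ DIM('a) / 2)"
proof -
  let ?N = "DIM('a)"
  define m where "m r = measure lborel (U \<inter> ball x r)" for r
  have K: "K > 0" unfolding K_def by (rule content_ball_pos) simp
  have cb: "measure lborel (ball x r) = K * r ^ ?N" if "0 \<le> r" for r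
    using content_ball_conv_unit_ball[OF that, of x] by (simp add: K_def mult.commute)
  have fin: "emeasure lborel (U \<inter> ball x r) < \<infinity>" for r
    using emeasure_mono[of "U \<inter> ball x r" "ball x r" lborel] emeasure_lborel_ball_finite[of x r]
    by (auto intro: le_less_trans)
  have mono: "m r \<le> m r'" if "r \<le> r'" for r r'
    unfolding m_def using that fin[of r'] U(1)
    by (intro measure_mono_fmeasurable) (auto simp: fmeasurable_def)
  \<comment> \<open>The radii \<open>R / 2 ^ k\<close> are scanned for the first one at which
    \<open>U\<close> fills half of the ball; it exists because \<open>U\<close> is open. At the
    radius before it \<open>U\<close> fills at most half, but still the fraction
    \<open>1 / (2 * 2 ^ N)\<close>, already inside the ball of half the radius. If the first such
    radius is \<open>R\<close> itself, the upper bound is given up.\<close>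
  define P where "P k \<longleftrightarrow> K * (R / 2 ^ k) ^ ?N / 2 \<le> m (R / 2 ^ k)" for k :: nat
  obtain e where e: "e > 0" "ball x e \<subseteq> U" using U openE by blast
  obtain k where "R / e < 2 ^ k" using real_arch_pow[of 2 "R / e"] by auto
  then have "R / 2 ^ k \<le> e" using e by (simp add: field_simps)
  then have "U \<inter> ball x (R / 2 ^ k) = ball x (R / 2 ^ k)" using e by auto
  then have "P k" unfolding P_def m_def using cb[of "R / 2 ^ k"] R K by simp
  define j where "j = (LEAST k. P k)"
  have j: "P j" "\<And>i. i < j \<Longrightarrow> \<not> P i"
    unfolding j_def using \<open>P k\<close> by (auto intro: LeastI dest: not_less_Least)
  show ?thesis
  proof (cases j)
    case 0
    have "K * R ^ ?N / (2 * 2 ^ ?N) \<le> K * R ^ ?N / 2"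
      using K R by (intro divide_left_mono) auto
    also have "\<dots> \<le> m R" using j(1) 0 by (simp add: P_def)
    finally show ?thesis using R by (intro exI[of _ R]) (simp add: m_def)
  next
    case (Suc i)
    let ?r = "R / 2 ^ i"
    have "K * ?r ^ ?N / (2 * 2 ^ ?N) = K * (R / 2 ^ j) ^ ?N / 2"
      by (simp add: Suc power_divide power_mult_distrib)
    also have "\<dots> \<le> m (R / 2 ^ j)" using j(1) by (simp add: P_def)
    also have "\<dots> \<le> m ?r" using R by (intro mono) (simp add: Suc field_simps)
    finally have 1: "K * ?r ^ ?N / (2 * 2 ^ ?N) \<le> m ?r" .
    have 2: "m ?r \<le> K * ?r ^ ?N / 2" using j(2)[of i] Suc by (simp add: P_def)
    have "?r \<le> R" using R by (simp add: field_simps)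
    then show ?thesis using 1 2 R unfolding m_def by (intro exI[of _ ?r]) auto
  qed
qed

text \<open>Where \<open>U\<close> fills at most half of the ball, the relative isoperimetric
  inequality bounds a product of two volumes of order \<open>r ^ N\<close> by
  \<open>r ^ (N + 1)\<close> times the gradient term. At the maximal radius the volume of
  \<open>U\<close> alone is of order \<open>r ^ N = R * r ^ (N - 1)\<close>, which is the origin of
  the second term.\<close>

lemma radius_power_le:
  fixes u :: "'a::euclidean_space \<Rightarrow> real"
  assumes u: "C1_grad u G" and U: "U = {x. t < u x}" and r: "0 < r"
  defines "K \<equiv> measure lborel (ball (0::'a) 1)"
  assumes lower: "K * r ^ DIM('a) / (2 * 2 ^ DIM('a)) \<le> measure lborel (U \<inter> ball a r)"
    and upper: "r = R \<or> measure lborel (U \<inter> ball a r) \<le> K * r ^ DIM('a) / 2"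
  shows "ennreal (r ^ (DIM('a) - 1)) \<le> ennreal (16 * 4 ^ DIM('a) / K) *
    (liminf (\<lambda>n. \<integral>\<^sup>+x\<in>ball a (3 * r). ennreal (norm (arctan_step_deriv (real n) t (u x) *\<^sub>R G x)) \<partial>lborel) +
     ennreal (1 / (16 * R)) * emeasure lborel (U \<inter> ball a (3 * r)))"
proof -
  note [measurable] = C1_grad_measurable[OF u]
  let ?N = "DIM('a)"
  define L where "L = liminf (\<lambda>n. \<integral>\<^sup>+x\<in>ball a (3 * r).
    ennreal (norm (arctan_step_deriv (real n) t (u x) *\<^sub>R G x)) \<partial>lborel)"
  have K: "K > 0" unfolding K_def by (rule content_ball_pos) simp
  have N: "r ^ ?N = r * r ^ (?N - 1)" using DIM_positive[where 'a='a] by (metis Suc_diff_1 power_Suc)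
  have [measurable]: "ball c r' \<in> sets borel" for c :: 'a and r' by simp
  have [measurable]: "U \<in> sets borel" unfolding U by measurable
  have fin: "emeasure lborel (U \<inter> ball a r) < \<infinity>" for r
    using emeasure_mono[of "U \<inter> ball a r" "ball a r" lborel] emeasure_lborel_ball_finite[of a r]
    by (auto intro: le_less_trans)
  define m where "m = measure lborel (U \<inter> ball a r)"
  have m: "emeasure lborel (U \<inter> ball a r) = ennreal m"
    unfolding m_def using fin[of r] by (intro emeasure_eq_ennreal_measure) auto
  have m0: "0 \<le> m" by (simp add: m_def)
  have cb: "emeasure lborel (ball c r) = ennreal (K * r ^ ?N)" if "0 \<le> r" for c :: 'a and r
    using emeasure_lborel_ball_conv_unit_ball[OF that, of c] by (simp add: K_def mult.commute)
  show ?thesis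
  proof (cases "r = R")
    case True
    have "r ^ (?N - 1) = r ^ ?N / r" using r by (simp add: N)
    also have "\<dots> = r ^ ?N / R" using True by simp
    also have "\<dots> \<le> (2 * 2 ^ ?N * m / K) / R"
      using lower K r True by (intro divide_right_mono) (simp_all add: m_def field_simps)
    also have "\<dots> = (2 ^ ?N * 2) * (m / (K * R))" by simp
    \<comment> \<open>Here \<open>2 \<le> 2 ^ N\<close> is used, so that both cases share the factor
      \<open>4 ^ N\<close>.\<close>
    also have "\<dots> \<le> (2 ^ ?N * 2 ^ ?N) * (m / (K * R))"
      using DIM_positive[where 'a='a] K r True m0 self_le_power[of "2::real" ?N]
      by (intro mult_right_mono mult_left_mono) auto
    also have "2 ^ ?N * 2 ^ ?N = (4 ^ ?N :: real)" by (simp add: power_mult_distrib[symmetric])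
    also have "4 ^ ?N * (m / (K * R)) = 16 * 4 ^ ?N / K * (1 / (16 * R) * m)" by simp
    finally have "ennreal (r ^ (?N - 1)) \<le> ennreal (16 * 4 ^ ?N / K) * (ennreal (1 / (16 * R)) * ennreal m)"
      using K r True m0 by (simp add: ennreal_mult[symmetric])
    also have "ennreal m \<le> emeasure lborel (U \<inter> ball a (3 * r))"
      unfolding m[symmetric] using r by (intro emeasure_mono) auto
    also have "ennreal (1 / (16 * R)) * emeasure lborel (U \<inter> ball a (3 * r))
      \<le> L + ennreal (1 / (16 * R)) * emeasure lborel (U \<inter> ball a (3 * r))" by simp
    finally show ?thesis unfolding L_def by (simp add: mult_left_mono)
  next
    case False
    with upper have upper: "m \<le> K * r ^ ?N / 2" by (simp add: m_def)
    have "emeasure lborel (ball a r - U) = emeasure lborel (ball a r - (U \<inter> ball a r))"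
      by (intro arg_cong[where f = "emeasure lborel"]) auto
    also have "\<dots> = ennreal (K * r ^ ?N) - ennreal m"
      using fin[of r] by (subst emeasure_Diff) (auto simp: cb m less_imp_le[OF r])
    also have "\<dots> = ennreal (K * r ^ ?N - m)" by (simp add: ennreal_minus m0)
    finally have m': "emeasure lborel (ball a r - U) = ennreal (K * r ^ ?N - m)" .
    have main: "ennreal (1 / 2) * (ennreal m * ennreal (K * r ^ ?N - m))
        \<le> ennreal (K * (2 * r) ^ ?N) * ennreal (2 * r) * L"
      using superlevel_ball_le[OF u less_imp_le[OF r] U, of a] r unfolding L_def m m' cb by (simp add: cb)
    have "ennreal (r ^ (?N - 1)) \<le> ennreal (16 * 4 ^ ?N / K) * L"
    proof (cases L)
      case (real l)
      have "0 \<le> K * r ^ ?N" using K r by simp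
      with upper have up: "m \<le> K * r ^ ?N" by linarith
      have "ennreal (1 / 2 * (m * (K * r ^ ?N - m))) = ennreal (1 / 2) * (ennreal m * ennreal (K * r ^ ?N - m))"
        using ennreal_mult'[of "1 / 2" "m * (K * r ^ ?N - m)"] ennreal_mult'[OF m0, of "K * r ^ ?N - m"] by simp
      moreover have "ennreal (K * (2 * r) ^ ?N * (2 * r) * l) = ennreal (K * (2 * r) ^ ?N) * ennreal (2 * r) * ennreal l"
        using K r real by (simp add: ennreal_mult)
      ultimately have "ennreal (1 / 2 * (m * (K * r ^ ?N - m))) \<le> ennreal (K * (2 * r) ^ ?N * (2 * r) * l)"
        using main real by simp
      then have "1 / 2 * (m * (K * r ^ ?N - m)) \<le> K * (2 * r) ^ ?N * (2 * r) * l"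
        using K r real by (subst (asm) ennreal_le_iff) auto
      \<comment> \<open>The factors \<open>1 / 2\<close>, \<open>1 / (2 * 2 ^ N)\<close> and
        \<open>1 / 2\<close> on the left and \<open>2 * 2 ^ N\<close> on the right combine to the
        constant \<open>16 * 4 ^ N\<close>.\<close>
      moreover have "K * r ^ ?N / (2 * 2 ^ ?N) * (K * r ^ ?N / 2) \<le> m * (K * r ^ ?N - m)"
        using lower upper K r m0 by (intro mult_mono) (auto simp: m_def)
      ultimately have "1 / 2 * (K * r ^ ?N / (2 * 2 ^ ?N) * (K * r ^ ?N / 2)) \<le> K * (2 * r) ^ ?N * (2 * r) * l"
        by linarith
      also have "1 / 2 * (K * r ^ ?N / (2 * 2 ^ ?N) * (K * r ^ ?N / 2)) = (K * r ^ ?N) * (K * r ^ ?N / (8 * 2 ^ ?N))"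
        by simp
      also have "K * (2 * r) ^ ?N * (2 * r) * l = (K * r ^ ?N) * (2 ^ ?N * (2 * r) * l)"
        by (simp add: power_mult_distrib)
      finally have "K * r ^ ?N / (8 * 2 ^ ?N) \<le> 2 ^ ?N * (2 * r) * l"
        by (rule mult_left_le_imp_le) (use K r in simp)
      then have "r * (K * r ^ (?N - 1)) \<le> r * (16 * (2 ^ ?N * 2 ^ ?N) * l)"
        unfolding N by (simp add: field_simps)
      then have "K * r ^ (?N - 1) \<le> 16 * (2 ^ ?N * 2 ^ ?N) * l"
        using r by (simp only: mult_le_cancel_left_pos)
      moreover have "2 ^ ?N * 2 ^ ?N = (4 ^ ?N :: real)" by (simp add: power_mult_distrib[symmetric])
      ultimately have "r ^ (?N - 1) \<le> 16 * 4 ^ ?N / K * l" using K by (simp add: field_simps)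
      then show ?thesis using real K by (auto simp: ennreal_mult[symmetric] intro!: ennreal_leI)
    next
      case top
      then show ?thesis using K by (simp add: ennreal_mult_top)
    qed
    also have "\<dots> \<le> ennreal (16 * 4 ^ ?N / K) * (L + ennreal (1 / (16 * R)) * emeasure lborel (U \<inter> ball a (3 * r)))"
      by (intro mult_left_mono) auto
    finally show ?thesis unfolding L_def .
  qed
qed

text \<open>The second factor is the constant of \<open>radius_power_le\<close>. The first comes
  from the growth condition at radius \<open>16 * r\<close>: a Vitali ball of radius
  \<open>3 * r\<close> is enlarged to radius \<open>15 * r\<close>, rounded up to
  \<open>16 * r\<close>.\<close>

definition trace_const :: "'a::euclidean_space itself \<Rightarrow> real" where
  "trace_const _ = 16 ^ (DIM('a) - 1) * (16 * 4 ^ DIM('a) / measure lborel (ball (0::'a) 1))"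

lemma trace_const_pos: "trace_const TYPE('a::euclidean_space) > 0"
  unfolding trace_const_def by (simp add: content_ball_pos)

text \<open>Boxing inequality: the superlevel set is covered by balls that it fills to a proportion
  bounded away from \<open>0\<close> and \<open>1\<close>, except for those of the largest admissible radius.\<close>

lemma emeasure_superlevel_le:
  fixes u :: "'a::euclidean_space \<Rightarrow> real" and \<nu> :: "'a measure"
  assumes u: "C1_grad u G" and \<nu>: "finite_measure \<nu>" and sets[measurable_cong]: "sets \<nu> = sets borel"
    and \<delta>: "0 < \<delta>" and \<eta>: "0 \<le> \<eta>"
    and growth: "\<And>x r. 0 < r \<Longrightarrow> r \<le> \<delta> \<Longrightarrow> measure \<nu> (ball x r) \<le> \<eta> * r ^ (DIM('a) - 1)"
  shows "emeasure \<nu> {x. t < u x} \<le> ennreal (\<eta> * trace_const TYPE('a)) *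
    (liminf (\<lambda>n. \<integral>\<^sup>+x. ennreal (norm (arctan_step_deriv (real n) t (u x) *\<^sub>R G x)) \<partial>lborel) +
     ennreal (1 / \<delta>) * emeasure lborel {x. t < u x})"
proof -
  interpret finite_measure \<nu> by fact
  note [measurable] = C1_grad_measurable[OF u]
  let ?N = "DIM('a)" and ?U = "{x. t < u x}"
  define K where "K = measure lborel (ball (0::'a) 1)"
  \<comment> \<open>Balls of radius at most \<open>16 * R\<close> are then within the range of
    \<open>growth\<close>, and \<open>1 / (16 * R)\<close> becomes
    \<open>1 / \<delta>\<close>.\<close>
  define R where "R = \<delta> / 16"
  define c where "c = ennreal (16 * 4 ^ ?N / K)"
  have K: "K > 0" unfolding K_def by (rule content_ball_pos) simp
  have R: "0 < R" using \<delta> by (simp add: R_def)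
  have [measurable]: "ball c r' \<in> sets borel" for c :: 'a and r' by simp
  have Um[measurable]: "?U \<in> sets borel" by measurable
  have Uo: "open ?U"
    by (intro open_Collect_less continuous_on_const C1_grad_continuous[OF u])
  define g where "g n x = ennreal (norm (arctan_step_deriv (real n) t (u x) *\<^sub>R G x))" for n x
  have gm[measurable]: "g n \<in> borel_measurable borel" for n
    unfolding g_def using C1_grad_measurable(2)[OF C1_grad_arctan_step[OF u]] by measurable
  have "\<forall>x\<in>?U. \<exists>r. 0 < r \<and> r \<le> R \<and> K * r ^ ?N / (2 * 2 ^ ?N) \<le> measure lborel (?U \<inter> ball x r) \<and>
    (r = R \<or> measure lborel (?U \<inter> ball x r) \<le> K * r ^ ?N / 2)"
    unfolding K_def using exists_radius_half_density[OF Uo _ R] by blast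
  then obtain r where r: "\<And>x. x \<in> ?U \<Longrightarrow> 0 < r x \<and> r x \<le> R \<and>
      K * r x ^ ?N / (2 * 2 ^ ?N) \<le> measure lborel (?U \<inter> ball x (r x)) \<and>
      (r x = R \<or> measure lborel (?U \<inter> ball x (r x)) \<le> K * r x ^ ?N / 2)"
    by metis
  \<comment> \<open>The balls of radius \<open>3 * r x\<close> are the ones selected to be disjoint,
    because the gradient integrals of \<open>radius_power_le\<close> live on them and are to be
    summed.\<close>
  obtain y :: "nat \<Rightarrow> 'a" and \<rho> where y: "\<And>n. \<rho> n = 0 \<or> y n \<in> ?U \<and> \<rho> n = 3 * r (y n)"
    "disjoint_family (\<lambda>n. ball (y n) (\<rho> n))" "?U \<subseteq> (\<Union>n. ball (y n) (5 * \<rho> n))"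
  proof (rule Vitali_covering_sequence[of ?U "\<lambda>x. 3 * r x" "3 * R"])
    show "0 < 3 * r x \<and> 3 * r x \<le> 3 * R" if "x \<in> ?U" for x using r[OF that] by simp
  qed blast
  define I where "I n i = (\<integral>\<^sup>+x\<in>ball (y i) (\<rho> i). g n x \<partial>lborel)" for n i
  define J where "J i = emeasure lborel (?U \<inter> ball (y i) (\<rho> i))" for i
  have each: "emeasure \<nu> (ball (y i) (5 * \<rho> i))
      \<le> ennreal (\<eta> * 16 ^ (?N - 1)) * (c * (liminf (\<lambda>n. I n i) + ennreal (1 / \<delta>) * J i))" for i
  proof (cases "\<rho> i = 0")
    case False
    then have yi: "y i \<in> ?U" and \<rho>i: "\<rho> i = 3 * r (y i)" using y(1)[of i] by auto
    note ri = r[OF yi]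
    have "emeasure \<nu> (ball (y i) (5 * \<rho> i)) \<le> emeasure \<nu> (ball (y i) (16 * r (y i)))"
      using \<rho>i ri by (intro emeasure_mono) (auto intro!: subset_ball)
    also have "\<dots> = ennreal (measure \<nu> (ball (y i) (16 * r (y i))))" by (simp add: emeasure_eq_measure)
    also have "\<dots> \<le> ennreal (\<eta> * (16 * r (y i)) ^ (?N - 1))"
      using ri by (intro ennreal_leI growth) (auto simp: R_def)
    also have "\<dots> = ennreal (\<eta> * 16 ^ (?N - 1)) * ennreal (r (y i) ^ (?N - 1))"
      using \<eta> ri by (simp add: power_mult_distrib ennreal_mult[symmetric] mult.assoc)
    also have "ennreal (r (y i) ^ (?N - 1)) \<le> c * (liminf (\<lambda>n. I n i) + ennreal (1 / (16 * R)) * J i)"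
      unfolding c_def I_def J_def g_def \<rho>i K_def
      by (rule radius_power_le[OF u refl]) (use ri in \<open>auto simp: K_def\<close>)
    finally show ?thesis by (simp add: mult_left_mono R_def)
  qed simp
  have "emeasure \<nu> ?U \<le> emeasure \<nu> (\<Union>i. ball (y i) (5 * \<rho> i))"
    using y(3) by (intro emeasure_mono) auto
  also have "\<dots> \<le> (\<Sum>i. emeasure \<nu> (ball (y i) (5 * \<rho> i)))"
    by (intro emeasure_subadditive_countably) auto
  also have "\<dots> \<le> (\<Sum>i. ennreal (\<eta> * 16 ^ (?N - 1)) * (c * (liminf (\<lambda>n. I n i) + ennreal (1 / \<delta>) * J i)))"
    by (intro suminf_le each) auto
  also have "\<dots> = ennreal (\<eta> * 16 ^ (?N - 1)) * (c * ((\<Sum>i. liminf (\<lambda>n. I n i)) + ennreal (1 / \<delta>) * (\<Sum>i. J i)))"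
    by (simp add: suminf_add[symmetric])
  also have "\<dots> \<le> ennreal (\<eta> * 16 ^ (?N - 1)) * (c * (liminf (\<lambda>n. \<integral>\<^sup>+x. g n x \<partial>lborel) + ennreal (1 / \<delta>) * emeasure lborel ?U))"
  proof (intro mult_left_mono add_mono)
    \<comment> \<open>The integrals are read as values of the measure with density
      \<open>g n\<close> on disjoint balls; Fatou's lemma for series then brings in the limit
      inferior.\<close>
    have "(\<Sum>i. I n i) \<le> (\<integral>\<^sup>+x. g n x \<partial>lborel)" for n
    proof -
      have "(\<Sum>i. I n i) = (\<Sum>i. emeasure (density lborel (g n)) (ball (y i) (\<rho> i)))"
        unfolding I_def by (simp add: emeasure_density)
      also have "\<dots> = emeasure (density lborel (g n)) (\<Union>i. ball (y i) (\<rho> i))"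
        by (intro suminf_emeasure y) auto
      also have "\<dots> \<le> emeasure (density lborel (g n)) UNIV"
        by (intro emeasure_mono) auto
      finally show ?thesis by (simp add: emeasure_density)
    qed
    then have "liminf (\<lambda>n. \<Sum>i. I n i) \<le> liminf (\<lambda>n. \<integral>\<^sup>+x. g n x \<partial>lborel)"
      by (intro Liminf_mono always_eventually) auto
    then show "(\<Sum>i. liminf (\<lambda>n. I n i)) \<le> liminf (\<lambda>n. \<integral>\<^sup>+x. g n x \<partial>lborel)"
      by (rule order_trans[OF suminf_liminf_le])
    have "(\<Sum>i. J i) = emeasure lborel (\<Union>i. ?U \<inter> ball (y i) (\<rho> i))"
      unfolding J_def using y(2) by (intro suminf_emeasure) (auto simp: disjoint_family_on_def)
    also have "\<dots> \<le> emeasure lborel ?U" by (intro emeasure_mono) auto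
    finally show "(\<Sum>i. J i) \<le> emeasure lborel ?U" .
  qed auto
  also have "\<dots> = ennreal (\<eta> * trace_const TYPE('a)) * (liminf (\<lambda>n. \<integral>\<^sup>+x. g n x \<partial>lborel) + ennreal (1 / \<delta>) * emeasure lborel ?U)"
    using \<eta> K unfolding trace_const_def c_def K_def[symmetric]
    by (simp add: mult.assoc[symmetric] ennreal_mult[symmetric])
  finally show ?thesis unfolding g_def .
qed

section \<open>Integration over the levels\<close>

lemma nn_integral_arctan_step_deriv_le:
  fixes n y :: real
  assumes n: "0 \<le> n"
  shows "(\<integral>\<^sup>+t. ennreal (arctan_step_deriv n t y) \<partial>lborel) \<le> 1"
proof (cases "n = 0")
  case False
  with n have n: "0 < n" by simp
  let ?f = "\<lambda>t. arctan_step_deriv n t y"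
  have [measurable]: "?f \<in> borel_measurable borel" unfolding arctan_step_deriv_def by measurable
  have f0: "0 \<le> ?f t" for t
    unfolding arctan_step_deriv_def using n by (intro divide_nonneg_nonneg mult_nonneg_nonneg) auto
  \<comment> \<open>For fixed \<open>y\<close> a primitive in \<open>t\<close> is
    \<open>- arctan_step n t y\<close>, which equals \<open>- 1 / 2\<close> at \<open>t = y\<close>
    and tends to \<open>0\<close> at infinity. The half line below \<open>y\<close> contributes the
    same by reflection at \<open>y\<close>.\<close>
  have half: "(\<integral>\<^sup>+t. ennreal (?f t) * indicator {y ..} t \<partial>lborel) = ennreal (0 - - arctan_step n y y)"
  proof (rule nn_integral_FTC_atLeast[where F = "\<lambda>t. - arctan_step n t y" and f = ?f and T = 0])
    fix t
    have "((\<lambda>t. arctan (n * (y - t))) has_real_derivative - n / (1 + (n * (y - t))\<^sup>2)) (at t)"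
      by (auto intro!: derivative_eq_intros simp: inverse_eq_divide)
    from DERIV_minus[OF DERIV_add[OF DERIV_const[of "1 / 2"] DERIV_cdivide[OF this, of pi]]]
    show "((\<lambda>t. - arctan_step n t y) has_real_derivative ?f t) (at t)"
      unfolding arctan_step_def arctan_step_deriv_def by (simp add: mult.commute)
    show "0 \<le> ?f t" by (rule f0)
  next
    have "filterlim (\<lambda>t. n * (- y + t)) at_top at_top"
      by (intro filterlim_tendsto_pos_mult_at_top[OF tendsto_const n filterlim_tendsto_add_at_top[OF tendsto_const filterlim_ident]])
    then have "((\<lambda>t. arctan (n * (- y + t))) \<longlongrightarrow> pi / 2) at_top"
      by (rule filterlim_compose[OF tendsto_arctan_at_top])
    then have "((\<lambda>t. - (1 / 2 - arctan (n * (- y + t)) / pi)) \<longlongrightarrow> - (1 / 2 - pi / 2 / pi)) at_top"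
      by (intro tendsto_intros) auto
    moreover have "- arctan_step n t y = - (1 / 2 - arctan (n * (- y + t)) / pi)" for t
      unfolding arctan_step_def using arctan_minus[of "n * (- y + t)"] by (simp add: algebra_simps)
    ultimately show "((\<lambda>t. - arctan_step n t y) \<longlongrightarrow> 0) at_top" by simp
  qed measurable
  have "(\<integral>\<^sup>+t. ennreal (?f t) \<partial>lborel)
     \<le> (\<integral>\<^sup>+t. ennreal (?f t) * indicator {y ..} t + ennreal (?f t) * indicator {.. y} t \<partial>lborel)"
    by (intro nn_integral_mono) (auto simp: indicator_def)
  also have "\<dots> = (\<integral>\<^sup>+t. ennreal (?f t) * indicator {y ..} t \<partial>lborel) + (\<integral>\<^sup>+t. ennreal (?f t) * indicator {.. y} t \<partial>lborel)"
    by (rule nn_integral_add) measurable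
  also have "(\<integral>\<^sup>+t. ennreal (?f t) * indicator {.. y} t \<partial>lborel)
     = (\<integral>\<^sup>+t. ennreal (?f (2 * y + - 1 * t)) * indicator {.. y} (2 * y + - 1 * t) \<partial>lborel)"
    by (subst nn_integral_real_affine[where c = "-1" and t = "2 * y"]) auto
  also have "\<dots> = (\<integral>\<^sup>+t. ennreal (?f t) * indicator {y ..} t \<partial>lborel)"
    by (intro nn_integral_cong) (auto simp: arctan_step_deriv_def indicator_def power2_eq_square algebra_simps)
  also have "(\<integral>\<^sup>+t. ennreal (?f t) * indicator {y ..} t \<partial>lborel) = ennreal (1 / 2)"
    using half by (simp add: arctan_step_def)
  also have "ennreal (1 / 2) + ennreal (1 / 2) = 1"
    by (subst ennreal_plus[symmetric]) auto
  finally show ?thesis .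
qed (simp add: arctan_step_deriv_def)

text \<open>Tonelli's theorem for the region between \<open>0\<close> and the graph of
  \<open>u\<close>. Where \<open>u\<close> is negative, \<open>ennreal (u x)\<close> is
  \<open>0\<close>, in agreement with the restriction to levels \<open>t \<ge> 0\<close>.\<close>

lemma nn_integral_layer_cake:
  fixes u :: "'a \<Rightarrow> real"
  assumes "sigma_finite_measure M" and [measurable]: "u \<in> borel_measurable M"
  shows "(\<integral>\<^sup>+x. ennreal (u x) \<partial>M) = (\<integral>\<^sup>+t. emeasure M {x \<in> space M. t < u x} * indicator {0..} t \<partial>lborel)"
proof -
  interpret M: sigma_finite_measure M by fact
  interpret pair_sigma_finite M "lborel :: real measure" ..
  have "(\<integral>\<^sup>+x. ennreal (u x) \<partial>M) = (\<integral>\<^sup>+x. (\<integral>\<^sup>+t. (if 0 \<le> t \<and> t < u x then 1 else 0) \<partial>lborel) \<partial>M)"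
  proof (intro nn_integral_cong)
    fix x
    have "(\<integral>\<^sup>+t. (if 0 \<le> t \<and> t < u x then 1 else 0) \<partial>lborel) = (\<integral>\<^sup>+t. indicator {0..<u x} t \<partial>lborel)"
      by (intro nn_integral_cong) (auto simp: indicator_def)
    also have "\<dots> = ennreal (u x)" by (cases "0 \<le> u x") (auto simp: ennreal_neg)
    finally show "ennreal (u x) = (\<integral>\<^sup>+t. (if 0 \<le> t \<and> t < u x then 1 else 0) \<partial>lborel)" ..
  qed
  also have "\<dots> = (\<integral>\<^sup>+t. (\<integral>\<^sup>+x. (if 0 \<le> t \<and> t < u x then 1 else 0) \<partial>M) \<partial>lborel)"
    by (rule Fubini'[symmetric]) measurable
  also have "\<dots> = (\<integral>\<^sup>+t. emeasure M {x \<in> space M. t < u x} * indicator {0..} t \<partial>lborel)"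
  proof (intro nn_integral_cong)
    fix t :: real
    have "(\<integral>\<^sup>+x. (if 0 \<le> t \<and> t < u x then 1 else 0) \<partial>M)
      = (\<integral>\<^sup>+x. indicator {0..} t * indicator {x \<in> space M. t < u x} x \<partial>M)"
      by (intro nn_integral_cong) (auto simp: indicator_def)
    also have "\<dots> = indicator {0..} t * emeasure M {x \<in> space M. t < u x}"
      by (rule nn_integral_cmult_indicator) measurable
    finally show "(\<integral>\<^sup>+x. (if 0 \<le> t \<and> t < u x then 1 else 0) \<partial>M)
      = emeasure M {x \<in> space M. t < u x} * indicator {0..} t" by (simp add: mult.commute)
  qed
  finally show ?thesis .
qed

text \<open>The estimate for superlevel sets is integrated over \<open>t\<close>. Fatou and Tonelli
  bound the gradient terms by the integral of \<open>norm (G x)\<close>, since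
  \<open>arctan_step_deriv\<close> has mass at most \<open>1\<close> in \<open>t\<close>; this
  stands in for one half of the coarea formula. The volume terms reassemble into the integral of the
  positive part of \<open>u\<close>.\<close>

lemma trace_inequality_pos:
  fixes u :: "'a::euclidean_space \<Rightarrow> real" and \<nu> :: "'a measure"
  assumes u: "C1_grad u G" and \<nu>: "finite_measure \<nu>" and sets[measurable_cong]: "sets \<nu> = sets borel"
    and \<delta>: "0 < \<delta>" and \<eta>: "0 \<le> \<eta>"
    and growth: "\<And>x r. 0 < r \<Longrightarrow> r \<le> \<delta> \<Longrightarrow> measure \<nu> (ball x r) \<le> \<eta> * r ^ (DIM('a) - 1)"
  shows "(\<integral>\<^sup>+x. ennreal (u x) \<partial>\<nu>) \<le> ennreal (\<eta> * trace_const TYPE('a)) *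
    ((\<integral>\<^sup>+x. ennreal (norm (G x)) \<partial>lborel) + ennreal (1 / \<delta>) * (\<integral>\<^sup>+x. ennreal (u x) \<partial>lborel))"
proof -
  interpret \<nu>: finite_measure \<nu> by fact
  have sp: "space \<nu> = UNIV" using sets_eq_imp_space_eq[OF sets] by simp
  note [measurable] = C1_grad_measurable[OF u]
  let ?c = "ennreal (\<eta> * trace_const TYPE('a))"
  define g where "g n t x = ennreal (norm (arctan_step_deriv (real n) t (u x) *\<^sub>R G x))" for n t x
  have gm[measurable]: "(\<lambda>(t, x). g n t x) \<in> borel_measurable (borel \<Otimes>\<^sub>M borel)" for n
    unfolding g_def arctan_step_deriv_def by measurable
  define L where "L t = liminf (\<lambda>n. \<integral>\<^sup>+x. g n t x \<partial>lborel)" for t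
  have Lm[measurable]: "L \<in> borel_measurable borel"
    unfolding L_def by measurable
  have Um: "(\<lambda>t. emeasure lborel {x. t < u x}) \<in> borel_measurable borel"
    using lborel.measurable_emeasure_Pair[of "{p \<in> space (borel \<Otimes>\<^sub>M lborel). fst p < u (snd p)}" borel]
    by (simp add: vimage_def space_pair_measure)
  note [measurable] = Um
  have "(\<integral>\<^sup>+x. ennreal (u x) \<partial>\<nu>) = (\<integral>\<^sup>+t. emeasure \<nu> {x. t < u x} * indicator {0..} t \<partial>lborel)"
    using nn_integral_layer_cake[OF \<nu>.sigma_finite_measure_axioms, of u] by (simp add: sp)
  also have "\<dots> \<le> (\<integral>\<^sup>+t. ?c * (L t + ennreal (1 / \<delta>) * (emeasure lborel {x. t < u x} * indicator {0..} t)) \<partial>lborel)"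
  proof (intro nn_integral_mono)
    fix t
    show "emeasure \<nu> {x. t < u x} * indicator {0..} t
      \<le> ?c * (L t + ennreal (1 / \<delta>) * (emeasure lborel {x. t < u x} * indicator {0..} t))"
      using emeasure_superlevel_le[OF u \<nu> sets \<delta> \<eta> growth, of t] unfolding L_def g_def
      by (auto simp: indicator_def)
  qed
  also have "\<dots> = ?c * ((\<integral>\<^sup>+t. L t \<partial>lborel) + ennreal (1 / \<delta>) * (\<integral>\<^sup>+t. emeasure lborel {x. t < u x} * indicator {0..} t \<partial>lborel))"
    by (simp add: nn_integral_cmult nn_integral_add)
  also have "(\<integral>\<^sup>+t. emeasure lborel {x. t < u x} * indicator {0..} t \<partial>lborel) = (\<integral>\<^sup>+x. ennreal (u x) \<partial>lborel)"
    using nn_integral_layer_cake[OF sigma_finite_lborel, of u] by simp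
  also have "(\<integral>\<^sup>+t. L t \<partial>lborel) \<le> (\<integral>\<^sup>+x. ennreal (norm (G x)) \<partial>lborel)"
  proof -
    have "(\<integral>\<^sup>+t. L t \<partial>lborel) \<le> liminf (\<lambda>n. \<integral>\<^sup>+t. (\<integral>\<^sup>+x. g n t x \<partial>lborel) \<partial>lborel)"
      unfolding L_def by (rule nn_integral_liminf) measurable
    also have "\<dots> \<le> liminf (\<lambda>n::nat. \<integral>\<^sup>+x. ennreal (norm (G x)) \<partial>lborel)"
    proof (intro Liminf_mono always_eventually allI)
      fix n
      have "(\<integral>\<^sup>+t. (\<integral>\<^sup>+x. g n t x \<partial>lborel) \<partial>lborel) = (\<integral>\<^sup>+x. (\<integral>\<^sup>+t. g n t x \<partial>lborel) \<partial>lborel)"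
        by (rule lborel_pair.Fubini') measurable
      also have "\<dots> \<le> (\<integral>\<^sup>+x. ennreal (norm (G x)) \<partial>lborel)"
      proof (intro nn_integral_mono)
        fix x
        have "0 \<le> arctan_step_deriv (real n) t (u x)" for t
          unfolding arctan_step_deriv_def by (intro divide_nonneg_nonneg mult_nonneg_nonneg) auto
        then have "(\<integral>\<^sup>+t. g n t x \<partial>lborel) = (\<integral>\<^sup>+t. ennreal (arctan_step_deriv (real n) t (u x)) * ennreal (norm (G x)) \<partial>lborel)"
          unfolding g_def by (intro nn_integral_cong) (simp add: ennreal_mult)
        also have "\<dots> = (\<integral>\<^sup>+t. ennreal (arctan_step_deriv (real n) t (u x)) \<partial>lborel) * ennreal (norm (G x))"
          by (rule nn_integral_multc) (simp add: arctan_step_deriv_def)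
        also have "\<dots> \<le> 1 * ennreal (norm (G x))"
          by (intro mult_right_mono nn_integral_arctan_step_deriv_le) auto
        finally show "(\<integral>\<^sup>+t. g n t x \<partial>lborel) \<le> ennreal (norm (G x))" by simp
      qed
      finally show "(\<integral>\<^sup>+t. (\<integral>\<^sup>+x. g n t x \<partial>lborel) \<partial>lborel) \<le> (\<integral>\<^sup>+x. ennreal (norm (G x)) \<partial>lborel)" .
    qed
    finally show ?thesis by (simp add: Liminf_const)
  qed
  finally show ?thesis by (simp add: mult_left_mono add_right_mono)
qed

lemma C1_grad_minus: "C1_grad u G \<Longrightarrow> C1_grad (\<lambda>x. - u x) (\<lambda>x. - G x)"
  unfolding C1_grad_def by (auto intro!: derivative_eq_intros continuous_intros)

text \<open>The positive and the negative part are treated separately, by applying the one-sided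
  inequality to \<open>u\<close> and to \<open>- u\<close>; the gradient is therefore counted
  twice.\<close>

lemma trace_inequality:
  fixes u :: "'a::euclidean_space \<Rightarrow> real" and \<nu> :: "'a measure"
  assumes u: "C1_grad u G" and \<nu>: "finite_measure \<nu>" and sets[measurable_cong]: "sets \<nu> = sets borel"
    and \<delta>: "0 < \<delta>" and \<eta>: "0 \<le> \<eta>"
    and growth: "\<And>x r. 0 < r \<Longrightarrow> r \<le> \<delta> \<Longrightarrow> measure \<nu> (ball x r) \<le> \<eta> * r ^ (DIM('a) - 1)"
  shows "(\<integral>\<^sup>+x. ennreal \<bar>u x\<bar> \<partial>\<nu>) \<le> ennreal (\<eta> * trace_const TYPE('a)) *
    (2 * (\<integral>\<^sup>+x. ennreal (norm (G x)) \<partial>lborel) + ennreal (1 / \<delta>) * (\<integral>\<^sup>+x. ennreal \<bar>u x\<bar> \<partial>lborel))"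
proof -
  note [measurable] = C1_grad_measurable[OF u]
  have split: "ennreal \<bar>u x\<bar> = ennreal (u x) + ennreal (- u x)" for x
    by (cases "0 \<le> u x") (auto simp: ennreal_neg)
  have "(\<integral>\<^sup>+x. ennreal \<bar>u x\<bar> \<partial>\<nu>) = (\<integral>\<^sup>+x. ennreal (u x) \<partial>\<nu>) + (\<integral>\<^sup>+x. ennreal (- u x) \<partial>\<nu>)"
    unfolding split by (rule nn_integral_add) measurable
  moreover have "(\<integral>\<^sup>+x. ennreal \<bar>u x\<bar> \<partial>lborel) = (\<integral>\<^sup>+x. ennreal (u x) \<partial>lborel) + (\<integral>\<^sup>+x. ennreal (- u x) \<partial>lborel)"
    unfolding split by (rule nn_integral_add) measurable
  moreover have "(\<integral>\<^sup>+x. ennreal (- u x) \<partial>\<nu>) \<le> ennreal (\<eta> * trace_const TYPE('a)) *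
    ((\<integral>\<^sup>+x. ennreal (norm (G x)) \<partial>lborel) + ennreal (1 / \<delta>) * (\<integral>\<^sup>+x. ennreal (- u x) \<partial>lborel))"
    using trace_inequality_pos[OF C1_grad_minus[OF u] \<nu> sets \<delta> \<eta> growth] by simp
  moreover have "c * (g + d * a) + c * (g + d * b) = c * (2 * g + d * (a + b))" for a b c d g :: ennreal
    by (simp add: distrib_left mult_2 add_ac)
  ultimately show ?thesis
    using add_mono[OF trace_inequality_pos[OF u \<nu> sets \<delta> \<eta> growth]] by metis
qed

section \<open>Dominated extension of linear functionals\<close>

text \<open>On a subspace the inequality for \<open>c > 0\<close>, applied also to
  \<open>1 / c\<close>, already gives equality; the one-sided form is the one that passes directly
  to infima.\<close>

definition sublinear_on :: "'v::real_vector set \<Rightarrow> ('v \<Rightarrow> real) \<Rightarrow> bool" where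
  "sublinear_on S s \<longleftrightarrow>
     (\<forall>x\<in>S. \<forall>y\<in>S. s (x + y) \<le> s x + s y) \<and> (\<forall>x\<in>S. \<forall>c>0. s (c *\<^sub>R x) \<le> c * s x)"

lemma sublinear_on_0:
  assumes "subspace S" "sublinear_on S s"
  shows "s 0 = 0"
proof -
  have *: "\<And>c. c > 0 \<Longrightarrow> s (c *\<^sub>R 0) \<le> c * s 0"
    using assms subspace_0 unfolding sublinear_on_def by blast
  show ?thesis using *[of 2] *[of "1/2"] by simp
qed

lemma sublinear_on_minus:
  assumes "subspace S" "sublinear_on S s" "x \<in> S"
  shows "0 \<le> s x + s (- x)"
proof -
  have "s (x + (- x)) \<le> s x + s (- x)"
    using assms subspace_neg unfolding sublinear_on_def by blast
  then show ?thesis using sublinear_on_0[OF assms(1,2)] by simp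
qed

text \<open>With \<open>x = - z\<close> the last inequality gives \<open>q (- z) \<le> - a\<close>, so that a linear functional below \<open>q\<close>
  has to agree with \<open>a\<close> at \<open>z\<close> as soon as \<open>K\<close> is symmetric.\<close>

lemma sublinear_on_INF_cone:
  fixes p :: "'v::real_vector \<Rightarrow> real" and K :: "('v \<times> real) set"
  assumes S: "subspace S" and p: "sublinear_on S p"
    and K: "(0, 0) \<in> K" "\<And>z a. (z, a) \<in> K \<Longrightarrow> z \<in> S \<and> a \<le> p z"
      "\<And>z a w b. (z, a) \<in> K \<Longrightarrow> (w, b) \<in> K \<Longrightarrow> (z + w, a + b) \<in> K"
      "\<And>z a c. (z, a) \<in> K \<Longrightarrow> c > 0 \<Longrightarrow> (c *\<^sub>R z, c * a) \<in> K"
  defines "q \<equiv> \<lambda>x. INF k\<in>K. p (x + fst k) - snd k"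
  shows "sublinear_on S q" "\<And>x. x \<in> S \<Longrightarrow> q x \<le> p x"
    "\<And>x z a. x \<in> S \<Longrightarrow> (z, a) \<in> K \<Longrightarrow> q x \<le> p (x + z) - a"
proof -
  have padd: "\<And>x y. x \<in> S \<Longrightarrow> y \<in> S \<Longrightarrow> p (x + y) \<le> p x + p y"
    and pscale: "\<And>x c. x \<in> S \<Longrightarrow> c > 0 \<Longrightarrow> p (c *\<^sub>R x) \<le> c * p x"
    using p unfolding sublinear_on_def by auto
  have Sadd: "\<And>x y. x \<in> S \<Longrightarrow> y \<in> S \<Longrightarrow> x + y \<in> S" and Sscale: "\<And>x c. x \<in> S \<Longrightarrow> c *\<^sub>R x \<in> S"
    and Sneg: "\<And>x. x \<in> S \<Longrightarrow> - x \<in> S"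
    using S subspace_add subspace_scale subspace_neg by blast+
  have bdd: "bdd_below ((\<lambda>k. p (x + fst k) - snd k) ` K)" if x: "x \<in> S" for x
  proof (rule bdd_belowI2)
    fix k assume k: "k \<in> K"
    then have "p ((x + fst k) + (- x)) \<le> p (x + fst k) + p (- x)"
      using K(2)[of "fst k" "snd k"] x by (intro padd Sadd Sneg) auto
    then show "- p (- x) \<le> p (x + fst k) - snd k" using K(2)[of "fst k" "snd k"] k by simp
  qed
  show le: "q x \<le> p (x + z) - a" if "x \<in> S" "(z, a) \<in> K" for x z a
    unfolding q_def using cINF_lower[OF bdd[OF that(1)] that(2)] by simp
  show "q x \<le> p x" if "x \<in> S" for x using le[OF that K(1)] by simp
  have ge: "b \<le> q x" if "\<And>z a. (z, a) \<in> K \<Longrightarrow> b \<le> p (x + z) - a" for b x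
    unfolding q_def using K(1) that by (intro cINF_greatest) auto
  show "sublinear_on S q"
    unfolding sublinear_on_def
  proof (intro conjI ballI allI impI)
    fix x y assume x: "x \<in> S" and y: "y \<in> S"
    have *: "q (x + y) \<le> (p (x + z) - a) + (p (y + w) - b)" if "(z, a) \<in> K" "(w, b) \<in> K" for z a w b
    proof -
      have "q (x + y) \<le> p ((x + y) + (z + w)) - (a + b)"
        by (intro le Sadd x y K that)
      also have "(x + y) + (z + w) = (x + z) + (y + w)" by simp
      also have "p \<dots> \<le> p (x + z) + p (y + w)" using x y K(2) that by (intro padd Sadd) auto
      finally show ?thesis by simp
    qed
    have "q (x + y) - (p (y + w) - b) \<le> q x" if "(w, b) \<in> K" for w b
      using *[OF _ that] by (intro ge) (simp add: algebra_simps)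
    then have "q (x + y) - q x \<le> q y" by (intro ge) (simp add: algebra_simps)
    then show "q (x + y) \<le> q x + q y" by simp
  next
    fix x and c :: real assume x: "x \<in> S" and c: "c > 0"
    have "q (c *\<^sub>R x) / c \<le> q x"
    proof (rule ge)
      fix z a assume k: "(z, a) \<in> K"
      have "q (c *\<^sub>R x) \<le> p (c *\<^sub>R x + c *\<^sub>R z) - c * a" by (intro le Sscale x K k c)
      also have "c *\<^sub>R x + c *\<^sub>R z = c *\<^sub>R (x + z)" by (simp add: scaleR_add_right)
      also have "p \<dots> \<le> c * p (x + z)" using x K(2)[OF k] c by (intro pscale Sadd) auto
      finally show "q (c *\<^sub>R x) / c \<le> p (x + z) - a" using c by (simp add: field_simps)
    qed
    then show "q (c *\<^sub>R x) \<le> c * q x" using c by (simp add: field_simps)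
  qed
qed

text \<open>A minimal sublinear functional \<open>m\<close> is additive, because the sublinear functional
  \<open>\<lambda>x. INF t\<in>{0..}. m (x + t *\<^sub>R y) - t * m y\<close> lies below it.\<close>

lemma exists_linear_below_sublinear:
  fixes q :: "'v::real_vector \<Rightarrow> real"
  assumes S: "subspace S" and q: "sublinear_on S q"
  shows "\<exists>T. (\<forall>x\<in>S. \<forall>y\<in>S. T (x + y) = T x + T y) \<and> (\<forall>x\<in>S. \<forall>c. T (c *\<^sub>R x) = c * T x) \<and> (\<forall>x\<in>S. T x \<le> q x)"
proof -
  \<comment> \<open>Fixing the value \<open>0\<close> outside \<open>S\<close> makes two candidates
    that agree on \<open>S\<close> equal, as antisymmetry and minimality require; \<open>ext\<close>
    restores this normalisation. \<open>P\<close> reverses the order, since Zorn's lemma is used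
    downwards.\<close>
  define A where "A = {s. sublinear_on S s \<and> (\<forall>x\<in>S. s x \<le> q x) \<and> (\<forall>x. x \<notin> S \<longrightarrow> s x = 0)}"
  define P where "P a b \<longleftrightarrow> (\<forall>x. b x \<le> a x)" for a b :: "'v \<Rightarrow> real"
  define ext where "ext s x = (if x \<in> S then s x else 0)" for s :: "'v \<Rightarrow> real" and x
  have Sadd: "\<And>x y. x \<in> S \<Longrightarrow> y \<in> S \<Longrightarrow> x + y \<in> S" and Sscale: "\<And>x c. x \<in> S \<Longrightarrow> c *\<^sub>R x \<in> S"
    and Sneg: "\<And>x. x \<in> S \<Longrightarrow> - x \<in> S"
    using S subspace_add subspace_scale subspace_neg by blast+
  have ext: "ext s \<in> A" if "sublinear_on S s" "\<And>x. x \<in> S \<Longrightarrow> s x \<le> q x" for s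
    using that Sadd Sscale by (auto simp: A_def ext_def sublinear_on_def)
  have "\<exists>m\<in>A. \<forall>a\<in>A. P m a \<longrightarrow> a = m"
  proof (rule predicate_Zorn)
    show "partial_order_on A (relation_of P A)"
      by (rule partial_order_on_relation_ofI) (auto simp: P_def fun_eq_iff intro: order_trans antisym)
  next
    fix C assume C: "C \<in> Chains (relation_of P A)"
    then have CA: "C \<subseteq> A" and chain: "\<And>a b. a \<in> C \<Longrightarrow> b \<in> C \<Longrightarrow> P a b \<or> P b a"
      unfolding Chains_def relation_of_def by auto
    show "\<exists>u\<in>A. \<forall>a\<in>C. P a u"
    proof (cases "C = {}")
      case True
      then show ?thesis using ext[OF q] by auto
    next
      case False
      define u where "u x = (INF s\<in>C. s x)" for x
      have sub: "sublinear_on S s" "\<And>x. x \<in> S \<Longrightarrow> s x \<le> q x" "\<And>x. x \<notin> S \<Longrightarrow> s x = 0" if "s \<in> C" for s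
        using that CA by (auto simp: A_def)
      have bdd: "bdd_below ((\<lambda>s. s x) ` C)" if x: "x \<in> S" for x
      proof (rule bdd_belowI2)
        fix s assume s: "s \<in> C"
        show "- q (- x) \<le> s x"
          using sublinear_on_minus[OF S sub(1)[OF s] x] sub(2)[OF s Sneg[OF x]] by simp
      qed
      have le: "u x \<le> s x" if "x \<in> S" "s \<in> C" for x s
        unfolding u_def by (rule cINF_lower[OF bdd[OF that(1)] that(2)])
      have ge: "b \<le> u x" if "\<And>s. s \<in> C \<Longrightarrow> b \<le> s x" for b x
        unfolding u_def using False that by (intro cINF_greatest) auto
      have "sublinear_on S u"
        unfolding sublinear_on_def
      proof (intro conjI ballI allI impI)
        fix x y assume x: "x \<in> S" and y: "y \<in> S"
        have *: "u (x + y) \<le> a x + b y" if "a \<in> C" "b \<in> C" for a b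
        proof -
          \<comment> \<open>Of two members of a chain the smaller one serves at \<open>x\<close> and
            at \<open>y\<close> simultaneously; this makes the infimum subadditive.\<close>
          have "\<exists>s\<in>C. s x \<le> a x \<and> s y \<le> b y" using chain[OF that] that unfolding P_def by blast
          then obtain s where s: "s \<in> C" "s x \<le> a x" "s y \<le> b y" by blast
          have "u (x + y) \<le> s (x + y)" by (intro le Sadd x y s)
          also have "\<dots> \<le> s x + s y" using sub(1)[OF s(1)] x y by (auto simp: sublinear_on_def)
          finally show ?thesis using s by simp
        qed
        have "u (x + y) - b y \<le> u x" if "b \<in> C" for b
          using *[OF _ that] by (intro ge) (simp add: algebra_simps)
        then have "u (x + y) - u x \<le> u y" by (intro ge) (simp add: algebra_simps)
        then show "u (x + y) \<le> u x + u y" by simp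
      next
        fix x and c :: real assume x: "x \<in> S" and c: "c > 0"
        have "u (c *\<^sub>R x) / c \<le> u x"
        proof (rule ge)
          fix s assume s: "s \<in> C"
          have "u (c *\<^sub>R x) \<le> s (c *\<^sub>R x)" by (intro le Sscale x s)
          also have "\<dots> \<le> c * s x" using sub(1)[OF s] x c by (auto simp: sublinear_on_def)
          finally show "u (c *\<^sub>R x) / c \<le> s x" using c by (simp add: field_simps)
        qed
        then show "u (c *\<^sub>R x) \<le> c * u x" using c by (simp add: field_simps)
      qed
      moreover have "u x \<le> q x" if "x \<in> S" for x
        using False le[OF that] sub(2)[OF _ that] by (meson all_not_in_conv order_trans)
      ultimately have "ext u \<in> A" by (rule ext)
      moreover have "P s (ext u)" if "s \<in> C" for s
        unfolding P_def ext_def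
      proof
        fix x show "(if x \<in> S then u x else 0) \<le> s x"
          using le[of x s] sub(3)[of s x] that by auto
      qed
      ultimately show ?thesis by blast
    qed
  qed
  then obtain m where m: "m \<in> A" "\<And>a. a \<in> A \<Longrightarrow> P m a \<Longrightarrow> a = m" by blast
  have msub: "sublinear_on S m" and mq: "\<And>x. x \<in> S \<Longrightarrow> m x \<le> q x" and m0: "\<And>x. x \<notin> S \<Longrightarrow> m x = 0"
    using m(1) by (auto simp: A_def)
  note mzero = sublinear_on_0[OF S msub]
  have mscale: "m (c *\<^sub>R x) = c * m x" if "x \<in> S" "c \<ge> 0" for x c
  proof (cases "c = 0")
    case False
    then have c: "c > 0" using that by simp
    have "m ((1 / c) *\<^sub>R (c *\<^sub>R x)) \<le> (1 / c) * m (c *\<^sub>R x)"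
      using msub[unfolded sublinear_on_def, THEN conjunct2, rule_format, OF Sscale[OF that(1), of c], of "1 / c"] c
      by (simp only: zero_less_divide_1_iff)
    then have "c * m x \<le> m (c *\<^sub>R x)" using c by (simp add: field_simps)
    moreover have "m (c *\<^sub>R x) \<le> c * m x" using msub c that unfolding sublinear_on_def by simp
    ultimately show ?thesis by simp
  qed (simp add: mzero)
  have add: "m (x + y) = m x + m y" if x: "x \<in> S" and y: "y \<in> S" for x y
  proof -
    define K where "K = (\<lambda>t. (t *\<^sub>R y, t * m y)) ` {0..}"
    define s where "s x = (INF k\<in>K. m (x + fst k) - snd k)" for x
    have K: "(0, 0) \<in> K" "\<And>z a. (z, a) \<in> K \<Longrightarrow> z \<in> S \<and> a \<le> m z"
      "\<And>z a w b. (z, a) \<in> K \<Longrightarrow> (w, b) \<in> K \<Longrightarrow> (z + w, a + b) \<in> K"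
      "\<And>z a c. (z, a) \<in> K \<Longrightarrow> c > 0 \<Longrightarrow> (c *\<^sub>R z, c * a) \<in> K"
    proof -
      show "(0, 0) \<in> K" unfolding K_def by (auto intro: image_eqI[of _ _ 0])
      show "z \<in> S \<and> a \<le> m z" if "(z, a) \<in> K" for z a
        using that y by (auto simp: K_def mscale Sscale)
      show "(z + w, a + b) \<in> K" if k: "(z, a) \<in> K" "(w, b) \<in> K" for z a w b
      proof -
        obtain t t' where "0 \<le> t" "0 \<le> t'" "z = t *\<^sub>R y" "w = t' *\<^sub>R y" "a = t * m y" "b = t' * m y"
          using k unfolding K_def by auto
        then show ?thesis unfolding K_def
          by (auto intro!: image_eqI[of _ _ "t + t'"] simp: algebra_simps)
      qed
      show "(c *\<^sub>R z, c * a) \<in> K" if k: "(z, a) \<in> K" "c > 0" for z a c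
      proof -
        obtain t where "0 \<le> t" "z = t *\<^sub>R y" "a = t * m y" using k unfolding K_def by auto
        then show ?thesis unfolding K_def using \<open>c > 0\<close> by (auto intro!: image_eqI[of _ _ "c * t"])
      qed
    qed
    note cone = sublinear_on_INF_cone[OF S msub K, folded s_def]
    have "ext s \<in> A" using cone(1,2) mq by (intro ext) (auto intro: order_trans)
    moreover have "P m (ext s)" using cone(2) m0 unfolding P_def ext_def by auto
    ultimately have "ext s = m" by (rule m(2))
    then have "m x = s x" using x by (metis ext_def)
    \<comment> \<open>The infimum is tested at \<open>t = 1\<close>.\<close>
    also have "\<dots> \<le> m (x + y) - m y"
      using x by (intro cone(3)) (auto simp: K_def intro: image_eqI[of _ _ 1])
    finally have "m x + m y \<le> m (x + y)" by simp
    moreover have "m (x + y) \<le> m x + m y" using msub x y unfolding sublinear_on_def by blast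
    ultimately show ?thesis by simp
  qed
  have neg: "m (- x) = - m x" if "x \<in> S" for x using add[OF that Sneg[OF that]] mzero by simp
  have "m (c *\<^sub>R x) = c * m x" if x: "x \<in> S" for x c
  proof (cases "c \<ge> 0")
    case False
    then show ?thesis using mscale[OF x, of "- c"] neg[OF Sscale[OF x, of c]] by simp
  qed (use mscale x in simp)
  then show ?thesis using add mq by blast
qed

text \<open>The functional to be extended is given by its graph \<open>K\<close>.\<close>

theorem Hahn_Banach_dominated:
  fixes p :: "'v::real_vector \<Rightarrow> real" and K :: "('v \<times> real) set"
  assumes S: "subspace S" and p: "sublinear_on S p"
    and K: "(0, 0) \<in> K" "\<And>z a. (z, a) \<in> K \<Longrightarrow> z \<in> S \<and> a \<le> p z"
      "\<And>z a w b. (z, a) \<in> K \<Longrightarrow> (w, b) \<in> K \<Longrightarrow> (z + w, a + b) \<in> K"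
      "\<And>z a c. (z, a) \<in> K \<Longrightarrow> (c *\<^sub>R z, c * a) \<in> K"
  obtains T where "\<And>x y. x \<in> S \<Longrightarrow> y \<in> S \<Longrightarrow> T (x + y) = T x + T y"
    "\<And>x c. x \<in> S \<Longrightarrow> T (c *\<^sub>R x) = c * T x" "\<And>x. x \<in> S \<Longrightarrow> T x \<le> p x"
    "\<And>z a. (z, a) \<in> K \<Longrightarrow> T z = a"
proof -
  define q where "q x = (INF k\<in>K. p (x + fst k) - snd k)" for x
  have "(c *\<^sub>R z, c * a) \<in> K" if "(z, a) \<in> K" "c > 0" for z a c
    using K(4) that by blast
  note cone = sublinear_on_INF_cone[OF S p K(1-3) this, folded q_def]
  obtain T where T: "\<forall>x\<in>S. \<forall>y\<in>S. T (x + y) = T x + T y" "\<forall>x\<in>S. \<forall>c. T (c *\<^sub>R x) = c * T x"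
    "\<forall>x\<in>S. T x \<le> q x"
    using exists_linear_below_sublinear[OF S cone(1)] by blast
  have low: "a \<le> T z" if k: "(z, a) \<in> K" for z a
  proof -
    have z: "z \<in> S" "- z \<in> S" using K(2)[OF k] subspace_neg[OF S] by auto
    have "T (- z) \<le> q (- z)" using T(3) z(2) by blast
    also have "q (- z) \<le> p (- z + z) - a" by (rule cone(3)) (use k z in auto)
    finally have "T (- z) \<le> p (- z + z) - a" .
    moreover have "T (- z) = - T z" using T(2)[rule_format, OF z(1), of "- 1"] by simp
    ultimately show ?thesis using sublinear_on_0[OF S p] by simp
  qed
  show ?thesis
  proof
    fix z a assume k: "(z, a) \<in> K"
    have "((- 1) *\<^sub>R z, (- 1) * a) \<in> K" by (rule K(4)[OF k])
    from low[OF this] low[OF k] show "T z = a"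
      using T(2)[rule_format, of z "- 1"] K(2)[OF k] by simp
  next
    show "T x \<le> p x" if "x \<in> S" for x using T(3) cone(2) that by fastforce
  qed (use T in auto)
qed

section \<open>Functions of compact support and their averages\<close>

definition Cc :: "('a::euclidean_space \<Rightarrow> 'b::real_normed_vector) \<Rightarrow> bool" where
  "Cc F \<longleftrightarrow> continuous_on UNIV F \<and> (\<exists>R. \<forall>x. R < norm x \<longrightarrow> F x = 0)"

lemma CcI: "continuous_on UNIV F \<Longrightarrow> (\<And>x. R < norm x \<Longrightarrow> F x = 0) \<Longrightarrow> Cc F"
  unfolding Cc_def by blast

lemma Cc_continuous: "Cc F \<Longrightarrow> continuous_on UNIV F"
  by (simp add: Cc_def)

lemma Cc_supportE:
  assumes "Cc F" obtains R where "R > 0" "\<And>x. R < norm x \<Longrightarrow> F x = 0"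
proof -
  obtain R where "\<And>x. R < norm x \<Longrightarrow> F x = 0" using assms unfolding Cc_def by blast
  then show ?thesis by (intro that[of "max R 1"]) auto
qed

lemma Cc_measurable [measurable_dest]: "Cc F \<Longrightarrow> F \<in> borel_measurable borel"
  using Cc_continuous borel_measurable_continuous_onI by blast

lemma Cc_add: assumes "Cc F" "Cc H" shows "Cc (\<lambda>x. F x + H x)"
proof -
  obtain R R' where "\<And>x. R < norm x \<Longrightarrow> F x = 0" "\<And>x. R' < norm x \<Longrightarrow> H x = 0"
    using assms unfolding Cc_def by blast
  then show ?thesis using assms
    by (intro CcI[where R = "max R R'"] continuous_intros) (auto simp: Cc_def)
qed

lemma Cc_bounded_linear_image: "bounded_linear f \<Longrightarrow> Cc F \<Longrightarrow> Cc (\<lambda>x. f (F x))"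
  unfolding Cc_def using bounded_linear.continuous_on[of f UNIV F] linear_0[OF bounded_linear.linear, of f]
  by metis

lemma Cc_scaleR_const: "Cc F \<Longrightarrow> Cc (\<lambda>x. c *\<^sub>R F x)"
  by (rule Cc_bounded_linear_image[OF bounded_linear_scaleR_right])

lemma Cc_scaleR_right: "Cc k \<Longrightarrow> Cc (\<lambda>x. k x *\<^sub>R b)"
  by (rule Cc_bounded_linear_image[OF bounded_linear_scaleR_left])

lemma Cc_diff: "Cc F \<Longrightarrow> Cc H \<Longrightarrow> Cc (\<lambda>x. F x - H x)"
  using Cc_add[OF _ Cc_scaleR_const[of H "- 1"]] by simp

lemma Cc_norm: "Cc F \<Longrightarrow> Cc (\<lambda>x. norm (F x))"
  unfolding Cc_def by (auto intro: continuous_intros)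

lemma Cc_scaleR_fun: "Cc k \<Longrightarrow> continuous_on UNIV F \<Longrightarrow> Cc (\<lambda>x. k x *\<^sub>R F x)"
  unfolding Cc_def by (auto intro!: continuous_intros)

lemma Cc_inner: "Cc F \<Longrightarrow> continuous_on UNIV V \<Longrightarrow> Cc (\<lambda>x. V x \<bullet> F x)"
  unfolding Cc_def by (auto intro!: continuous_intros) (metis inner_zero_right)

lemma Cc_shift: assumes "Cc F" shows "Cc (\<lambda>y. F (y + a))"
proof -
  obtain R where R: "\<And>x. R < norm x \<Longrightarrow> F x = 0" using assms unfolding Cc_def by blast
  show ?thesis
  proof (rule CcI[where R = "R + norm a"])
    show "continuous_on UNIV (\<lambda>y. F (y + a))"
      by (intro continuous_on_compose2[OF Cc_continuous[OF assms]] continuous_intros) auto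
    show "F (y + a) = 0" if "R + norm a < norm y" for y
      using that norm_diff_ineq[of y a] by (intro R) auto
  qed
qed

lemma Cc_bounded: assumes "Cc F" obtains B where "B > 0" "\<And>x. norm (F x) \<le> B"
proof -
  obtain R where R: "R > 0" "\<And>x. R < norm x \<Longrightarrow> F x = 0" using assms by (rule Cc_supportE) blast
  have "compact (F ` cball 0 R)"
    by (intro compact_continuous_image continuous_on_subset[OF Cc_continuous[OF assms]]) auto
  then have "bounded (F ` cball 0 R)" by (rule compact_imp_bounded)
  then obtain B where B: "B > 0" "\<And>x. x \<in> cball 0 R \<Longrightarrow> norm (F x) \<le> B"
    unfolding bounded_pos by blast
  have "norm (F x) \<le> B" for x
    using R(2)[of x] B(2)[of x] B(1) by (cases "norm x \<le> R") auto
  then show ?thesis using that B(1) by blast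
qed

text \<open>Compactness applies on a ball whose radius exceeds that of the support by
  \<open>1\<close>; two points closer than \<open>1\<close> either both lie in that ball or both lie
  outside the support.\<close>

lemma Cc_uniformly_continuous:
  assumes "Cc F" and "\<epsilon> > 0"
  obtains d where "d > 0" "\<And>x y. norm (x - y) < d \<Longrightarrow> norm (F x - F y) < \<epsilon>"
proof -
  obtain R where R: "R > 0" "\<And>x. R < norm x \<Longrightarrow> F x = 0" using assms(1) by (rule Cc_supportE) blast
  have "uniformly_continuous_on (cball 0 (R + 1)) F"
    by (intro compact_uniformly_continuous continuous_on_subset[OF Cc_continuous[OF assms(1)]]) auto
  then obtain d where d: "d > 0" "\<And>x y. x \<in> cball 0 (R + 1) \<Longrightarrow> y \<in> cball 0 (R + 1) \<Longrightarrow> dist x y < d \<Longrightarrow> dist (F x) (F y) < \<epsilon>"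
    using \<open>\<epsilon> > 0\<close> unfolding uniformly_continuous_on_def by (metis dist_commute)
  have "norm (F x - F y) < \<epsilon>" if xy: "norm (x - y) < min d 1" for x y
  proof (cases "norm x \<le> R \<or> norm y \<le> R")
    case True
    then have "norm x \<le> R + 1" "norm y \<le> R + 1"
      using xy norm_triangle_sub[of x y] norm_triangle_sub[of y x] by (auto simp: norm_minus_commute)
    then show ?thesis using d(2)[of x y] xy by (auto simp: dist_norm)
  next
    case False
    then show ?thesis using R(2)[of x] R(2)[of y] \<open>\<epsilon> > 0\<close> by simp
  qed
  then show ?thesis using that[of "min d 1"] d(1) by auto
qed

lemma Cc_integrable:
  fixes F :: "'a::euclidean_space \<Rightarrow> 'b::{banach, second_countable_topology}"
  assumes "Cc F" shows "integrable lborel F"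
proof -
  obtain R where R: "R > 0" "\<And>x. R < norm x \<Longrightarrow> F x = 0" using assms by (rule Cc_supportE) blast
  have "integrable lborel (\<lambda>x. indicator (cball 0 R) x *\<^sub>R F x)"
    by (intro borel_integrable_compact continuous_on_subset[OF Cc_continuous[OF assms]]) auto
  also have "(\<lambda>x. indicator (cball 0 R) x *\<^sub>R F x) = F"
    using R(2) by (force simp: indicator_def)
  finally show ?thesis .
qed

section \<open>Compactly supported C1 functions and correlations\<close>

definition C1c :: "('a::euclidean_space \<Rightarrow> real) \<Rightarrow> ('a \<Rightarrow> 'a) \<Rightarrow> bool" where
  "C1c u G \<longleftrightarrow> C1_grad u G \<and> Cc u \<and> Cc G"

lemma C1c_add: "C1c u G \<Longrightarrow> C1c v H \<Longrightarrow> C1c (\<lambda>x. u x + v x) (\<lambda>x. G x + H x)"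
  unfolding C1c_def C1_grad_def
  by (auto intro!: Cc_add derivative_eq_intros continuous_intros simp: inner_add_left)

lemma C1c_scale: "C1c u G \<Longrightarrow> C1c (\<lambda>x. c * u x) (\<lambda>x. c *\<^sub>R G x)"
  unfolding C1c_def C1_grad_def
  using Cc_scaleR_const[of u c]
  by (auto intro!: Cc_scaleR_const derivative_eq_intros continuous_intros)

lemma C1c_diff: "C1c u G \<Longrightarrow> C1c v H \<Longrightarrow> C1c (\<lambda>x. u x - v x) (\<lambda>x. G x - H x)"
  using C1c_add[OF _ C1c_scale[of v H "- 1"]] by simp

text \<open>This is convolution with the reflected kernel, hence with \<open>k\<close> itself when
  \<open>k\<close> is even. In this form it is the adjoint of convolving a measure with
  \<open>k\<close>.\<close>

definition corr :: "('a::euclidean_space \<Rightarrow> real) \<Rightarrow> ('a \<Rightarrow> 'b) \<Rightarrow> 'a \<Rightarrow> 'b::euclidean_space" where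
  "corr k F x = (LINT z|lborel. k z *\<^sub>R F (x + z))"

lemma Cc_corr_integrand: "Cc k \<Longrightarrow> continuous_on UNIV F \<Longrightarrow> Cc (\<lambda>z. k z *\<^sub>R F (x + z))"
  by (rule Cc_scaleR_fun, assumption, rule continuous_on_compose2[of UNIV F], assumption)
     (auto intro: continuous_intros)

lemma corr_integrable:
  fixes F :: "'a::euclidean_space \<Rightarrow> 'b::euclidean_space"
  shows "Cc k \<Longrightarrow> continuous_on UNIV F \<Longrightarrow> integrable lborel (\<lambda>z. k z *\<^sub>R F (x + z))"
  by (intro Cc_integrable Cc_corr_integrand)

lemma integral_lborel_translate:
  fixes f :: "'a::euclidean_space \<Rightarrow> 'b::{banach, second_countable_topology}"
  assumes [measurable]: "f \<in> borel_measurable borel"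
  shows "(LINT x|lborel. f (c + x)) = (LINT x|lborel. f x)"
proof -
  have "(LINT x|lborel. f x) = (LINT x|distr lborel borel ((+) c). f x)"
    by (simp add: lborel_distr_plus)
  also have "\<dots> = (LINT x|lborel. f (c + x))"
    by (intro integral_distr) auto
  finally show ?thesis ..
qed

lemma corr_eq:
  fixes F :: "'a::euclidean_space \<Rightarrow> 'b::euclidean_space"
  assumes [measurable]: "k \<in> borel_measurable borel" "F \<in> borel_measurable borel"
  shows "corr k F x = (LINT y|lborel. k (y - x) *\<^sub>R F y)"
  unfolding corr_def using integral_lborel_translate[of "\<lambda>y. k (y - x) *\<^sub>R F y" x] by simp

text \<open>One estimate serves three purposes, according to the choice of \<open>v\<close>:
  continuity of \<open>corr\<close> with \<open>v\<close> a translate of \<open>F\<close>,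
  differentiability with \<open>v\<close> a first order expansion, and convergence of mollifications
  with \<open>v\<close> constant.\<close>

lemma norm_corr_diff_le:
  fixes F :: "'a::euclidean_space \<Rightarrow> 'b::euclidean_space"
  assumes k: "Cc k" and F: "continuous_on UNIV F" and le: "\<And>z. k z \<noteq> 0 \<Longrightarrow> norm (F (x + z) - v z) \<le> \<epsilon>"
    and v: "integrable lborel (\<lambda>z. k z *\<^sub>R v z)"
  shows "norm (corr k F x - (LINT z|lborel. k z *\<^sub>R v z)) \<le> (LINT z|lborel. \<bar>k z\<bar>) * \<epsilon>"
proof -
  have "corr k F x - (LINT z|lborel. k z *\<^sub>R v z) = (LINT z|lborel. k z *\<^sub>R (F (x + z) - v z))"
    unfolding corr_def scaleR_diff_right
    by (rule Bochner_Integration.integral_diff[symmetric]) (intro corr_integrable k F v)+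
  also have "norm \<dots> \<le> (LINT z|lborel. \<bar>k z\<bar> * \<epsilon>)"
  proof (rule Bochner_Integration.integral_norm_bound_integral)
    show "integrable lborel (\<lambda>z. k z *\<^sub>R (F (x + z) - v z))"
      unfolding scaleR_diff_right by (intro Bochner_Integration.integrable_diff corr_integrable k F v)
    show "integrable lborel (\<lambda>z. \<bar>k z\<bar> * \<epsilon>)"
      using Cc_integrable[OF Cc_norm[OF k]] by simp
    show "norm (k z *\<^sub>R (F (x + z) - v z)) \<le> \<bar>k z\<bar> * \<epsilon>" for z
      using le[of z] by (cases "k z = 0") (auto intro: mult_left_mono)
  qed
  finally show ?thesis by simp
qed

text \<open>The divisor \<open>I + 1\<close> is used wherever a tolerance is divided by a quantity
  \<open>I\<close> that may be \<open>0\<close>.\<close>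

lemma mult_divide_add_1_less:
  fixes I e :: real
  assumes "0 \<le> I" "0 < e" shows "I * (e / (I + 1)) < e"
  using assms by (simp add: field_simps add_nonneg_pos)

lemma Cc_corr:
  fixes F :: "'a::euclidean_space \<Rightarrow> 'b::euclidean_space"
  assumes k: "Cc k" and F: "Cc F"
  shows "Cc (corr k F)"
proof -
  let ?I = "LINT z|lborel. \<bar>k z\<bar>"
  have I: "0 \<le> ?I" by simp
  obtain R where R: "R > 0" "\<And>x. R < norm x \<Longrightarrow> k x = 0" using k by (rule Cc_supportE) blast
  obtain R' where R': "R' > 0" "\<And>x. R' < norm x \<Longrightarrow> F x = 0" using F by (rule Cc_supportE) blast
  show ?thesis
  proof (rule CcI[where R = "R + R'"])
    show "continuous_on UNIV (corr k F)"
      unfolding continuous_on_iff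
    proof (intro ballI allI impI)
      fix x and e :: real assume "0 < e"
      obtain d where d: "d > 0" "\<And>x y. norm (x - y) < d \<Longrightarrow> norm (F x - F y) < e / (?I + 1)"
        using Cc_uniformly_continuous[OF F, of "e / (?I + 1)"] \<open>0 < e\<close> I by (auto intro: divide_pos_pos)
      have "dist (corr k F x') (corr k F x) < e" if "dist x' x < d" for x'
      proof -
        have "norm (corr k F x' - (LINT z|lborel. k z *\<^sub>R F (x + z))) \<le> ?I * (e / (?I + 1))"
          using that d(2)
          by (intro norm_corr_diff_le k Cc_continuous[OF F] corr_integrable) (auto simp: dist_norm intro!: less_imp_le)
        also have "\<dots> < e" by (rule mult_divide_add_1_less[OF I \<open>0 < e\<close>])
        finally show ?thesis by (simp add: dist_norm corr_def)
      qed
      then show "\<exists>d>0. \<forall>x'\<in>UNIV. dist x' x < d \<longrightarrow> dist (corr k F x') (corr k F x) < e"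
        using d(1) by blast
    qed
    fix x :: 'a assume x: "R + R' < norm x"
    have 0: "k z *\<^sub>R F (x + z) = 0" for z
      using R(2)[of z] R'(2)[of "x + z"] norm_diff_ineq[of x z] x by (cases "norm z \<le> R") auto
    show "corr k F x = 0" by (simp only: corr_def 0 Bochner_Integration.integral_zero)
  qed
qed

text \<open>Mean value inequality for \<open>u\<close> minus the linear map given by
  \<open>G x\<close>; the uniform continuity of \<open>G\<close> makes \<open>d\<close> independent
  of \<open>x\<close>, so that the expansion can be averaged.\<close>

lemma C1c_first_order:
  assumes u: "C1c u G" and "\<epsilon> > 0"
  obtains d where "d > 0" "\<And>x h. norm h < d \<Longrightarrow> \<bar>u (x + h) - u x - G x \<bullet> h\<bar> \<le> \<epsilon> * norm h"
proof -
  obtain d where d: "d > 0" "\<And>x y. norm (x - y) < d \<Longrightarrow> norm (G x - G y) < \<epsilon>"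
    using Cc_uniformly_continuous[of G \<epsilon>] assms by (auto simp: C1c_def)
  have "\<bar>u (x + h) - u x - G x \<bullet> h\<bar> \<le> \<epsilon> * norm h" if h: "norm h < d" for x h
  proof -
    let ?f = "\<lambda>y. u y - G x \<bullet> y"
    have "norm (?f (x + h) - ?f x) \<le> \<epsilon> * norm ((x + h) - x)"
    proof (rule differentiable_bound[where S = "ball x d" and f' = "\<lambda>y h. (G y - G x) \<bullet> h"])
      fix y assume y: "y \<in> ball x d"
      have "(u has_derivative (\<lambda>h. G y \<bullet> h)) (at y within ball x d)"
        using u by (auto simp: C1c_def C1_grad_def intro: has_derivative_at_withinI)
      then show "(?f has_derivative (\<lambda>h. (G y - G x) \<bullet> h)) (at y within ball x d)"
        by (auto intro!: derivative_eq_intros simp: inner_diff_left)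
      have "norm (G y - G x) \<le> \<epsilon>" using d(2)[of y x] y by (auto simp: dist_norm norm_minus_commute)
      then show "onorm (\<lambda>h. (G y - G x) \<bullet> h) \<le> \<epsilon>"
        by (intro onorm_bound) (auto intro!: order_trans[OF Cauchy_Schwarz_ineq2] mult_right_mono less_imp_le[OF \<open>\<epsilon> > 0\<close>])
    qed (use d(1) h in \<open>auto simp: dist_norm\<close>)
    then show ?thesis by (simp add: algebra_simps inner_add_right)
  qed
  then show ?thesis using that d(1) by blast
qed

text \<open>The uniform first order expansion of \<open>u\<close> is averaged against
  \<open>k\<close>. The derivative falls on \<open>u\<close>, so a continuous kernel such as a tent
  is enough.\<close>

lemma C1c_corr:
  assumes k: "Cc k" and u: "C1c u G"
  shows "C1c (corr k u) (corr k G)"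
proof -
  let ?I = "LINT z|lborel. \<bar>k z\<bar>"
  have I: "0 \<le> ?I" by simp
  have uc: "Cc u" and Gc: "Cc G" using u by (auto simp: C1c_def)
  have "(corr k u has_derivative (\<lambda>h. corr k G x \<bullet> h)) (at x)" for x
    unfolding has_derivative_at_alt
  proof (intro conjI allI impI)
    show "bounded_linear (\<lambda>h. corr k G x \<bullet> h)" by (rule bounded_linear_inner_right)
    fix e :: real assume "0 < e"
    obtain d where d: "d > 0" "\<And>x h. norm h < d \<Longrightarrow> \<bar>u (x + h) - u x - G x \<bullet> h\<bar> \<le> (e / (?I + 1)) * norm h"
      using C1c_first_order[OF u, of "e / (?I + 1)"] \<open>0 < e\<close> I by (auto intro: divide_pos_pos)
    have "norm (corr k u y - corr k u x - corr k G x \<bullet> (y - x)) \<le> e * norm (y - x)" if y: "norm (y - x) < d" for y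
    proof -
      define h where "h = y - x"
      have i1: "integrable lborel (\<lambda>z. k z * u (x + z))"
        using corr_integrable[OF k Cc_continuous[OF uc]] by simp
      have i2: "integrable lborel (\<lambda>z. k z *\<^sub>R G (x + z))"
        by (rule corr_integrable[OF k Cc_continuous[OF Gc]])
      have i3: "integrable lborel (\<lambda>z. k z * (G (x + z) \<bullet> h))"
        using integrable_inner_left[OF i2, of h] by simp
      have "(LINT z|lborel. k z *\<^sub>R (u (x + z) + G (x + z) \<bullet> h)) = corr k u x + corr k G x \<bullet> h"
        using i1 i2 i3 integral_inner_left[OF i2, of h] unfolding corr_def by (simp add: distrib_left)
      moreover have "norm (corr k u y - (LINT z|lborel. k z *\<^sub>R (u (x + z) + G (x + z) \<bullet> h))) \<le> ?I * (e / (?I + 1) * norm h)"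
      proof (intro norm_corr_diff_le k Cc_continuous[OF uc])
        show "integrable lborel (\<lambda>z. k z *\<^sub>R (u (x + z) + G (x + z) \<bullet> h))"
          using i1 i3 by (simp add: distrib_left)
        fix z
        show "norm (u (y + z) - (u (x + z) + G (x + z) \<bullet> h)) \<le> e / (?I + 1) * norm h"
          using d(2)[of h "x + z"] y by (simp add: h_def algebra_simps)
      qed
      moreover have "?I * (e / (?I + 1) * norm h) \<le> e * norm h"
      proof -
        have "?I * (e / (?I + 1)) \<le> e" using mult_divide_add_1_less[OF I \<open>0 < e\<close>] by simp
        from mult_right_mono[OF this norm_ge_zero[of h]] show ?thesis by (simp only: mult.assoc)
      qed
      ultimately show ?thesis by (simp add: h_def algebra_simps)
    qed
    then show "\<exists>d>0. \<forall>y. norm (y - x) < d \<longrightarrow> norm (corr k u y - corr k u x - corr k G x \<bullet> (y - x)) \<le> e * norm (y - x)"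
      using d(1) by blast
  qed
  then show ?thesis
    unfolding C1c_def C1_grad_def using Cc_corr[OF k uc] Cc_corr[OF k Gc] Cc_continuous by blast
qed

lemma nn_integral_small_support:
  fixes h :: "'a::euclidean_space \<Rightarrow> real"
  assumes "\<And>x. \<bar>h x\<bar> \<le> \<epsilon>" "\<And>x. R < norm x \<Longrightarrow> h x = 0"
  shows "(\<integral>\<^sup>+x. ennreal \<bar>h x\<bar> \<partial>lborel) \<le> ennreal (\<epsilon> * measure lborel (cball (0::'a) R))"
proof -
  have "0 \<le> \<epsilon>" using assms(1)[of 0] by simp
  have "(\<integral>\<^sup>+x. ennreal \<bar>h x\<bar> \<partial>lborel) \<le> (\<integral>\<^sup>+x. ennreal \<epsilon> * indicator (cball (0::'a) R) x \<partial>lborel)"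
  proof (intro nn_integral_mono)
    fix x
    show "ennreal \<bar>h x\<bar> \<le> ennreal \<epsilon> * indicator (cball 0 R) x"
      using assms(1)[of x] assms(2)[of x] by (cases "norm x \<le> R") (auto intro!: ennreal_leI)
  qed
  also have "\<dots> = ennreal \<epsilon> * emeasure lborel (cball (0::'a) R)"
    by (rule nn_integral_cmult_indicator) auto
  also have "\<dots> = ennreal (\<epsilon> * measure lborel (cball (0::'a) R))"
    using \<open>0 \<le> \<epsilon>\<close> emeasure_lborel_cball_finite[of "0::'a" R]
    by (simp add: emeasure_eq_ennreal_measure ennreal_mult)
  finally show ?thesis .
qed

text \<open>Uniform continuity bounds the difference pointwise, and for
  \<open>norm (a - b) < 1\<close> the difference is, up to a translation, supported in a fixed
  ball.\<close>

lemma Cc_translate_L1_small: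
  fixes k :: "'a::euclidean_space \<Rightarrow> real"
  assumes k: "Cc k" and "\<epsilon> > 0"
  obtains d where "d > 0" "\<And>a b. norm (a - b) < d \<Longrightarrow> (\<integral>\<^sup>+y. ennreal \<bar>k (y - a) - k (y - b)\<bar> \<partial>lborel) \<le> ennreal \<epsilon>"
proof -
  have [measurable]: "k \<in> borel_measurable borel" using k by (rule Cc_measurable)
  obtain R where R: "R > 0" "\<And>x. R < norm x \<Longrightarrow> k x = 0" using k by (rule Cc_supportE) blast
  define M where "M = measure lborel (cball (0::'a) (R + 1))"
  have M: "0 \<le> M" by (simp add: M_def)
  have "\<epsilon> / (M + 1) > 0" using M \<open>\<epsilon> > 0\<close> by simp
  then obtain d where d: "d > 0" "\<And>x y. norm (x - y) < d \<Longrightarrow> norm (k x - k y) < \<epsilon> / (M + 1)"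
    using Cc_uniformly_continuous[OF k] by blast
  have "(\<integral>\<^sup>+y. ennreal \<bar>k (y - a) - k (y - b)\<bar> \<partial>lborel) \<le> ennreal \<epsilon>" if ab: "norm (a - b) < min d 1" for a b
  proof -
    have "(\<integral>\<^sup>+y. ennreal \<bar>k (y - a) - k (y - b)\<bar> \<partial>lborel) = (\<integral>\<^sup>+y. ennreal \<bar>k y - k (y + (a - b))\<bar> \<partial>lborel)"
      using nn_integral_lborel_translate[of "\<lambda>y. ennreal \<bar>k (y - a) - k (y - b)\<bar>" a] by (simp add: algebra_simps)
    also have "\<dots> \<le> ennreal (\<epsilon> / (M + 1) * M)"
      unfolding M_def
    proof (rule nn_integral_small_support)
      fix y
      show "\<bar>k y - k (y + (a - b))\<bar> \<le> \<epsilon> / (measure lborel (cball (0::'a) (R + 1)) + 1)"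
        using d(2)[of y "y + (a - b)"] ab by (simp add: M_def norm_minus_commute)
      assume "R + 1 < norm y"
      then show "k y - k (y + (a - b)) = 0"
        using R(2)[of y] R(2)[of "y + (a - b)"] norm_diff_ineq[of y "a - b"] ab by simp
    qed
    also have "\<epsilon> / (M + 1) * M \<le> \<epsilon>" using mult_divide_add_1_less[OF M \<open>\<epsilon> > 0\<close>] by (simp add: mult.commute)
    finally show ?thesis by (simp add: ennreal_leI)
  qed
  then show ?thesis using that[of "min d 1"] d(1) by auto
qed

section \<open>Tent mollifiers\<close>

definition tent :: "real \<Rightarrow> 'a::euclidean_space \<Rightarrow> real" where
  "tent \<delta> z = max 0 (1 - norm z / \<delta>)"

text \<open>The kernel is even, so that correlating with it is convolving with it; this lets
  mollifications move between kernels and functions.\<close>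

definition mollifier :: "real \<Rightarrow> 'a::euclidean_space \<Rightarrow> real" where
  "mollifier \<delta> z = tent \<delta> z / (LINT w|lborel. tent \<delta> (w::'a))"

lemma Cc_tent: "0 < \<delta> \<Longrightarrow> Cc (tent \<delta>)"
  by (rule CcI[where R = \<delta>]) (auto simp: tent_def intro!: continuous_intros)

lemma tent_integral_pos:
  assumes "0 < \<delta>"
  shows "0 < (LINT w|lborel. tent \<delta> (w::'a::euclidean_space))"
proof -
  have "0 < 1 / 2 * measure lborel (ball (0::'a) (\<delta> / 2))"
    using content_ball_pos[of "\<delta> / 2" "0::'a"] assms by simp
  also have "\<dots> = (LINT w|lborel. 1 / 2 * indicator (ball (0::'a) (\<delta> / 2)) w)"
    by simp
  also have "\<dots> \<le> (LINT w|lborel. tent \<delta> (w::'a))"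
  proof (rule integral_mono)
    show "integrable lborel (tent \<delta> :: 'a \<Rightarrow> real)" by (intro Cc_integrable Cc_tent assms)
    show "integrable lborel (\<lambda>w. 1 / 2 * indicator (ball (0::'a) (\<delta> / 2)) w :: real)"
      using emeasure_lborel_ball_finite[of "0::'a" "\<delta> / 2"] by (intro integrable_mult_right integrable_real_indicator) auto
    show "1 / 2 * indicator (ball 0 (\<delta> / 2)) w \<le> tent \<delta> w" for w :: 'a
      using assms by (auto simp: indicator_def tent_def field_simps max_def)
  qed
  finally show ?thesis .
qed

context
  fixes \<delta> :: real
  assumes \<delta>: "0 < \<delta>"
begin

lemma Cc_mollifier: "Cc (mollifier \<delta> :: 'a::euclidean_space \<Rightarrow> real)"
  using Cc_scaleR_const[OF Cc_tent[OF \<delta>], of "inverse (LINT w|lborel. tent \<delta> (w::'a))"]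
  unfolding mollifier_def by (simp add: divide_inverse mult.commute)

lemma mollifier_nonneg: "0 \<le> mollifier \<delta> z"
  unfolding mollifier_def using less_imp_le[OF tent_integral_pos[OF \<delta>]]
  by (intro divide_nonneg_nonneg) (auto simp: tent_def)

lemma mollifier_minus: "mollifier \<delta> (- z) = mollifier \<delta> z"
  by (simp add: mollifier_def tent_def)

lemma mollifier_support: "mollifier \<delta> z \<noteq> 0 \<Longrightarrow> norm z < \<delta>"
  using \<delta> by (auto simp: mollifier_def tent_def max_def split: if_splits)

lemma integral_mollifier: "(LINT z|lborel. mollifier \<delta> (z::'a::euclidean_space)) = 1"
  unfolding mollifier_def using tent_integral_pos[OF \<delta>, where 'a='a] by simp

lemma integral_abs_mollifier: "(LINT z|lborel. \<bar>mollifier \<delta> (z::'a::euclidean_space)\<bar>) = 1"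
  by (simp add: integral_mollifier mollifier_nonneg)

lemma nn_integral_mollifier: "(\<integral>\<^sup>+z. ennreal \<bar>mollifier \<delta> (z::'a::euclidean_space)\<bar> \<partial>lborel) = 1"
proof -
  have "(\<integral>\<^sup>+z. ennreal \<bar>mollifier \<delta> (z::'a)\<bar> \<partial>lborel) = ennreal (LINT z|lborel. \<bar>mollifier \<delta> (z::'a)\<bar>)"
    using Cc_integrable[OF Cc_norm[OF Cc_mollifier]] by (intro nn_integral_eq_integral) auto
  then show ?thesis by (simp add: integral_abs_mollifier)
qed

lemma norm_corr_mollifier_le:
  fixes F :: "'a::euclidean_space \<Rightarrow> 'b::euclidean_space"
  assumes F: "continuous_on UNIV F" and le: "\<And>z. norm z < \<delta> \<Longrightarrow> norm (F (x + z) - F x) \<le> \<epsilon>"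
  shows "norm (corr (mollifier \<delta>) F x - F x) \<le> \<epsilon>"
proof -
  have "norm (corr (mollifier \<delta>) F x - (LINT z|lborel. mollifier \<delta> (z::'a) *\<^sub>R F x)) \<le> (LINT z|lborel. \<bar>mollifier \<delta> (z::'a)\<bar>) * \<epsilon>"
    by (rule norm_corr_diff_le[OF Cc_mollifier F]) (auto intro!: le mollifier_support Cc_integrable Cc_scaleR_right Cc_mollifier)
  then show ?thesis
    using integral_mollifier[where 'a='a] integral_abs_mollifier[where 'a='a]
    by (simp add: Cc_integrable Cc_mollifier)
qed

end

lemma Cc_corr_mollifier_uniform:
  fixes F :: "'a::euclidean_space \<Rightarrow> 'b::euclidean_space"
  assumes F: "Cc F" and "\<epsilon> > 0"
  obtains d where "d > 0" "\<And>\<delta> x. 0 < \<delta> \<Longrightarrow> \<delta> < d \<Longrightarrow> norm (corr (mollifier \<delta>) F x - F x) \<le> \<epsilon>"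
proof -
  obtain d where d: "d > 0" "\<And>x y. norm (x - y) < d \<Longrightarrow> norm (F x - F y) < \<epsilon>"
    using Cc_uniformly_continuous[OF assms] by blast
  have "norm (corr (mollifier \<delta>) F x - F x) \<le> \<epsilon>" if "0 < \<delta>" "\<delta> < d" for \<delta> x
    using d(2)[of "x + z" x for z] that by (intro norm_corr_mollifier_le Cc_continuous F) (auto intro: less_imp_le)
  then show ?thesis using that d(1) by blast
qed

text \<open>Mollifications are uniformly close, and a scale at most \<open>1\<close> keeps the
  supports in a fixed ball, where uniform smallness gives L1 smallness. In the application
  \<open>k\<close> is a kernel, so that \<open>\<tau>\<close> does not depend on the test
  function.\<close>

lemma corr_mollifier_L1_small:
  fixes k :: "'a::euclidean_space \<Rightarrow> real"
  assumes k: "Cc k" and "\<epsilon> > 0"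
  obtains \<tau> where "\<tau> > 0" "(\<integral>\<^sup>+x. ennreal \<bar>k x - corr (mollifier \<tau>) k x\<bar> \<partial>lborel) \<le> ennreal \<epsilon>"
proof -
  obtain R where R: "R > 0" "\<And>x. R < norm x \<Longrightarrow> k x = 0" using k by (rule Cc_supportE) blast
  define M where "M = measure lborel (cball (0::'a) (R + 1))"
  have M: "0 \<le> M" by (simp add: M_def)
  have "\<epsilon> / (M + 1) > 0" using M \<open>\<epsilon> > 0\<close> by simp
  then obtain d where d: "d > 0" "\<And>\<delta> x. 0 < \<delta> \<Longrightarrow> \<delta> < d \<Longrightarrow> norm (corr (mollifier \<delta>) k x - k x) \<le> \<epsilon> / (M + 1)"
    using Cc_corr_mollifier_uniform[OF k] by blast
  define \<tau> where "\<tau> = min (d / 2) 1"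
  have \<tau>: "0 < \<tau>" "\<tau> < d" "\<tau> \<le> 1" using d(1) by (auto simp: \<tau>_def)
  have "(\<integral>\<^sup>+x. ennreal \<bar>k x - corr (mollifier \<tau>) k x\<bar> \<partial>lborel) \<le> ennreal (\<epsilon> / (M + 1) * M)"
    unfolding M_def
  proof (rule nn_integral_small_support)
    fix x
    show "\<bar>k x - corr (mollifier \<tau>) k x\<bar> \<le> \<epsilon> / (measure lborel (cball (0::'a) (R + 1)) + 1)"
      using d(2)[OF \<tau>(1,2), of x] by (simp add: M_def abs_minus_commute)
    assume x: "R + 1 < norm x"
    have 0: "mollifier \<tau> z *\<^sub>R k (x + z) = 0" for z
      using mollifier_support[OF \<tau>(1), of z] R(2)[of "x + z"] norm_diff_ineq[of x z] x \<tau>(3) by force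
    have "corr (mollifier \<tau>) k x = 0" by (simp only: corr_def 0 Bochner_Integration.integral_zero)
    then show "k x - corr (mollifier \<tau>) k x = 0" using R(2)[of x] x by simp
  qed
  also have "\<epsilon> / (M + 1) * M \<le> \<epsilon>" using mult_divide_add_1_less[OF M \<open>\<epsilon> > 0\<close>] by (simp add: mult.commute)
  finally show ?thesis using that[OF \<tau>(1)] by (simp add: ennreal_leI order_trans)
qed

lemma nn_integral_norm_corr_le:
  fixes F :: "'a::euclidean_space \<Rightarrow> 'b::euclidean_space"
  assumes k: "Cc k" and F: "Cc F"
  shows "(\<integral>\<^sup>+x. ennreal (norm (corr k F x)) \<partial>lborel)
    \<le> (\<integral>\<^sup>+z. ennreal \<bar>k z\<bar> \<partial>lborel) * (\<integral>\<^sup>+x. ennreal (norm (F x)) \<partial>lborel)"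
proof -
  note [measurable] = Cc_measurable[OF k] Cc_measurable[OF F]
  have "(\<integral>\<^sup>+x. ennreal (norm (corr k F x)) \<partial>lborel)
     \<le> (\<integral>\<^sup>+x. (\<integral>\<^sup>+z. ennreal \<bar>k z\<bar> * ennreal (norm (F (z + x))) \<partial>lborel) \<partial>lborel)"
  proof (intro nn_integral_mono)
    fix x
    have "ennreal (norm (corr k F x)) \<le> (\<integral>\<^sup>+z. norm (k z *\<^sub>R F (x + z)) \<partial>lborel)"
      unfolding corr_def by (intro integral_norm_bound_ennreal corr_integrable k Cc_continuous[OF F])
    then show "ennreal (norm (corr k F x)) \<le> (\<integral>\<^sup>+z. ennreal \<bar>k z\<bar> * ennreal (norm (F (z + x))) \<partial>lborel)"
      by (simp add: ennreal_mult add.commute)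
  qed
  also have "\<dots> = (\<integral>\<^sup>+z. (\<integral>\<^sup>+x. ennreal \<bar>k z\<bar> * ennreal (norm (F (z + x))) \<partial>lborel) \<partial>lborel)"
    by (rule lborel_pair.Fubini') measurable
  also have "\<dots> = (\<integral>\<^sup>+z. ennreal \<bar>k z\<bar> * (\<integral>\<^sup>+x. ennreal (norm (F x)) \<partial>lborel) \<partial>lborel)"
    using nn_integral_lborel_translate[of "\<lambda>x. ennreal (norm (F x))"] by (simp add: nn_integral_cmult)
  also have "\<dots> = (\<integral>\<^sup>+z. ennreal \<bar>k z\<bar> \<partial>lborel) * (\<integral>\<^sup>+x. ennreal (norm (F x)) \<partial>lborel)"
    by (rule nn_integral_multc) measurable
  finally show ?thesis .
qed

text \<open>Each translation by \<open>z\<close> with \<open>norm z < \<delta>\<close> costs at most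
  \<open>\<delta>\<close> times the gradient norm. This factor compensates the reciprocal of the
  scale in \<open>trace_inequality\<close>.\<close>

lemma nn_integral_corr_mollifier_diff_le:
  fixes u :: "'a::euclidean_space \<Rightarrow> real"
  assumes \<delta>: "0 < \<delta>" and u: "C1c u G"
  shows "(\<integral>\<^sup>+x. ennreal \<bar>corr (mollifier \<delta>) u x - u x\<bar> \<partial>lborel) \<le> ennreal \<delta> * (\<integral>\<^sup>+x. ennreal (norm (G x)) \<partial>lborel)"
proof -
  let ?k = "mollifier \<delta> :: 'a \<Rightarrow> real"
  have uc: "Cc u" and u1: "C1_grad u G" using u by (auto simp: C1c_def)
  note k = Cc_mollifier[OF \<delta>]
  have km: "?k \<in> borel_measurable borel" by (rule Cc_measurable[OF k])
  note [measurable] = km Cc_measurable[OF uc]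
  have "(\<integral>\<^sup>+x. ennreal \<bar>corr ?k u x - u x\<bar> \<partial>lborel)
     \<le> (\<integral>\<^sup>+x. (\<integral>\<^sup>+z. ennreal \<bar>?k z\<bar> * ennreal \<bar>u (x + z) - u x\<bar> \<partial>lborel) \<partial>lborel)"
  proof (intro nn_integral_mono)
    fix x
    have i1: "integrable lborel (\<lambda>z. ?k z * u (x + z))"
      using corr_integrable[OF k Cc_continuous[OF uc]] by simp
    have i2: "integrable lborel (\<lambda>z. ?k z * u x)" by (intro integrable_mult_left Cc_integrable[OF k])
    have "corr ?k u x - u x = (LINT z|lborel. ?k z * (u (x + z) - u x))"
      using i1 i2 integral_mollifier[OF \<delta>, where 'a='a] by (simp add: corr_def right_diff_distrib)
    also have "ennreal \<bar>\<dots>\<bar> \<le> (\<integral>\<^sup>+z. norm (?k z * (u (x + z) - u x)) \<partial>lborel)"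
      using integral_norm_bound_ennreal[of lborel "\<lambda>z. ?k z * (u (x + z) - u x)"] i1 i2
      by (simp add: right_diff_distrib)
    finally show "ennreal \<bar>corr ?k u x - u x\<bar> \<le> (\<integral>\<^sup>+z. ennreal \<bar>?k z\<bar> * ennreal \<bar>u (x + z) - u x\<bar> \<partial>lborel)"
      by (simp add: ennreal_mult abs_mult)
  qed
  also have "\<dots> = (\<integral>\<^sup>+z. (\<integral>\<^sup>+x. ennreal \<bar>?k z\<bar> * ennreal \<bar>u (x + z) - u x\<bar> \<partial>lborel) \<partial>lborel)"
    by (rule lborel_pair.Fubini') measurable
  also have "\<dots> \<le> (\<integral>\<^sup>+z. ennreal \<bar>?k z\<bar> * (ennreal \<delta> * (\<integral>\<^sup>+x. ennreal (norm (G x)) \<partial>lborel)) \<partial>lborel)"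
  proof (intro nn_integral_mono)
    fix z
    show "(\<integral>\<^sup>+x. ennreal \<bar>?k z\<bar> * ennreal \<bar>u (x + z) - u x\<bar> \<partial>lborel)
      \<le> ennreal \<bar>?k z\<bar> * (ennreal \<delta> * (\<integral>\<^sup>+x. ennreal (norm (G x)) \<partial>lborel))"
    proof (cases "?k z = 0")
      case False
      have "(\<integral>\<^sup>+x. ennreal \<bar>u (x + z) - u x\<bar> \<partial>lborel) \<le> ennreal (norm z) * (\<integral>\<^sup>+x. ennreal (norm (G x)) \<partial>lborel)"
        using nn_integral_translate_diff_le[OF u1, of UNIV UNIV z] by simp
      also have "\<dots> \<le> ennreal \<delta> * (\<integral>\<^sup>+x. ennreal (norm (G x)) \<partial>lborel)"
        using mollifier_support[OF \<delta> False] by (intro mult_right_mono ennreal_leI) auto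
      finally show ?thesis by (simp add: nn_integral_cmult mult_left_mono)
    qed simp
  qed
  also have "\<dots> = ennreal \<delta> * (\<integral>\<^sup>+x. ennreal (norm (G x)) \<partial>lborel)"
    using nn_integral_mollifier[OF \<delta>, where 'a='a] by (simp add: nn_integral_multc)
  finally show ?thesis .
qed

lemma integral_lborel_reflect:
  fixes f :: "'a::euclidean_space \<Rightarrow> 'b::{banach, second_countable_topology}"
  assumes [measurable]: "f \<in> borel_measurable borel"
  shows "(LINT x|lborel. f (- x)) = (LINT x|lborel. f x)"
proof -
  have "(lborel :: 'a measure) = distr lborel borel (\<lambda>x. - x)"
    using lborel_affine[of "- 1" "0::'a"] by (simp add: density_1 one_ennreal_def[symmetric])
  then have "(LINT x|lborel. f x) = (LINT x|distr lborel borel (\<lambda>x. - x). f x)" by simp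
  also have "\<dots> = (LINT x|lborel. f (- x))" by (intro integral_distr) auto
  finally show ?thesis ..
qed

lemma integrable_Cc_pair:
  fixes k :: "'a::euclidean_space \<Rightarrow> real" and l :: "'c::euclidean_space \<Rightarrow> real"
  assumes k: "Cc k" and l: "Cc l" and H: "continuous_on UNIV H"
  shows "integrable (lborel \<Otimes>\<^sub>M lborel) (\<lambda>(y, z). k y * l z * H (y, z) :: real)"
proof -
  obtain R where R: "\<And>x. R < norm x \<Longrightarrow> k x = 0" using k by (rule Cc_supportE) blast
  obtain R' where R': "\<And>x. R' < norm x \<Longrightarrow> l x = 0" using l by (rule Cc_supportE) blast
  have "Cc (\<lambda>p. k (fst p) * l (snd p) * H p)"
  proof (rule CcI[where R = "R + R'"])
    show "continuous_on UNIV (\<lambda>p. k (fst p) * l (snd p) * H p)"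
      by (intro continuous_intros H continuous_on_compose2[OF Cc_continuous[OF k]]
          continuous_on_compose2[OF Cc_continuous[OF l]]) auto
    fix p :: "'a \<times> 'c" assume "R + R' < norm p"
    then have "R + R' < norm (fst p) + norm (snd p)"
      using norm_Pair_le[of "fst p" "snd p"] by simp
    then have "R < norm (fst p) \<or> R' < norm (snd p)" by linarith
    then show "k (fst p) * l (snd p) * H p = 0" using R R' by auto
  qed
  then have "integrable lborel (\<lambda>p. k (fst p) * l (snd p) * H p)" by (rule Cc_integrable)
  then show ?thesis by (simp add: lborel_prod case_prod_unfold)
qed

text \<open>Correlating twice is correlating with the convolution of the kernels, and this
  convolution is \<open>corr (mollifier \<tau>) k\<close> because the mollifier is even. The
  mollification is thereby transferred from the test function to the kernel.\<close>

lemma corr_corr_mollifier: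
  fixes k \<phi> :: "'a::euclidean_space \<Rightarrow> real"
  assumes \<tau>: "0 < \<tau>" and k: "Cc k" and \<phi>: "Cc \<phi>"
  shows "corr k (corr (mollifier \<tau>) \<phi>) x = corr (corr (mollifier \<tau>) k) \<phi> x"
proof -
  let ?m = "mollifier \<tau> :: 'a \<Rightarrow> real"
  note m = Cc_mollifier[OF \<tau>, where 'a='a]
  note [measurable] = Cc_measurable[OF k] Cc_measurable[OF \<phi>] Cc_measurable[OF m]
  have \<phi>x: "Cc (\<lambda>w. \<phi> (w + x))" by (rule Cc_shift[OF \<phi>])
  have "corr k (corr ?m \<phi>) x = (LINT y|lborel. (LINT z|lborel. k y * ?m z * \<phi> (x + y + z)))"
    by (simp add: corr_def mult.assoc)
  also have "\<dots> = (LINT z|lborel. (LINT y|lborel. k y * ?m z * \<phi> (x + y + z)))"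
  proof -
    have "continuous_on UNIV (\<lambda>p::'a \<times> 'a. \<phi> (x + fst p + snd p))"
      by (intro continuous_on_compose2[OF Cc_continuous[OF \<phi>]] continuous_intros) auto
    from integrable_Cc_pair[OF k m this] have "integrable (lborel \<Otimes>\<^sub>M lborel) (\<lambda>(y, z). k y * ?m z * \<phi> (x + y + z))"
      by (simp add: case_prod_unfold)
    from lborel_pair.Fubini_integral[OF this] show ?thesis by simp
  qed
  also have "\<dots> = (LINT z|lborel. (LINT w|lborel. ?m z * \<phi> (w + x) * k (w - z)))"
  proof (rule Bochner_Integration.integral_cong[OF refl])
    fix z
    show "(LINT y|lborel. k y * ?m z * \<phi> (x + y + z)) = (LINT w|lborel. ?m z * \<phi> (w + x) * k (w - z))"
      using integral_lborel_translate[of "\<lambda>w. ?m z * \<phi> (w + x) * k (w - z)" z]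
      by (simp add: algebra_simps)
  qed
  also have "\<dots> = (LINT w|lborel. (LINT z|lborel. ?m z * \<phi> (w + x) * k (w - z)))"
  proof -
    have "continuous_on UNIV (\<lambda>p::'a \<times> 'a. k (snd p - fst p))"
      by (intro continuous_on_compose2[OF Cc_continuous[OF k]] continuous_intros) auto
    from integrable_Cc_pair[OF m \<phi>x this] have "integrable (lborel \<Otimes>\<^sub>M lborel) (\<lambda>(z, w). ?m z * \<phi> (w + x) * k (w - z))"
      by (simp add: case_prod_unfold)
    from lborel_pair.Fubini_integral[OF this] show ?thesis by simp
  qed
  also have "\<dots> = (LINT w|lborel. corr ?m k w * \<phi> (x + w))"
  proof (rule Bochner_Integration.integral_cong[OF refl])
    fix w
    have "(LINT z|lborel. ?m z * \<phi> (w + x) * k (w - z)) = (LINT z|lborel. \<phi> (w + x) * (?m z * k (w - z)))"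
      by (simp add: algebra_simps)
    also have "\<dots> = \<phi> (w + x) * (LINT z|lborel. ?m z * k (w - z))" by (rule integral_mult_right_zero)
    also have "(LINT z|lborel. ?m z * k (w - z)) = (LINT z|lborel. ?m (- z) * k (w - - z))"
      by (rule integral_lborel_reflect[symmetric]) measurable
    also have "\<dots> = corr ?m k w" by (simp add: corr_def mollifier_minus[OF \<tau>])
    finally show "(LINT z|lborel. ?m z * \<phi> (w + x) * k (w - z)) = corr ?m k w * \<phi> (x + w)"
      by (simp add: add.commute mult.commute)
  qed
  also have "\<dots> = corr (corr ?m k) \<phi> x" by (simp add: corr_def[of "corr ?m k"])
  finally show ?thesis .
qed

section \<open>Functionals of the gradient represented by continuous fields\<close>

lemma Cc_sum:
  assumes "finite I" "\<And>i. i \<in> I \<Longrightarrow> Cc (F i)"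
  shows "Cc (\<lambda>x. \<Sum>i\<in>I. F i x)"
  using assms
proof (induction I rule: finite_induct)
  case empty
  show ?case by (rule CcI[where R = 0]) auto
next
  case (insert i I)
  then show ?case using Cc_add[of "F i" "\<lambda>x. \<Sum>i\<in>I. F i x"] by simp
qed

lemma Cc_bcontfun: "Cc F \<Longrightarrow> apply_bcontfun (Bcontfun F) = F"
  using Cc_continuous Cc_bounded Bcontfun_inverse bcontfun_normI by metis

text \<open>The one-sided bound, applied also to the negative of \<open>F\<close>, controls the
  absolute value.\<close>

definition Cc_functional :: "real \<Rightarrow> (('a::euclidean_space \<Rightarrow> 'a) \<Rightarrow> real) \<Rightarrow> bool" where
  "Cc_functional c T \<longleftrightarrow>
     (\<forall>F H. Cc F \<longrightarrow> Cc H \<longrightarrow> T (\<lambda>x. F x + H x) = T F + T H) \<and>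
     (\<forall>a F. Cc F \<longrightarrow> T (\<lambda>x. a *\<^sub>R F x) = a * T F) \<and>
     (\<forall>F. Cc F \<longrightarrow> T F \<le> c * (LINT x|lborel. norm (F x)))"

text \<open>Hahn--Banach on a subspace of the bounded continuous fields; the dominating functional
  is a multiple of the L1 norm, not of the norm of the type. Since the functional on gradients is
  passed as the graph \<open>K\<close>, no primitive has to be chosen: that
  \<open>\<Lambda> u\<close> depends on the gradient of \<open>u\<close> alone is part of the
  conclusion.\<close>

lemma extend_gradient_functional:
  fixes \<Lambda> :: "('a::euclidean_space \<Rightarrow> real) \<Rightarrow> real"
  assumes c: "0 \<le> c"
    and add: "\<And>u G v H. C1c u G \<Longrightarrow> C1c v H \<Longrightarrow> \<Lambda> (\<lambda>x. u x + v x) = \<Lambda> u + \<Lambda> v"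
    and scale: "\<And>a u G. C1c u G \<Longrightarrow> \<Lambda> (\<lambda>x. a * u x) = a * \<Lambda> u"
    and bound: "\<And>u G. C1c u G \<Longrightarrow> \<Lambda> u \<le> c * (LINT x|lborel. norm (G x))"
  obtains T where "Cc_functional c T" "\<And>u G. C1c u G \<Longrightarrow> T G = \<Lambda> u"
proof -
  define S where "S = {F :: 'a \<Rightarrow>\<^sub>C 'a. Cc (apply_bcontfun F)}"
  define p where "p F = c * (LINT x|lborel. norm (apply_bcontfun F x))" for F :: "'a \<Rightarrow>\<^sub>C 'a"
  define K where "K = {(F :: 'a \<Rightarrow>\<^sub>C 'a, a). \<exists>u. C1c u (apply_bcontfun F) \<and> a = \<Lambda> u}"
  have zero: "C1c (\<lambda>x::'a. 0) (\<lambda>x. 0)"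
    unfolding C1c_def C1_grad_def by (auto intro!: CcI[where R = 0] derivative_eq_intros)
  have addp: "apply_bcontfun (F + H) = (\<lambda>x. apply_bcontfun F x + apply_bcontfun H x)"
    and scalep: "apply_bcontfun (a *\<^sub>R F) = (\<lambda>x. a *\<^sub>R apply_bcontfun F x)"
    and zerop: "apply_bcontfun (0 :: 'a \<Rightarrow>\<^sub>C 'a) = (\<lambda>x. 0)" for F H :: "'a \<Rightarrow>\<^sub>C 'a" and a
    by auto
  have int: "integrable lborel (\<lambda>x. norm (apply_bcontfun F x))" if "F \<in> S" for F
    using that by (intro Cc_integrable Cc_norm) (simp add: S_def)
  obtain T where T: "\<And>x y. x \<in> S \<Longrightarrow> y \<in> S \<Longrightarrow> T (x + y) = T x + T y"
    "\<And>x a. x \<in> S \<Longrightarrow> T (a *\<^sub>R x) = a * T x" "\<And>x. x \<in> S \<Longrightarrow> T x \<le> p x" "\<And>z a. (z, a) \<in> K \<Longrightarrow> T z = a"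
  proof (rule Hahn_Banach_dominated[of S p K])
    show "subspace S"
      unfolding subspace_def S_def mem_Collect_eq addp scalep zerop
      using zero by (auto intro: Cc_add Cc_scaleR_const simp: C1c_def)
    show "sublinear_on S p"
      unfolding sublinear_on_def
    proof (intro conjI ballI allI impI)
      fix F H assume F: "F \<in> S" and H: "H \<in> S"
      have "(LINT x|lborel. norm (apply_bcontfun F x + apply_bcontfun H x))
          \<le> (LINT x|lborel. norm (apply_bcontfun F x) + norm (apply_bcontfun H x))"
        using F H by (intro integral_mono Cc_integrable Cc_norm Cc_add norm_triangle_ineq) (auto simp: S_def)
      also have "\<dots> = (LINT x|lborel. norm (apply_bcontfun F x)) + (LINT x|lborel. norm (apply_bcontfun H x))"
        by (rule Bochner_Integration.integral_add) (intro int F H)+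
      finally have "c * (LINT x|lborel. norm (apply_bcontfun F x + apply_bcontfun H x)) \<le>
          c * ((LINT x|lborel. norm (apply_bcontfun F x)) + (LINT x|lborel. norm (apply_bcontfun H x)))"
        using c by (rule mult_left_mono)
      then show "p (F + H) \<le> p F + p H" unfolding p_def addp by (simp only: distrib_left)
    next
      fix F and a :: real assume "F \<in> S" "0 < a"
      then show "p (a *\<^sub>R F) \<le> a * p F" unfolding p_def scalep by simp
    qed
    show "(0, 0) \<in> K"
      using zero scale[OF zero, of 0] unfolding K_def zerop by auto
    show "z \<in> S \<and> a \<le> p z" if "(z, a) \<in> K" for z a
      using that bound unfolding K_def S_def p_def by (auto simp: C1c_def)
    show "(z + w, a + b) \<in> K" if "(z, a) \<in> K" "(w, b) \<in> K" for z a w b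
      using that C1c_add add unfolding K_def addp by fastforce
    show "(a' *\<^sub>R z, a' * a) \<in> K" if "(z, a) \<in> K" for z a a'
      using that C1c_scale scale unfolding K_def scalep by fastforce
  qed blast
  define T' where "T' F = T (Bcontfun F)" for F
  have BS: "Bcontfun F \<in> S" if "Cc F" for F using that by (simp add: S_def Cc_bcontfun)
  show ?thesis
  proof (rule that[of T'])
    show "Cc_functional c T'"
      unfolding Cc_functional_def
    proof (intro conjI allI impI)
      fix F H :: "'a \<Rightarrow> 'a" assume F: "Cc F" and H: "Cc H"
      have "Bcontfun (\<lambda>x. F x + H x) = Bcontfun F + Bcontfun H"
        using F H by (intro bcontfun_eqI) (simp add: Cc_bcontfun Cc_add)
      then show "T' (\<lambda>x. F x + H x) = T' F + T' H" unfolding T'_def by (simp add: T(1) BS F H)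
    next
      fix a and F :: "'a \<Rightarrow> 'a" assume F: "Cc F"
      have "Bcontfun (\<lambda>x. a *\<^sub>R F x) = a *\<^sub>R Bcontfun F"
        using F by (intro bcontfun_eqI) (simp add: Cc_bcontfun Cc_scaleR_const)
      then show "T' (\<lambda>x. a *\<^sub>R F x) = a * T' F" unfolding T'_def by (simp add: T(2) BS F)
    next
      fix F :: "'a \<Rightarrow> 'a" assume F: "Cc F"
      show "T' F \<le> c * (LINT x|lborel. norm (F x))"
        using T(3)[OF BS[OF F]] by (simp add: T'_def p_def Cc_bcontfun[OF F])
    qed
    show "T' G = \<Lambda> u" if "C1c u G" for u G
      unfolding T'_def using that by (intro T(4)) (auto simp: K_def C1c_def Cc_bcontfun)
  qed
qed

text \<open>Total boundedness gives a finite net, and a Borel choice of a nearby net point is built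
  by induction on the net. It turns an integral into a finite sum, on which a linear functional can
  be evaluated.\<close>

lemma finite_range_approximation:
  assumes "0 < d"
  obtains s :: "'a::euclidean_space \<Rightarrow> 'a"
  where "s \<in> borel_measurable borel" "finite (range s)" "\<And>x. norm x \<le> R \<Longrightarrow> norm (s x - x) < d"
proof -
  obtain X where X: "finite X" "cball (0::'a) R \<subseteq> (\<Union>x\<in>X. ball x d)"
    using compact_cball[of "0::'a" R] assms unfolding compact_eq_totally_bounded by blast
  have "\<exists>s. s \<in> borel_measurable borel \<and> finite (range s) \<and> (\<forall>x\<in>(\<Union>a\<in>X. ball a d). norm (s x - x) < d)"
    using X(1)
  proof (induction X rule: finite_induct)
    case empty
    show ?case by (intro exI[of _ "\<lambda>x. 0"]) auto
  next
    case (insert a X)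
    then obtain s where s: "s \<in> borel_measurable borel" "finite (range s)" "\<forall>x\<in>(\<Union>a\<in>X. ball a d). norm (s x - x) < d"
      by blast
    define t where "t x = (if x \<in> ball a d then a else s x)" for x
    have "t \<in> borel_measurable borel"
      unfolding t_def using s(1) by (intro measurable_If_set) auto
    moreover have "finite (range t)"
      by (rule finite_subset[of _ "insert a (range s)"]) (auto simp: t_def s(2))
    moreover have "\<forall>x\<in>(\<Union>a\<in>insert a X. ball a d). norm (t x - x) < d"
      using s(3) by (auto simp: t_def dist_norm)
    ultimately show ?case by blast
  qed
  then obtain s where s: "s \<in> borel_measurable borel" "finite (range s)"
    "\<And>x. x \<in> (\<Union>a\<in>X. ball a d) \<Longrightarrow> norm (s x - x) < d" by blast
  show ?thesis
  proof (rule that[OF s(1,2)])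
    fix x :: 'a assume "norm x \<le> R"
    then have "x \<in> cball 0 R" by simp
    then show "norm (s x - x) < d" using X(2) s(3) by blast
  qed
qed

text \<open>If \<open>T\<close> were integration against a bounded field \<open>W\<close>, this
  would be the integral of \<open>W y\<close> with weight \<open>\<rho> (y - x)\<close>, that is, a
  mollification of \<open>W\<close>.\<close>

definition mollified_field :: "(('a::euclidean_space \<Rightarrow> 'a) \<Rightarrow> real) \<Rightarrow> ('a \<Rightarrow> real) \<Rightarrow> 'a \<Rightarrow> 'a" where
  "mollified_field T \<rho> x = (\<Sum>b\<in>Basis. T (\<lambda>y. \<rho> (y - x) *\<^sub>R b) *\<^sub>R b)"

context
  fixes c :: real and T :: "('a::euclidean_space \<Rightarrow> 'a) \<Rightarrow> real"
  assumes T: "Cc_functional c T" and c0: "0 \<le> c"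
begin

lemma Cc_functional_add: "Cc F \<Longrightarrow> Cc H \<Longrightarrow> T (\<lambda>x. F x + H x) = T F + T H"
  and Cc_functional_scale: "Cc F \<Longrightarrow> T (\<lambda>x. a *\<^sub>R F x) = a * T F"
  and Cc_functional_le: "Cc F \<Longrightarrow> T F \<le> c * (LINT x|lborel. norm (F x))"
  using T unfolding Cc_functional_def by blast+

lemma Cc_functional_diff: "Cc F \<Longrightarrow> Cc H \<Longrightarrow> T (\<lambda>x. F x - H x) = T F - T H"
  using Cc_functional_add[OF _ Cc_scaleR_const[of H "- 1"]] Cc_functional_scale[of H "- 1"] by simp

lemma Cc_functional_abs_le: "Cc F \<Longrightarrow> \<bar>T F\<bar> \<le> c * (LINT x|lborel. norm (F x))"
  using Cc_functional_le[of F] Cc_functional_le[OF Cc_scaleR_const[of F "- 1"]] Cc_functional_scale[of F "- 1"] by simp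

lemma Cc_functional_sum:
  assumes "finite I" "\<And>i. i \<in> I \<Longrightarrow> Cc (F i)"
  shows "T (\<lambda>x. \<Sum>i\<in>I. F i x) = (\<Sum>i\<in>I. T (F i))"
  using assms
proof (induction I rule: finite_induct)
  case empty
  have "Cc (\<lambda>x::'a. 0::'a)" by (rule CcI[where R = 0]) auto
  from Cc_functional_scale[OF this, of 0] show ?case by simp
next
  case (insert i I)
  then show ?case using Cc_functional_add[of "F i" "\<lambda>x. \<Sum>i\<in>I. F i x"] by (simp add: Cc_sum)
qed

context
  fixes \<rho> :: "'a \<Rightarrow> real"
  assumes \<rho>: "Cc \<rho>"
begin

lemma Cc_kernel: "Cc (\<lambda>y. \<rho> (y - x) *\<^sub>R e)"
  using Cc_scaleR_right[OF Cc_shift[OF \<rho>, of "- x"]] by simp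

lemma mollified_field_inner: "mollified_field T \<rho> x \<bullet> e = T (\<lambda>y. \<rho> (y - x) *\<^sub>R e)"
proof -
  have "T (\<lambda>y. \<rho> (y - x) *\<^sub>R e) = T (\<lambda>y. \<Sum>b\<in>Basis. (e \<bullet> b) *\<^sub>R (\<rho> (y - x) *\<^sub>R b))"
  proof (rule arg_cong[where f = T], rule ext)
    fix y
    have "\<rho> (y - x) *\<^sub>R e = \<rho> (y - x) *\<^sub>R (\<Sum>b\<in>Basis. (e \<bullet> b) *\<^sub>R b)" by (simp add: euclidean_representation)
    then show "\<rho> (y - x) *\<^sub>R e = (\<Sum>b\<in>Basis. (e \<bullet> b) *\<^sub>R (\<rho> (y - x) *\<^sub>R b))"
      by (simp add: scaleR_sum_right mult.commute)
  qed
  also have "\<dots> = (\<Sum>b\<in>Basis. (e \<bullet> b) * T (\<lambda>y. \<rho> (y - x) *\<^sub>R b))"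
    by (subst Cc_functional_sum) (auto intro!: Cc_scaleR_const Cc_kernel simp: Cc_functional_scale[OF Cc_kernel] simp del: scaleR_scaleR)
  also have "\<dots> = mollified_field T \<rho> x \<bullet> e"
    by (simp add: mollified_field_def inner_sum_left inner_commute[of e] mult.commute)
  finally show ?thesis ..
qed

text \<open>The difference \<open>e\<close> is tested against itself: \<open>e \<bullet> e\<close>
  is a value of \<open>T\<close>, bounded by a multiple of \<open>norm e\<close>. This gives the
  Euclidean norm with the constant \<open>c\<close> itself, without a factor from the
  coordinates.\<close>

lemma norm_mollified_field_diff_le:
  "norm (mollified_field T \<rho> a - mollified_field T \<rho> b) \<le> c * (LINT y|lborel. \<bar>\<rho> (y - a) - \<rho> (y - b)\<bar>)"
proof -
  define e where "e = mollified_field T \<rho> a - mollified_field T \<rho> b"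
  have "e \<bullet> e = T (\<lambda>y. \<rho> (y - a) *\<^sub>R e - \<rho> (y - b) *\<^sub>R e)"
    by (simp add: e_def inner_diff_left mollified_field_inner Cc_functional_diff Cc_kernel)
  also have "\<dots> \<le> c * (LINT y|lborel. norm (\<rho> (y - a) *\<^sub>R e - \<rho> (y - b) *\<^sub>R e))"
    by (intro Cc_functional_le Cc_diff Cc_kernel)
  also have "\<dots> = (c * (LINT y|lborel. \<bar>\<rho> (y - a) - \<rho> (y - b)\<bar>)) * norm e"
    by (simp add: scaleR_diff_left[symmetric])
  finally have "norm e * norm e \<le> (c * (LINT y|lborel. \<bar>\<rho> (y - a) - \<rho> (y - b)\<bar>)) * norm e"
    by (simp add: dot_square_norm power2_eq_square)
  then show ?thesis
    using c0 unfolding e_def[symmetric] by (cases "e = 0") (auto simp: mult_le_cancel_right)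
qed

lemma norm_mollified_field_le:
  "norm (mollified_field T \<rho> a) \<le> c * (LINT y|lborel. \<bar>\<rho> y\<bar>)"
proof -
  define e where "e = mollified_field T \<rho> a"
  have "e \<bullet> e = T (\<lambda>y. \<rho> (y - a) *\<^sub>R e)"
    unfolding e_def by (rule mollified_field_inner)
  also have "\<dots> \<le> c * (LINT y|lborel. norm (\<rho> (y - a) *\<^sub>R e))"
    by (intro Cc_functional_le Cc_kernel)
  also have "\<dots> = (c * (LINT y|lborel. \<bar>\<rho> (y - a)\<bar>)) * norm e"
    by simp
  also have "(LINT y|lborel. \<bar>\<rho> (y - a)\<bar>) = (LINT y|lborel. \<bar>\<rho> y\<bar>)"
    using integral_lborel_translate[of "\<lambda>y. \<bar>\<rho> y\<bar>" "- a"] Cc_measurable[OF \<rho>] by simp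
  finally have "norm e * norm e \<le> (c * (LINT y|lborel. \<bar>\<rho> y\<bar>)) * norm e"
    by (simp add: dot_square_norm power2_eq_square)
  then show ?thesis
    using c0 unfolding e_def[symmetric] by (cases "e = 0") (auto simp: mult_le_cancel_right)
qed

lemma translate_integral_small:
  assumes "\<epsilon> > 0"
  obtains d where "d > 0" "\<And>a b. norm (a - b) < d \<Longrightarrow> (LINT y|lborel. \<bar>\<rho> (y - a) - \<rho> (y - b)\<bar>) \<le> \<epsilon>"
proof -
  obtain d where d: "d > 0" "\<And>a b. norm (a - b) < d \<Longrightarrow> (\<integral>\<^sup>+y. ennreal \<bar>\<rho> (y - a) - \<rho> (y - b)\<bar> \<partial>lborel) \<le> ennreal \<epsilon>"
    using Cc_translate_L1_small[OF \<rho> assms] by blast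
  have int: "integrable lborel (\<lambda>y. \<bar>\<rho> (y - a) - \<rho> (y - b)\<bar>)" for a b
    using Cc_integrable[OF Cc_norm[OF Cc_diff[OF Cc_shift[OF \<rho>, of "- a"] Cc_shift[OF \<rho>, of "- b"]]]] by simp
  have "(LINT y|lborel. \<bar>\<rho> (y - a) - \<rho> (y - b)\<bar>) \<le> \<epsilon>" if "norm (a - b) < d" for a b
    using d(2)[OF that] nn_integral_eq_integral[OF int, of a b] assms by (simp add: ennreal_le_iff)
  then show ?thesis using that d(1) by blast
qed

lemma continuous_on_mollified_field: "continuous_on UNIV (mollified_field T \<rho>)"
  unfolding continuous_on_iff
proof (intro ballI allI impI)
  fix x and \<epsilon> :: real assume "0 < \<epsilon>"
  then have "0 < \<epsilon> / (c + 1)" using c0 by simp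
  then obtain d where d: "d > 0" "\<And>a b. norm (a - b) < d \<Longrightarrow> (LINT y|lborel. \<bar>\<rho> (y - a) - \<rho> (y - b)\<bar>) \<le> \<epsilon> / (c + 1)"
    using translate_integral_small by blast
  have "dist (mollified_field T \<rho> y) (mollified_field T \<rho> x) < \<epsilon>" if "dist y x < d" for y
  proof -
    have "norm (mollified_field T \<rho> y - mollified_field T \<rho> x) \<le> c * (\<epsilon> / (c + 1))"
      using that c0 d(2)[of y x] by (intro order_trans[OF norm_mollified_field_diff_le] mult_left_mono) (auto simp: dist_norm)
    also have "\<dots> < \<epsilon>" using mult_divide_add_1_less[OF c0 \<open>0 < \<epsilon>\<close>] .
    finally show ?thesis by (simp add: dist_norm)
  qed
  then show "\<exists>d>0. \<forall>y\<in>UNIV. dist y x < d \<longrightarrow> dist (mollified_field T \<rho> y) (mollified_field T \<rho> x) < \<epsilon>"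
    using d(1) by blast
qed

end

end

text \<open>Interchange of \<open>T\<close> with the integral defining the correlation, by Riemann sums: both sides
  are approximated by the value of \<open>T\<close> at a finite combination of kernels.\<close>

lemma integral_mollified_field:
  fixes T :: "('a::euclidean_space \<Rightarrow> 'a) \<Rightarrow> real"
  assumes T: "Cc_functional c T" and c0: "0 \<le> c" and \<rho>: "Cc \<rho>" and even: "\<And>z. \<rho> (- z) = \<rho> z"
    and F: "Cc F"
  shows "(LINT x|lborel. mollified_field T \<rho> x \<bullet> F x) = T (corr \<rho> F)"
proof -
  let ?V = "mollified_field T \<rho>"
  define I where "I = (LINT x|lborel. norm (F x))"
  have I0: "0 \<le> I" by (simp add: I_def)
  have V: "continuous_on UNIV ?V" by (rule continuous_on_mollified_field[OF T c0 \<rho>])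
  have Fint: "integrable lborel F" by (rule Cc_integrable[OF F])
  have nFint: "integrable lborel (\<lambda>x. norm (F x))" by (rule Cc_integrable[OF Cc_norm[OF F]])
  note [measurable] = Cc_measurable[OF F] Cc_measurable[OF \<rho>] borel_measurable_continuous_onI[OF V]
  obtain R where R: "R > 0" "\<And>x. R < norm x \<Longrightarrow> F x = 0" using F by (rule Cc_supportE) blast
  have key: "\<bar>(LINT x|lborel. ?V x \<bullet> F x) - T (corr \<rho> F)\<bar> \<le> (2 * (c * I)) * \<epsilon>" if "\<epsilon> > 0" for \<epsilon>
  proof -
    obtain d where d: "d > 0" "\<And>a b. norm (a - b) < d \<Longrightarrow> (LINT y|lborel. \<bar>\<rho> (y - a) - \<rho> (y - b)\<bar>) \<le> \<epsilon>"
      using translate_integral_small[OF T c0 \<rho> \<open>\<epsilon> > 0\<close>] by blast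
    obtain s :: "'a \<Rightarrow> 'a" where s[measurable]: "s \<in> borel_measurable borel" and fin: "finite (range s)"
      and sd: "\<And>x. norm x \<le> R \<Longrightarrow> norm (s x - x) < d"
      using finite_range_approximation[OF d(1), of R] by blast
    have small: "(LINT y|lborel. \<bar>\<rho> (y - x) - \<rho> (y - s x)\<bar>) \<le> \<epsilon>" if "F x \<noteq> 0" for x
      using R(2)[of x] that by (intro d(2)) (use sd[of x] in \<open>auto simp: norm_minus_commute not_less[symmetric]\<close>)
    \<comment> \<open>The cells on which \<open>s\<close> is constant; \<open>v j\<close> below is
      the integral of \<open>F\<close> over a cell.\<close>
    define A where "A j = s -` {j}" for j
    have [measurable]: "A j \<in> sets borel" for j
      unfolding A_def using measurable_sets[OF s, of "{j}"] by simp
    define v where "v j = (LINT x|lborel. indicator (A j) x *\<^sub>R F x)" for j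
    have vint: "integrable lborel (\<lambda>x. indicator (A j) x *\<^sub>R F x)" for j
      by (rule integrable_mult_indicator[OF _ Fint]) simp
    have ind: "(\<Sum>j\<in>range s. g j * indicator (A j) x) = (g (s x) :: real)" for g x
    proof -
      have "(\<Sum>j\<in>range s. g j * indicator (A j) x) = (\<Sum>j\<in>range s. if j = s x then g j else 0)"
        by (intro sum.cong) (auto simp: A_def)
      then show ?thesis using fin by simp
    qed
    have split: "(\<Sum>j\<in>range s. g j *\<^sub>R (indicator (A j) x *\<^sub>R F x)) = g (s x) *\<^sub>R F x" for g :: "'a \<Rightarrow> real" and x
      using ind[of g x] by (simp add: scaleR_sum_left[symmetric])
    have split2: "(\<Sum>j\<in>range s. g j \<bullet> (indicator (A j) x *\<^sub>R F x)) = g (s x) \<bullet> F x" for g :: "'a \<Rightarrow> 'a" and x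
      using ind[of "\<lambda>j. g j \<bullet> F x" x] by (simp add: mult.commute)
    have int1: "integrable lborel (\<lambda>x. ?V (s x) \<bullet> F x)"
      unfolding split2[symmetric] by (intro Bochner_Integration.integrable_sum integrable_inner_right vint)
    have eq1: "(LINT x|lborel. ?V (s x) \<bullet> F x) = (\<Sum>j\<in>range s. ?V j \<bullet> v j)"
    proof -
      have ii: "integrable lborel (\<lambda>x. w \<bullet> (indicator (A j) x *\<^sub>R F x))" for w j
        by (rule integrable_inner_right) (rule vint)
      then show ?thesis
        unfolding split2[symmetric] v_def
        by (subst Bochner_Integration.integral_sum) (rule ii, intro sum.cong refl integral_inner_right vint)
    qed
    \<comment> \<open>The Riemann sum of \<open>corr \<rho> F\<close> in which the centre
      \<open>x\<close> of the kernel is frozen at \<open>s x\<close>; \<open>T\<close> acts on it by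
      linearity.\<close>
    define M where "M y = (\<Sum>j\<in>range s. \<rho> (y - j) *\<^sub>R v j)" for y
    have M: "Cc M" unfolding M_def by (intro Cc_sum fin Cc_kernel[OF T c0 \<rho>])
    have TM: "T M = (\<Sum>j\<in>range s. ?V j \<bullet> v j)"
      unfolding M_def by (subst Cc_functional_sum[OF T c0 fin]) (auto intro!: Cc_kernel[OF T c0 \<rho>] simp: mollified_field_inner[OF T c0 \<rho>])
    have eqM: "M y = (LINT x|lborel. \<rho> (y - s x) *\<^sub>R F x)"
      and int2: "integrable lborel (\<lambda>x. \<rho> (y - s x) *\<^sub>R F x)" for y
    proof -
      show "integrable lborel (\<lambda>x. \<rho> (y - s x) *\<^sub>R F x)"
        unfolding split[of "\<lambda>j. \<rho> (y - j)", symmetric] by (intro Bochner_Integration.integrable_sum integrable_scaleR_right vint)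
      show "M y = (LINT x|lborel. \<rho> (y - s x) *\<^sub>R F x)"
      proof -
        have ii: "integrable lborel (\<lambda>x. w *\<^sub>R (indicator (A j) x *\<^sub>R F x))" for w :: real and j
          by (rule integrable_scaleR_right) (rule vint)
        then show ?thesis
          unfolding split[of "\<lambda>j. \<rho> (y - j)", symmetric] M_def v_def
          by (subst Bochner_Integration.integral_sum) (rule ii, intro sum.cong refl integral_scaleR_right[symmetric])
      qed
    qed
    \<comment> \<open>Evenness of \<open>\<rho>\<close> turns the correlation into a superposition,
      with weights \<open>F x\<close>, of the kernels centred at \<open>x\<close>.\<close>
    have corr: "corr \<rho> F y = (LINT x|lborel. \<rho> (y - x) *\<^sub>R F x)" for y
      using even[of "y - x" for x] by (subst corr_eq) (auto simp: algebra_simps)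
    have int3: "integrable lborel (\<lambda>x. \<rho> (y - x) *\<^sub>R F x)" for y
    proof -
      have "Cc (\<lambda>x. \<rho> (x - y) *\<^sub>R F x)"
        using Cc_scaleR_fun[OF Cc_shift[OF \<rho>, of "- y"] Cc_continuous[OF F]] by simp
      then show ?thesis using even[of "y - x" for x] by (auto simp: algebra_simps dest: Cc_integrable)
    qed
    \<comment> \<open>\<open>T\<close> is controlled by the L1 norm in \<open>y\<close>, so below
      the two integrals are exchanged and, for each fixed \<open>x\<close>, the kernel is compared
      with its translate to \<open>s x\<close>.\<close>
    have D: "Cc (\<lambda>y. corr \<rho> F y - M y)" by (intro Cc_diff Cc_corr \<rho> F M)
    have "(\<integral>\<^sup>+y. ennreal (norm (corr \<rho> F y - M y)) \<partial>lborel)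
       \<le> (\<integral>\<^sup>+y. (\<integral>\<^sup>+x. ennreal (norm (F x)) * ennreal \<bar>\<rho> (y - x) - \<rho> (y - s x)\<bar> \<partial>lborel) \<partial>lborel)"
    proof (intro nn_integral_mono)
      fix y
      have "corr \<rho> F y - M y = (LINT x|lborel. (\<rho> (y - x) - \<rho> (y - s x)) *\<^sub>R F x)"
        unfolding corr eqM scaleR_diff_left by (rule Bochner_Integration.integral_diff[symmetric]) (rule int3 int2)+
      also have "ennreal (norm \<dots>) \<le> (\<integral>\<^sup>+x. norm ((\<rho> (y - x) - \<rho> (y - s x)) *\<^sub>R F x) \<partial>lborel)"
        unfolding scaleR_diff_left by (intro integral_norm_bound_ennreal Bochner_Integration.integrable_diff int2 int3)
      finally show "ennreal (norm (corr \<rho> F y - M y)) \<le> (\<integral>\<^sup>+x. ennreal (norm (F x)) * ennreal \<bar>\<rho> (y - x) - \<rho> (y - s x)\<bar> \<partial>lborel)"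
        by (simp add: ennreal_mult mult.commute)
    qed
    also have "\<dots> = (\<integral>\<^sup>+x. (\<integral>\<^sup>+y. ennreal (norm (F x)) * ennreal \<bar>\<rho> (y - x) - \<rho> (y - s x)\<bar> \<partial>lborel) \<partial>lborel)"
      by (rule lborel_pair.Fubini') measurable
    also have "\<dots> \<le> (\<integral>\<^sup>+x. ennreal (norm (F x)) * ennreal \<epsilon> \<partial>lborel)"
    proof (intro nn_integral_mono)
      fix x
      show "(\<integral>\<^sup>+y. ennreal (norm (F x)) * ennreal \<bar>\<rho> (y - x) - \<rho> (y - s x)\<bar> \<partial>lborel) \<le> ennreal (norm (F x)) * ennreal \<epsilon>"
      proof (cases "F x = 0")
        case False
        have "integrable lborel (\<lambda>y. \<bar>\<rho> (y - x) - \<rho> (y - s x)\<bar>)"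
          using Cc_integrable[OF Cc_norm[OF Cc_diff[OF Cc_shift[OF \<rho>, of "- x"] Cc_shift[OF \<rho>, of "- s x"]]]] by simp
        then have "(\<integral>\<^sup>+y. ennreal \<bar>\<rho> (y - x) - \<rho> (y - s x)\<bar> \<partial>lborel) = ennreal (LINT y|lborel. \<bar>\<rho> (y - x) - \<rho> (y - s x)\<bar>)"
          by (rule nn_integral_eq_integral) simp
        also have "\<dots> \<le> ennreal \<epsilon>" by (rule ennreal_leI[OF small[OF False]])
        finally show ?thesis by (simp add: nn_integral_cmult mult_left_mono)
      qed simp
    qed
    also have "\<dots> = ennreal (I * \<epsilon>)"
      using nFint \<open>\<epsilon> > 0\<close> I0 by (simp add: nn_integral_multc nn_integral_eq_integral I_def ennreal_mult)
    also have "(\<integral>\<^sup>+y. ennreal (norm (corr \<rho> F y - M y)) \<partial>lborel) = ennreal (LINT y|lborel. norm (corr \<rho> F y - M y))"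
      by (rule nn_integral_eq_integral[OF Cc_integrable[OF Cc_norm[OF D]]]) simp
    finally have "(LINT y|lborel. norm (corr \<rho> F y - M y)) \<le> I * \<epsilon>"
      using I0 \<open>\<epsilon> > 0\<close> by (subst (asm) ennreal_le_iff) auto
    then have "c * (LINT y|lborel. norm (corr \<rho> F y - M y)) \<le> c * (I * \<epsilon>)"
      using c0 by (rule mult_left_mono)
    with Cc_functional_abs_le[OF T c0 D] have 2: "\<bar>T (corr \<rho> F) - T M\<bar> \<le> c * (I * \<epsilon>)"
      using Cc_functional_diff[OF T c0 Cc_corr[OF \<rho> F] M] by simp
    \<comment> \<open>On the field side the freezing is harmless because the mollified field differs
      by at most \<open>c * \<epsilon>\<close> between \<open>x\<close> and \<open>s x\<close>
      wherever \<open>F x\<close> is nonzero.\<close>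
    have "norm ((LINT x|lborel. ?V x \<bullet> F x) - (LINT x|lborel. ?V (s x) \<bullet> F x)) = norm (LINT x|lborel. (?V x - ?V (s x)) \<bullet> F x)"
      using Cc_integrable[OF Cc_inner[OF F V]] int1 by (simp add: inner_diff_left)
    also have "\<dots> \<le> (LINT x|lborel. c * \<epsilon> * norm (F x))"
    proof (rule Bochner_Integration.integral_norm_bound_integral)
      show "integrable lborel (\<lambda>x. (?V x - ?V (s x)) \<bullet> F x)"
        using Cc_integrable[OF Cc_inner[OF F V]] int1 by (simp add: inner_diff_left)
      show "integrable lborel (\<lambda>x. c * \<epsilon> * norm (F x))" using nFint by simp
      fix x
      show "norm ((?V x - ?V (s x)) \<bullet> F x) \<le> c * \<epsilon> * norm (F x)"
      proof (cases "F x = 0")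
        case False
        have "norm (?V x - ?V (s x)) \<le> c * \<epsilon>"
          by (intro order_trans[OF norm_mollified_field_diff_le[OF T c0 \<rho>]] mult_left_mono small False c0)
        from order_trans[OF Cauchy_Schwarz_ineq2 mult_right_mono[OF this norm_ge_zero]] show ?thesis by simp
      qed simp
    qed
    also have "\<dots> = c * (I * \<epsilon>)" by (simp add: I_def)
    finally have 1: "\<bar>(LINT x|lborel. ?V x \<bullet> F x) - T M\<bar> \<le> c * (I * \<epsilon>)"
      by (simp add: eq1 TM)
    have "2 * (c * I) * \<epsilon> = c * (I * \<epsilon>) + c * (I * \<epsilon>)" by simp
    with 1 2 show ?thesis by linarith
  qed
  show ?thesis
  proof (rule ccontr)
    define D where "D = \<bar>(LINT x|lborel. ?V x \<bullet> F x) - T (corr \<rho> F)\<bar>"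
    assume "(LINT x|lborel. ?V x \<bullet> F x) \<noteq> T (corr \<rho> F)"
    then have D: "D > 0" by (simp add: D_def)
    have J: "0 \<le> 2 * (c * I)" using c0 I0 by simp
    then have "0 < 2 * (c * I) + 1" by linarith
    then have "D / (2 * (c * I) + 1) > 0" using D by (intro divide_pos_pos)
    from key[OF this] have "D \<le> 2 * (c * I) * (D / (2 * (c * I) + 1))" by (simp add: D_def)
    with mult_divide_add_1_less[OF J D] show False by simp
  qed
qed

text \<open>Correlation commutes with the gradient, so \<open>corr (mollifier \<tau>) G\<close> is
  again a gradient, namely of \<open>corr (mollifier \<tau>) u\<close>, and there the extension
  \<open>T\<close> is known. The price for the continuity of \<open>V\<close> is that
  \<open>u\<close> appears mollified on the right.\<close>

lemma continuous_representation:
  fixes \<Lambda> :: "('a::euclidean_space \<Rightarrow> real) \<Rightarrow> real"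
  assumes c: "0 \<le> c" and \<tau>: "0 < \<tau>"
    and "\<And>u G v H. C1c u G \<Longrightarrow> C1c v H \<Longrightarrow> \<Lambda> (\<lambda>x. u x + v x) = \<Lambda> u + \<Lambda> v"
    and "\<And>a u G. C1c u G \<Longrightarrow> \<Lambda> (\<lambda>x. a * u x) = a * \<Lambda> u"
    and "\<And>u G. C1c u G \<Longrightarrow> \<Lambda> u \<le> c * (LINT x|lborel. norm (G x))"
  obtains V where "continuous_on UNIV V" "\<And>x. norm (V x) \<le> c"
    "\<And>u G. C1c u G \<Longrightarrow> (LINT x|lborel. V x \<bullet> G x) = \<Lambda> (corr (mollifier \<tau>) u)"
proof -
  obtain T where T: "Cc_functional c T" "\<And>u G. C1c u G \<Longrightarrow> T G = \<Lambda> u"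
    using extend_gradient_functional[of c \<Lambda>] assms by blast
  note m = Cc_mollifier[OF \<tau>, where 'a='a]
  show ?thesis
  proof (rule that[of "mollified_field T (mollifier \<tau>)"])
    show "continuous_on UNIV (mollified_field T (mollifier \<tau>))"
      by (rule continuous_on_mollified_field[OF T(1) c m])
    show "norm (mollified_field T (mollifier \<tau>) x) \<le> c" for x
      using norm_mollified_field_le[OF T(1) c m, of x] by (simp add: integral_abs_mollifier[OF \<tau>])
    show "(LINT x|lborel. mollified_field T (mollifier \<tau>) x \<bullet> G x) = \<Lambda> (corr (mollifier \<tau>) u)"
      if u: "C1c u G" for u G
      using T(2)[OF C1c_corr[OF m u]] u
      by (subst integral_mollified_field[OF T(1) c m mollifier_minus[OF \<tau>]]) (auto simp: C1c_def)
  qed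
qed

section \<open>Decomposition of a nonnegative measure\<close>

text \<open>The value \<open>u y\<close> is recovered by integrating the gradient in a fixed
  direction \<open>b\<close> up to a point where \<open>u\<close> vanishes. A given point is met
  only from starting points on one line parallel to \<open>b\<close>, whose part in the ball has
  length at most \<open>2 * R\<close>; hence the constant does not depend on the support of
  \<open>u\<close>.\<close>

lemma nn_integral_ball_le_gradient:
  fixes u :: "'a::euclidean_space \<Rightarrow> real"
  assumes u: "C1c u G" and R: "0 < R"
  shows "(\<integral>\<^sup>+y\<in>ball a R. ennreal \<bar>u y\<bar> \<partial>lborel) \<le> ennreal (2 * R) * (\<integral>\<^sup>+y. ennreal (norm (G y)) \<partial>lborel)"
proof -
  have u1: "C1_grad u G" and uc: "Cc u" using u by (auto simp: C1c_def)
  note [measurable] = C1_grad_measurable[OF u1]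
  obtain R' where R': "R' > 0" "\<And>x. R' < norm x \<Longrightarrow> u x = 0" using uc by (rule Cc_supportE) blast
  obtain b :: 'a where b: "b \<in> Basis" using nonempty_Basis by blast
  have nb: "norm b = 1" using b by simp
  \<comment> \<open>The length \<open>M\<close> is such that \<open>y + M *\<^sub>R b\<close> leaves
    the support of \<open>u\<close> for every \<open>y\<close> in the ball.\<close>
  define M where "M = R' + norm a + R + 1"
  have M: "M > 0" using R R' by (simp add: M_def add_pos_nonneg)
  have [measurable]: "ball c r \<in> sets borel" for c :: 'a and r by simp
  let ?I = "\<lambda>y s. ennreal M * indicator {0..1} s * indicator (ball a R) (y - (s * M) *\<^sub>R b) :: ennreal"
  have "(\<integral>\<^sup>+y\<in>ball a R. ennreal \<bar>u y\<bar> \<partial>lborel)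
     \<le> (\<integral>\<^sup>+y. (\<integral>\<^sup>+s. ennreal (norm (G ((s * M) *\<^sub>R b + y))) * ?I ((s * M) *\<^sub>R b + y) s \<partial>lborel) \<partial>lborel)"
  proof (intro nn_integral_mono)
    fix y
    show "ennreal \<bar>u y\<bar> * indicator (ball a R) y
      \<le> (\<integral>\<^sup>+s. ennreal (norm (G ((s * M) *\<^sub>R b + y))) * ?I ((s * M) *\<^sub>R b + y) s \<partial>lborel)"
    proof (cases "y \<in> ball a R")
      case True
      have "norm y \<le> norm a + R" using True norm_triangle_sub[of y a] by (simp add: dist_norm norm_minus_commute)
      then have "R' < norm (y + M *\<^sub>R b)"
        using norm_diff_ineq[of "M *\<^sub>R b" y] nb M by (simp add: M_def add.commute)
      then have "u (y + M *\<^sub>R b) = 0" by (rule R'(2))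
      then have "ennreal \<bar>u y\<bar> \<le> (\<integral>\<^sup>+s. ennreal (norm (M *\<^sub>R b)) * ennreal (norm (G (y + s *\<^sub>R M *\<^sub>R b))) * indicator {0..1} s \<partial>lborel)"
        using C1_grad_segment_le[OF u1, of y "M *\<^sub>R b"] by simp
      also have "\<dots> = (\<integral>\<^sup>+s. ennreal (norm (G ((s * M) *\<^sub>R b + y))) * ?I ((s * M) *\<^sub>R b + y) s \<partial>lborel)"
        using True nb M by (intro nn_integral_cong) (simp add: mult_ac add.commute)
      finally show ?thesis using True by simp
    qed simp
  qed
  also have "\<dots> = (\<integral>\<^sup>+s. (\<integral>\<^sup>+y. ennreal (norm (G ((s * M) *\<^sub>R b + y))) * ?I ((s * M) *\<^sub>R b + y) s \<partial>lborel) \<partial>lborel)"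
    by (rule lborel_pair.Fubini') measurable
  also have "\<dots> = (\<integral>\<^sup>+s. (\<integral>\<^sup>+y. ennreal (norm (G y)) * ?I y s \<partial>lborel) \<partial>lborel)"
  proof (rule nn_integral_cong)
    fix s :: real
    show "(\<integral>\<^sup>+y. ennreal (norm (G ((s * M) *\<^sub>R b + y))) * ?I ((s * M) *\<^sub>R b + y) s \<partial>lborel)
        = (\<integral>\<^sup>+y. ennreal (norm (G y)) * ?I y s \<partial>lborel)"
      by (rule nn_integral_lborel_translate[where f = "\<lambda>y. ennreal (norm (G y)) * ?I y s"]) measurable
  qed
  also have "\<dots> = (\<integral>\<^sup>+y. (\<integral>\<^sup>+s. ennreal (norm (G y)) * ?I y s \<partial>lborel) \<partial>lborel)"
    by (rule lborel_pair.Fubini') measurable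
  also have "\<dots> \<le> (\<integral>\<^sup>+y. ennreal (norm (G y)) * ennreal (2 * R) \<partial>lborel)"
  proof (intro nn_integral_mono)
    fix y
    \<comment> \<open>The parameters \<open>s\<close> for which some starting point in the ball
      reaches \<open>y\<close> form a set of length at most \<open>2 * R / M\<close>; the factor
      \<open>M\<close> cancels.\<close>
    define t where "t = (y - a) \<bullet> b"
    have "(\<integral>\<^sup>+s. ?I y s \<partial>lborel) \<le> (\<integral>\<^sup>+s. ennreal M * indicator {(t - R) / M .. (t + R) / M} s \<partial>lborel)"
    proof (intro nn_integral_mono)
      fix s :: real
      show "?I y s \<le> ennreal M * indicator {(t - R) / M .. (t + R) / M} s"
      proof (cases "y - (s * M) *\<^sub>R b \<in> ball a R")
        case True
        have "\<bar>(y - (s * M) *\<^sub>R b - a) \<bullet> b\<bar> \<le> norm (y - (s * M) *\<^sub>R b - a)"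
          using Basis_le_norm[OF b] .
        also have "\<dots> < R" using True by (simp add: dist_norm norm_minus_commute)
        finally have "\<bar>t - s * M\<bar> < R" using b by (simp add: t_def inner_diff_left)
        then have "s \<in> {(t - R) / M .. (t + R) / M}" using M by (auto simp: field_simps)
        then show ?thesis by (auto simp: indicator_def)
      qed simp
    qed
    also have "\<dots> = ennreal M * emeasure lborel {(t - R) / M .. (t + R) / M}"
      by (rule nn_integral_cmult_indicator) simp
    also have "\<dots> = ennreal (2 * R)"
      using M R by (simp add: ennreal_mult[symmetric] divide_right_mono diff_divide_distrib[symmetric])
    finally have "ennreal (norm (G y)) * (\<integral>\<^sup>+s. ?I y s \<partial>lborel) \<le> ennreal (norm (G y)) * ennreal (2 * R)"
      by (rule mult_left_mono) simp
    then show "(\<integral>\<^sup>+s. ennreal (norm (G y)) * ?I y s \<partial>lborel) \<le> ennreal (norm (G y)) * ennreal (2 * R)"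
      by (subst nn_integral_cmult) measurable
  qed
  also have "\<dots> = ennreal (2 * R) * (\<integral>\<^sup>+y. ennreal (norm (G y)) \<partial>lborel)"
    by (simp add: nn_integral_multc mult.commute)
  finally show ?thesis .
qed

section \<open>Convolution densities of a weighted measure and the functionals they
  represent\<close>

definition mass_density :: "'a measure \<Rightarrow> ('a::euclidean_space \<Rightarrow> real) \<Rightarrow> ('a \<Rightarrow> real) \<Rightarrow> 'a \<Rightarrow> real" where
  "mass_density P w k y = (LINT x|P. w x * k (y - x))"

locale finite_borel_measure = finite_measure P
  for P :: "'a::euclidean_space measure" +
  assumes sets_P [measurable_cong]: "sets P = sets borel"
begin

lemma space_P [simp]: "space P = UNIV"
  using sets_eq_imp_space_eq[OF sets_P] by simp

lemma integrable_P_bounded: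
  assumes "f \<in> borel_measurable borel" "\<And>x. \<bar>f x\<bar> \<le> B"
  shows "integrable P (f :: 'a \<Rightarrow> real)"
  using assms by (intro integrable_const_bound[where B = B]) auto

lemma measurable_mass_density:
  assumes [measurable]: "w \<in> borel_measurable borel" "k \<in> borel_measurable borel"
  shows "mass_density P w k \<in> borel_measurable borel"
  unfolding mass_density_def by measurable

text \<open>Both factors are kept because smallness may come from either: from \<open>k\<close> for
  the error of mollifying a kernel, from \<open>w\<close> for the change of the truncating
  sets.\<close>

lemma nn_integral_mass_density_le:
  assumes w[measurable]: "w \<in> borel_measurable borel" and w1: "\<And>x. \<bar>w x\<bar> \<le> 1" and k: "Cc k"
  shows "(\<integral>\<^sup>+y. ennreal \<bar>mass_density P w k y\<bar> \<partial>lborel) \<le> (\<integral>\<^sup>+y. ennreal \<bar>k y\<bar> \<partial>lborel) * (\<integral>\<^sup>+x. ennreal \<bar>w x\<bar> \<partial>P)"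
proof -
  interpret pair_sigma_finite P "lborel :: 'a measure" ..
  obtain B where B: "B > 0" "\<And>x. norm (k x) \<le> B" using k by (rule Cc_bounded) blast
  note [measurable] = Cc_measurable[OF k]
  have "(\<integral>\<^sup>+y. ennreal \<bar>mass_density P w k y\<bar> \<partial>lborel)
      \<le> (\<integral>\<^sup>+y. (\<integral>\<^sup>+x. ennreal \<bar>w x\<bar> * ennreal \<bar>k (- x + y)\<bar> \<partial>P) \<partial>lborel)"
  proof (intro nn_integral_mono)
    fix y
    have "\<bar>w x * k (y - x)\<bar> \<le> 1 * B" for x
      using w1[of x] B(2)[of "y - x"] unfolding abs_mult by (intro mult_mono) auto
    then have "integrable P (\<lambda>x. w x * k (y - x))"
      by (intro integrable_P_bounded) measurable
    from integral_norm_bound_ennreal[OF this]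
    show "ennreal \<bar>mass_density P w k y\<bar> \<le> (\<integral>\<^sup>+x. ennreal \<bar>w x\<bar> * ennreal \<bar>k (- x + y)\<bar> \<partial>P)"
      unfolding mass_density_def by (simp add: abs_mult ennreal_mult)
  qed
  also have "\<dots> = (\<integral>\<^sup>+x. (\<integral>\<^sup>+y. ennreal \<bar>w x\<bar> * ennreal \<bar>k (- x + y)\<bar> \<partial>lborel) \<partial>P)"
    by (rule Fubini') measurable
  also have "\<dots> = (\<integral>\<^sup>+x. ennreal \<bar>w x\<bar> * (\<integral>\<^sup>+y. ennreal \<bar>k y\<bar> \<partial>lborel) \<partial>P)"
  proof (rule nn_integral_cong)
    fix x
    have "(\<integral>\<^sup>+y. ennreal \<bar>w x\<bar> * ennreal \<bar>k (- x + y)\<bar> \<partial>lborel) = ennreal \<bar>w x\<bar> * (\<integral>\<^sup>+y. ennreal \<bar>k (- x + y)\<bar> \<partial>lborel)"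
      by (rule nn_integral_cmult) measurable
    also have "(\<integral>\<^sup>+y. ennreal \<bar>k (- x + y)\<bar> \<partial>lborel) = (\<integral>\<^sup>+y. ennreal \<bar>k y\<bar> \<partial>lborel)"
      by (rule nn_integral_lborel_translate[where f = "\<lambda>y. ennreal \<bar>k y\<bar>"]) measurable
    finally show "(\<integral>\<^sup>+y. ennreal \<bar>w x\<bar> * ennreal \<bar>k (- x + y)\<bar> \<partial>lborel) = ennreal \<bar>w x\<bar> * (\<integral>\<^sup>+y. ennreal \<bar>k y\<bar> \<partial>lborel)" .
  qed
  also have "\<dots> = (\<integral>\<^sup>+y. ennreal \<bar>k y\<bar> \<partial>lborel) * (\<integral>\<^sup>+x. ennreal \<bar>w x\<bar> \<partial>P)"
    by (subst nn_integral_multc) (auto simp: mult.commute)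
  finally show ?thesis .
qed

lemma mass_density_bound:
  assumes w[measurable]: "w \<in> borel_measurable borel" and w1: "\<And>x. \<bar>w x\<bar> \<le> 1" and k: "Cc k"
    and kw: "(\<integral>\<^sup>+y. ennreal \<bar>k y\<bar> \<partial>lborel) * (\<integral>\<^sup>+x. ennreal \<bar>w x\<bar> \<partial>P) \<le> ennreal \<epsilon>" and \<epsilon>: "0 \<le> \<epsilon>"
  shows "integrable lborel (mass_density P w k)" "(LINT y|lborel. \<bar>mass_density P w k y\<bar>) \<le> \<epsilon>"
proof -
  have le: "(\<integral>\<^sup>+y. ennreal \<bar>mass_density P w k y\<bar> \<partial>lborel) \<le> ennreal \<epsilon>"
    using nn_integral_mass_density_le[OF w w1 k] kw by (rule order_trans)
  show int: "integrable lborel (mass_density P w k)"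
    using le measurable_mass_density[OF w Cc_measurable[OF k]]
    by (intro integrableI_bounded) (auto intro: le_less_trans)
  show "(LINT y|lborel. \<bar>mass_density P w k y\<bar>) \<le> \<epsilon>"
    using le nn_integral_eq_integral[OF integrable_abs[OF int]] \<epsilon> by (simp add: ennreal_le_iff)
qed

lemma integral_corr_eq_mass_density:
  assumes w[measurable]: "w \<in> borel_measurable borel" and w1: "\<And>x. \<bar>w x\<bar> \<le> 1" and k: "Cc k" and \<phi>: "Cc \<phi>"
  shows "(LINT x|P. w x * corr k \<phi> x) = (LINT y|lborel. mass_density P w k y * \<phi> y)"
proof -
  interpret pair_sigma_finite P "lborel :: 'a measure" ..
  obtain B where B: "B > 0" "\<And>x. norm (k x) \<le> B" using k by (rule Cc_bounded) blast
  note [measurable] = Cc_measurable[OF k] Cc_measurable[OF \<phi>]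
  have "integrable (P \<Otimes>\<^sub>M lborel) (\<lambda>(x, y). w x * k (y - x) * \<phi> y)"
  proof (rule integrableI_bounded)
    show "(\<lambda>(x, y). w x * k (y - x) * \<phi> y) \<in> borel_measurable (P \<Otimes>\<^sub>M lborel)" by measurable
    have "(\<integral>\<^sup>+p. ennreal (norm (case p of (x, y) \<Rightarrow> w x * k (y - x) * \<phi> y)) \<partial>(P \<Otimes>\<^sub>M lborel))
        = (\<integral>\<^sup>+x. (\<integral>\<^sup>+y. ennreal (norm (w x * k (y - x) * \<phi> y)) \<partial>lborel) \<partial>P)"
      by (subst lborel.nn_integral_fst[symmetric]) auto
    also have "\<dots> \<le> (\<integral>\<^sup>+x. (\<integral>\<^sup>+y. ennreal B * ennreal \<bar>\<phi> y\<bar> \<partial>lborel) \<partial>P)"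
    proof (intro nn_integral_mono)
      fix x y
      have "\<bar>w x\<bar> * \<bar>k (y - x)\<bar> \<le> 1 * B" using w1[of x] B(2)[of "y - x"] by (intro mult_mono) auto
      then have "\<bar>w x\<bar> * \<bar>k (y - x)\<bar> * \<bar>\<phi> y\<bar> \<le> B * \<bar>\<phi> y\<bar>" by (intro mult_right_mono) auto
      then show "ennreal (norm (w x * k (y - x) * \<phi> y)) \<le> ennreal B * ennreal \<bar>\<phi> y\<bar>"
        using B(1) by (simp add: abs_mult ennreal_mult[symmetric] ennreal_leI)
    qed
    also have "\<dots> = ennreal B * (\<integral>\<^sup>+y. ennreal \<bar>\<phi> y\<bar> \<partial>lborel) * emeasure P UNIV"
      by (simp add: nn_integral_cmult)
    also have "\<dots> < \<infinity>"
      using nn_integral_eq_integral[OF integrable_abs[OF Cc_integrable[OF \<phi>]]]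
      by (simp add: ennreal_mult_less_top emeasure_eq_measure)
    finally show "(\<integral>\<^sup>+p. ennreal (norm (case p of (x, y) \<Rightarrow> w x * k (y - x) * \<phi> y)) \<partial>(P \<Otimes>\<^sub>M lborel)) < \<infinity>" .
  qed
  from Fubini_integral[OF this]
  have "(LINT y|lborel. (LINT x|P. w x * k (y - x) * \<phi> y)) = (LINT x|P. (LINT y|lborel. w x * k (y - x) * \<phi> y))" .
  moreover have "(LINT y|lborel. w x * k (y - x) * \<phi> y) = w x * corr k \<phi> x" for x
    by (subst corr_eq) (simp_all add: mult.assoc)
  ultimately show ?thesis by (simp add: mass_density_def)
qed

text \<open>The field represents the functional at the mollified function. The remainder, the
  functional at \<open>u\<close> minus its mollification, is the integral of
  \<open>w x * corr l u x\<close> with the kernel \<open>l = k - corr (mollifier \<tau>) k\<close>,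
  and therefore has a density of small L1 norm.\<close>

lemma corr_functional_representation:
  assumes w[measurable]: "w \<in> borel_measurable borel" and w1: "\<And>x. \<bar>w x\<bar> \<le> 1" and k: "Cc k"
    and c: "0 \<le> c" and \<epsilon>: "0 < \<epsilon>"
    and bound: "\<And>u G. C1c u G \<Longrightarrow> \<bar>LINT x|P. w x * corr k u x\<bar> \<le> c * (LINT x|lborel. norm (G x))"
  shows "\<exists>V h. continuous_on UNIV V \<and> (\<forall>x. norm (V x) \<le> c) \<and> integrable lborel h \<and> (LINT x|lborel. \<bar>h x\<bar>) \<le> \<epsilon> \<and>
    (\<forall>u G. C1c u G \<longrightarrow> (LINT x|P. w x * corr k u x) = (LINT x|lborel. V x \<bullet> G x) + (LINT x|lborel. h x * u x))"
proof -
  define m where "m = measure P UNIV"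
  have m: "0 \<le> m" by (simp add: m_def)
  have "\<epsilon> / (m + 1) > 0" using \<epsilon> m by simp
  then obtain \<tau> where \<tau>: "\<tau> > 0" "(\<integral>\<^sup>+x. ennreal \<bar>k x - corr (mollifier \<tau>) k x\<bar> \<partial>lborel) \<le> ennreal (\<epsilon> / (m + 1))"
    using corr_mollifier_L1_small[OF k] by blast
  define l where "l = (\<lambda>x. k x - corr (mollifier \<tau>) k x)"
  note mol = Cc_mollifier[OF \<tau>(1), where 'a='a]
  have ck: "Cc (corr (mollifier \<tau>) k)" by (rule Cc_corr[OF mol k])
  have l: "Cc l" unfolding l_def by (rule Cc_diff[OF k ck])
  have int: "integrable P (\<lambda>x. w x * f x)" if f: "Cc f" for f
  proof -
    obtain B where B: "B > 0" "\<And>x. norm (f x) \<le> B" using f by (rule Cc_bounded) blast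
    note [measurable] = Cc_measurable[OF f]
    have "\<bar>w x * f x\<bar> \<le> 1 * B" for x using w1[of x] B(2)[of x] unfolding abs_mult by (intro mult_mono) auto
    then show ?thesis by (intro integrable_P_bounded) measurable
  qed
  have add: "corr k' (\<lambda>x. u x + v x) x = corr k' u x + corr k' v x" if "Cc k'" "Cc u" "Cc v" for k' u v :: "'a \<Rightarrow> real" and x :: 'a
    using corr_integrable[OF that(1) Cc_continuous[OF that(2)], of x] corr_integrable[OF that(1) Cc_continuous[OF that(3)], of x]
    by (simp add: corr_def distrib_left)
  have scale: "corr k' (\<lambda>x. a * u x) x = a * corr k' u x" for k' u :: "'a \<Rightarrow> real" and a :: real and x :: 'a
    by (simp add: corr_def mult.left_commute)
  define \<Lambda> where "\<Lambda> u = (LINT x|P. w x * corr k u x)" for u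
  obtain V where V: "continuous_on UNIV V" "\<And>x. norm (V x) \<le> c"
    "\<And>u G. C1c u G \<Longrightarrow> (LINT x|lborel. V x \<bullet> G x) = \<Lambda> (corr (mollifier \<tau>) u)"
  proof (rule continuous_representation[OF c \<tau>(1), of \<Lambda>])
    fix u v :: "'a \<Rightarrow> real" and G H assume u: "C1c u G" and v: "C1c v H"
    then have uv: "Cc u" "Cc v" by (auto simp: C1c_def)
    show "\<Lambda> (\<lambda>x. u x + v x) = \<Lambda> u + \<Lambda> v"
      unfolding \<Lambda>_def add[OF k uv] distrib_left
      by (intro Bochner_Integration.integral_add int Cc_corr k uv)
  next
    fix u :: "'a \<Rightarrow> real" and G and a :: real assume u: "C1c u G"
    show "\<Lambda> (\<lambda>x. a * u x) = a * \<Lambda> u"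
      unfolding \<Lambda>_def scale by (simp add: mult.left_commute)
  next
    fix u :: "'a \<Rightarrow> real" and G assume u: "C1c u G"
    show "\<Lambda> u \<le> c * (LINT x|lborel. norm (G x))" using bound[OF u] by (simp add: \<Lambda>_def)
  qed blast
  have kw: "(\<integral>\<^sup>+y. ennreal \<bar>l y\<bar> \<partial>lborel) * (\<integral>\<^sup>+x. ennreal \<bar>w x\<bar> \<partial>P) \<le> ennreal \<epsilon>"
  proof -
    have "(\<integral>\<^sup>+x. ennreal \<bar>w x\<bar> \<partial>P) \<le> (\<integral>\<^sup>+x. 1 \<partial>P)"
      using w1 by (intro nn_integral_mono) (simp add: ennreal_le_1)
    also have "\<dots> = ennreal m" by (simp add: m_def emeasure_eq_measure)
    finally have "(\<integral>\<^sup>+y. ennreal \<bar>l y\<bar> \<partial>lborel) * (\<integral>\<^sup>+x. ennreal \<bar>w x\<bar> \<partial>P) \<le> ennreal (\<epsilon> / (m + 1)) * ennreal m"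
      using \<tau>(2) unfolding l_def by (intro mult_mono) auto
    also have "\<dots> = ennreal (m * (\<epsilon> / (m + 1)))"
      using m \<epsilon> by (subst ennreal_mult[symmetric]) (auto simp: mult.commute)
    also have "\<dots> \<le> ennreal \<epsilon>"
      using mult_divide_add_1_less[OF m \<epsilon>] by (intro ennreal_leI) simp
    finally show ?thesis .
  qed
  note h = mass_density_bound[OF w w1 l kw less_imp_le[OF \<epsilon>]]
  have eq: "(LINT x|P. w x * corr k u x) = (LINT x|lborel. V x \<bullet> G x) + (LINT x|lborel. mass_density P w l x * u x)"
    if u: "C1c u G" for u G
  proof -
    have uc: "Cc u" using u by (simp add: C1c_def)
    have "corr l u x = corr k u x - corr k (corr (mollifier \<tau>) u) x" for x
      unfolding corr_corr_mollifier[OF \<tau>(1) k uc]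
      using corr_integrable[OF k Cc_continuous[OF uc], of x] corr_integrable[OF ck Cc_continuous[OF uc], of x]
      by (simp add: corr_def l_def left_diff_distrib)
    then have "(LINT x|P. w x * corr l u x) = \<Lambda> u - \<Lambda> (corr (mollifier \<tau>) u)"
      unfolding \<Lambda>_def using int[OF Cc_corr[OF k uc]] int[OF Cc_corr[OF k Cc_corr[OF mol uc]]]
      by (simp add: right_diff_distrib)
    then show ?thesis
      using V(3)[OF u] integral_corr_eq_mass_density[OF w w1 l uc] by (simp add: \<Lambda>_def)
  qed
  show ?thesis using V(1,2) h eq by blast
qed

end

section \<open>Truncated measures of small density\<close>

context finite_borel_measure
begin

text \<open>The density bound is known only at centres outside \<open>high_density P c d\<close>. A
  ball that meets this complement is contained in the ball of twice the radius around a point of it;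
  \<open>r \<le> d / 4\<close> keeps \<open>2 * r\<close> below \<open>d\<close>.\<close>

lemma measure_ball_low_density_le:
  assumes c: "0 \<le> c" and r: "0 < r" "r \<le> d / 4"
  shows "measure P (ball x r \<inter> - high_density P c d) \<le> c * 2 ^ (DIM('a) - 1) * r ^ (DIM('a) - 1)"
proof (cases "ball x r \<inter> - high_density P c d = {}")
  case True
  then show ?thesis using c r by simp
next
  case False
  then obtain y where y: "y \<in> ball x r" "y \<notin> high_density P c d" by blast
  have "ball x r \<subseteq> ball y (2 * r)"
  proof
    fix z assume "z \<in> ball x r"
    then show "z \<in> ball y (2 * r)" using y(1) dist_triangle[of y z x] by (simp add: dist_commute)
  qed
  then have "measure P (ball x r \<inter> - high_density P c d) \<le> measure P (ball y (2 * r))"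
    using sets_P by (intro finite_measure_mono) auto
  also have "\<dots> \<le> c * (2 * r) ^ (DIM('a) - 1)"
    using y(2) r unfolding high_density_def by (auto dest!: spec[of _ "2 * r"])
  finally show ?thesis by (simp add: power_mult_distrib mult.assoc)
qed

text \<open>\<open>trace_inequality\<close> for \<open>P\<close> restricted to \<open>E\<close> is
  applied to the difference of the two mollifications. Its gradient has L1 norm at most
  \<open>2 * I\<close>, the difference itself at most \<open>2 * \<Delta> * I\<close>, where
  \<open>I\<close> is the L1 norm of \<open>G\<close>; with the weights \<open>2\<close> and
  \<open>1 / \<Delta>\<close> this gives \<open>4 + 2 = 6\<close>.\<close>

lemma trace_mollifier_diff:
  assumes E[measurable]: "E \<in> sets borel" and \<Delta>: "0 < \<Delta>" and \<eta>: "0 \<le> \<eta>"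
    and growth: "\<And>x r. 0 < r \<Longrightarrow> r \<le> \<Delta> \<Longrightarrow> measure P (ball x r \<inter> E) \<le> \<eta> * r ^ (DIM('a) - 1)"
    and \<delta>: "0 < \<delta>" "\<delta> \<le> \<Delta>" and \<delta>': "0 < \<delta>'" "\<delta>' \<le> \<Delta>" and u: "C1c u G"
  shows "\<bar>LINT x|P. indicator E x * corr (\<lambda>z. mollifier \<delta>' z - mollifier \<delta> z) u x\<bar>
    \<le> (6 * (\<eta> * trace_const TYPE('a))) * (LINT x|lborel. norm (G x))"
proof -
  define \<nu> where "\<nu> = density P (indicator E)"
  have sets_\<nu>: "sets \<nu> = sets borel" by (simp add: \<nu>_def sets_P)
  have em: "emeasure \<nu> A = emeasure P (A \<inter> E)" if [measurable]: "A \<in> sets borel" for A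
  proof -
    have "emeasure \<nu> A = (\<integral>\<^sup>+x. indicator E x * indicator A x \<partial>P)"
      unfolding \<nu>_def by (subst emeasure_density) (auto simp: sets_P)
    also have "\<dots> = (\<integral>\<^sup>+x. indicator (A \<inter> E) x \<partial>P)"
      by (intro nn_integral_cong) (auto split: split_indicator)
    also have "\<dots> = emeasure P (A \<inter> E)" by (rule nn_integral_indicator) (simp add: sets_P)
    finally show ?thesis .
  qed
  have fin: "finite_measure \<nu>"
    by (rule finite_measureI) (use em[of UNIV] in \<open>simp add: \<nu>_def emeasure_eq_measure\<close>)
  have growth': "measure \<nu> (ball x r) \<le> \<eta> * r ^ (DIM('a) - 1)" if "0 < r" "r \<le> \<Delta>" for x r
    using growth[OF that, of x] em[of "ball x r"] by (simp add: measure_def)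
  have uc: "Cc u" and Gc: "Cc G" using u by (auto simp: C1c_def)
  note m = Cc_mollifier[OF \<delta>(1), where 'a='a] and m' = Cc_mollifier[OF \<delta>'(1), where 'a='a]
  define \<psi> where "\<psi> x = corr (mollifier \<delta>') u x - corr (mollifier \<delta>) u x" for x
  define H where "H x = corr (mollifier \<delta>') G x - corr (mollifier \<delta>) G x" for x
  have \<psi>: "C1c \<psi> H"
    unfolding \<psi>_def[abs_def] H_def[abs_def] by (intro C1c_diff C1c_corr m m' u)
  have corr: "corr (\<lambda>z. mollifier \<delta>' z - mollifier \<delta> z) u x = \<psi> x" for x
    using corr_integrable[OF m Cc_continuous[OF uc], of x] corr_integrable[OF m' Cc_continuous[OF uc], of x]
    by (simp add: \<psi>_def corr_def left_diff_distrib)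
  have C1: "C1_grad \<psi> H" using \<psi> by (simp add: C1c_def)
  note [measurable] = Cc_measurable[OF uc] Cc_measurable[OF Gc] C1_grad_measurable[OF C1]
    Cc_measurable[OF Cc_corr[OF m uc]] Cc_measurable[OF Cc_corr[OF m' uc]]
    Cc_measurable[OF Cc_corr[OF m Gc]] Cc_measurable[OF Cc_corr[OF m' Gc]]
  define I where "I = (LINT x|lborel. norm (G x))"
  have I0: "0 \<le> I" by (simp add: I_def)
  have I: "(\<integral>\<^sup>+x. ennreal (norm (G x)) \<partial>lborel) = ennreal I"
    unfolding I_def by (rule nn_integral_eq_integral[OF Cc_integrable[OF Cc_norm[OF Gc]]]) simp
  have tc: "0 < trace_const TYPE('a)" by (rule trace_const_pos)
  have H_le: "(\<integral>\<^sup>+x. ennreal (norm (H x)) \<partial>lborel) \<le> ennreal (2 * I)"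
  proof -
    have "(\<integral>\<^sup>+x. ennreal (norm (H x)) \<partial>lborel)
      \<le> (\<integral>\<^sup>+x. ennreal (norm (corr (mollifier \<delta>') G x)) + ennreal (norm (corr (mollifier \<delta>) G x)) \<partial>lborel)"
      unfolding H_def by (intro nn_integral_mono) (simp add: ennreal_plus[symmetric] ennreal_leI norm_triangle_ineq4 del: ennreal_plus)
    also have "\<dots> = (\<integral>\<^sup>+x. ennreal (norm (corr (mollifier \<delta>') G x)) \<partial>lborel) + (\<integral>\<^sup>+x. ennreal (norm (corr (mollifier \<delta>) G x)) \<partial>lborel)"
      by (rule nn_integral_add) measurable
    also have "\<dots> \<le> ennreal I + ennreal I"
      using nn_integral_norm_corr_le[OF m Gc] nn_integral_norm_corr_le[OF m' Gc]
      by (intro add_mono) (simp_all add: nn_integral_mollifier \<delta> \<delta>' I)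
    also have "\<dots> = ennreal (2 * I)" using I0 by (simp add: ennreal_plus[symmetric] del: ennreal_plus)
    finally show ?thesis .
  qed
  have \<psi>_le: "(\<integral>\<^sup>+x. ennreal \<bar>\<psi> x\<bar> \<partial>lborel) \<le> ennreal (2 * \<Delta> * I)"
  proof -
    have "(\<integral>\<^sup>+x. ennreal \<bar>\<psi> x\<bar> \<partial>lborel)
      \<le> (\<integral>\<^sup>+x. ennreal \<bar>corr (mollifier \<delta>') u x - u x\<bar> + ennreal \<bar>corr (mollifier \<delta>) u x - u x\<bar> \<partial>lborel)"
      unfolding \<psi>_def by (intro nn_integral_mono) (simp add: ennreal_plus[symmetric] ennreal_leI del: ennreal_plus)
    also have "\<dots> = (\<integral>\<^sup>+x. ennreal \<bar>corr (mollifier \<delta>') u x - u x\<bar> \<partial>lborel) + (\<integral>\<^sup>+x. ennreal \<bar>corr (mollifier \<delta>) u x - u x\<bar> \<partial>lborel)"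
      by (rule nn_integral_add) measurable
    also have "\<dots> \<le> ennreal \<delta>' * ennreal I + ennreal \<delta> * ennreal I"
      using nn_integral_corr_mollifier_diff_le[OF \<delta>(1) u] nn_integral_corr_mollifier_diff_le[OF \<delta>'(1) u]
      unfolding I by (intro add_mono)
    also have "\<dots> = ennreal (\<delta>' * I + \<delta> * I)"
      using \<delta> \<delta>' I0 by (simp add: ennreal_mult[symmetric] ennreal_plus[symmetric] del: ennreal_plus)
    also have "\<dots> \<le> ennreal (2 * \<Delta> * I)"
    proof (rule ennreal_leI)
      have "(\<delta>' + \<delta>) * I \<le> (2 * \<Delta>) * I" using \<delta> \<delta>' I0 by (intro mult_right_mono) auto
      then show "\<delta>' * I + \<delta> * I \<le> 2 * \<Delta> * I" by (simp add: distrib_right)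
    qed
    finally show ?thesis .
  qed
  have "integrable P (\<lambda>x. indicator E x * \<psi> x)"
  proof -
    obtain B where B: "B > 0" "\<And>x. norm (\<psi> x) \<le> B" using \<psi> Cc_bounded[of \<psi>] unfolding C1c_def by blast
    show ?thesis using B(1) B(2) by (intro integrable_P_bounded[where B = B]) (auto simp: indicator_def less_imp_le)
  qed
  from integral_norm_bound_ennreal[OF this]
  have "ennreal \<bar>LINT x|P. indicator E x * \<psi> x\<bar> \<le> (\<integral>\<^sup>+x. indicator E x * ennreal \<bar>\<psi> x\<bar> \<partial>P)"
    by (simp add: abs_mult ennreal_mult ennreal_indicator)
  also have "\<dots> = (\<integral>\<^sup>+x. ennreal \<bar>\<psi> x\<bar> \<partial>\<nu>)"
    unfolding \<nu>_def by (subst nn_integral_density) auto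
  also have "\<dots> \<le> ennreal (\<eta> * trace_const TYPE('a)) *
    (2 * (\<integral>\<^sup>+x. ennreal (norm (H x)) \<partial>lborel) + ennreal (1 / \<Delta>) * (\<integral>\<^sup>+x. ennreal \<bar>\<psi> x\<bar> \<partial>lborel))"
    by (rule trace_inequality[OF C1 fin sets_\<nu> \<Delta> \<eta> growth'])
  also have "\<dots> \<le> ennreal (\<eta> * trace_const TYPE('a)) * (2 * ennreal (2 * I) + ennreal (1 / \<Delta>) * ennreal (2 * \<Delta> * I))"
    by (intro mult_left_mono add_mono H_le \<psi>_le) auto
  also have "2 * ennreal (2 * I) = ennreal (4 * I)"
    using I0 ennreal_mult[of 2 "2 * I"] by simp
  also have "ennreal (1 / \<Delta>) * ennreal (2 * \<Delta> * I) = ennreal (2 * I)"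
    using \<Delta> I0 by (subst ennreal_mult[symmetric]) auto
  also have "ennreal (4 * I) + ennreal (2 * I) = ennreal (6 * I)"
    using I0 by (simp add: ennreal_plus[symmetric] del: ennreal_plus)
  also have "ennreal (\<eta> * trace_const TYPE('a)) * ennreal (6 * I) = ennreal (6 * (\<eta> * trace_const TYPE('a)) * I)"
    using \<eta> tc I0 by (subst ennreal_mult[symmetric]) (auto simp: mult_ac)
  finally show ?thesis
    unfolding corr using \<eta> tc I0 by (subst (asm) ennreal_le_iff) (auto simp: I_def)
qed

text \<open>A value of \<open>corr k u\<close> is a weighted integral of \<open>u\<close> over a
  ball, bounded by the L1 norm of the gradient whatever the measure \<open>P\<close>. The constant
  is finite but not small, which suffices at the first scale.\<close>

lemma corr_gradient_bound:
  assumes w[measurable]: "w \<in> borel_measurable borel" and w1: "\<And>x. \<bar>w x\<bar> \<le> 1" and k: "Cc k"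
  obtains c where "0 \<le> c"
    "\<And>u G. C1c u G \<Longrightarrow> \<bar>LINT x|P. w x * corr k u x\<bar> \<le> c * (LINT x|lborel. norm (G x))"
proof -
  obtain B where B: "B > 0" "\<And>x. norm (k x) \<le> B" using k by (rule Cc_bounded) blast
  obtain R where R: "R > 0" "\<And>x. R < norm x \<Longrightarrow> k x = 0" using k by (rule Cc_supportE) blast
  define m where "m = measure P UNIV"
  have m: "0 \<le> m" by (simp add: m_def)
  \<comment> \<open>\<open>B\<close> bounds the kernel, and \<open>2 * (R + 1)\<close> is the
    constant of \<open>nn_integral_ball_le_gradient\<close> for an open ball containing the closed
    ball of radius \<open>R\<close>.\<close>
  define b where "b = B * (2 * (R + 1))"
  have b: "0 \<le> b" using B R by (simp add: b_def)
  have "\<bar>LINT x|P. w x * corr k u x\<bar> \<le> (m * b) * (LINT x|lborel. norm (G x))" if u: "C1c u G" for u G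
  proof -
    have uc: "Cc u" and Gc: "Cc G" using u by (auto simp: C1c_def)
    note [measurable] = Cc_measurable[OF k] Cc_measurable[OF uc] Cc_measurable[OF Cc_corr[OF k uc]]
    define I where "I = (LINT x|lborel. norm (G x))"
    have I0: "0 \<le> I" by (simp add: I_def)
    have I: "(\<integral>\<^sup>+x. ennreal (norm (G x)) \<partial>lborel) = ennreal I"
      unfolding I_def by (rule nn_integral_eq_integral[OF Cc_integrable[OF Cc_norm[OF Gc]]]) simp
    have pt: "\<bar>corr k u x\<bar> \<le> b * I" for x
    proof -
      have "integrable lborel (\<lambda>y. k (y - x) *\<^sub>R u y)"
        using Cc_integrable[OF Cc_scaleR_fun[OF Cc_shift[OF k, of "- x"] Cc_continuous[OF uc]]] by simp
      from integral_norm_bound_ennreal[OF this]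
      have "ennreal \<bar>corr k u x\<bar> \<le> (\<integral>\<^sup>+y. ennreal (\<bar>k (y - x)\<bar> * \<bar>u y\<bar>) \<partial>lborel)"
        by (simp add: corr_eq abs_mult)
      also have "\<dots> \<le> (\<integral>\<^sup>+y. ennreal B * (ennreal \<bar>u y\<bar> * indicator (ball x (R + 1)) y) \<partial>lborel)"
      proof (intro nn_integral_mono)
        fix y
        show "ennreal (\<bar>k (y - x)\<bar> * \<bar>u y\<bar>) \<le> ennreal B * (ennreal \<bar>u y\<bar> * indicator (ball x (R + 1)) y)"
        proof (cases "norm (y - x) \<le> R")
          case True
          then have "y \<in> ball x (R + 1)" by (simp add: dist_norm norm_minus_commute)
          moreover have "\<bar>k (y - x)\<bar> * \<bar>u y\<bar> \<le> B * \<bar>u y\<bar>" using B(2)[of "y - x"] by (intro mult_right_mono) auto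
          ultimately show ?thesis using B(1) by (simp add: ennreal_mult[symmetric] ennreal_leI)
        next
          case False
          then show ?thesis using R(2)[of "y - x"] by simp
        qed
      qed
      also have "\<dots> = ennreal B * (\<integral>\<^sup>+y\<in>ball x (R + 1). ennreal \<bar>u y\<bar> \<partial>lborel)"
      proof (rule nn_integral_cmult)
        have [measurable]: "ball x (R + 1) \<in> sets borel" by simp
        show "(\<lambda>y. ennreal \<bar>u y\<bar> * indicator (ball x (R + 1)) y) \<in> borel_measurable lborel" by measurable
      qed
      also have "\<dots> \<le> ennreal B * (ennreal (2 * (R + 1)) * ennreal I)"
        using nn_integral_ball_le_gradient[OF u, of "R + 1" x] R(1) unfolding I by (intro mult_left_mono) auto
      also have "\<dots> = ennreal (b * I)"
      proof -
        have "ennreal B * (ennreal r * ennreal I) = ennreal (B * r * I)" if "0 \<le> r" for r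
          using that B(1) I0 by (simp add: ennreal_mult mult.assoc)
        from this[of "2 * (R + 1)"] show ?thesis unfolding b_def using R(1) by simp
      qed
      finally show ?thesis using b I0 by (subst (asm) ennreal_le_iff) auto
    qed
    have le: "\<bar>w x * corr k u x\<bar> \<le> b * I" for x
    proof -
      have "\<bar>w x\<bar> * \<bar>corr k u x\<bar> \<le> 1 * (b * I)" using w1[of x] pt[of x] by (intro mult_mono) auto
      then show ?thesis by (simp add: abs_mult)
    qed
    have "norm (LINT x|P. w x * corr k u x) \<le> (LINT x|P. b * I)"
      using le b I0 by (intro Bochner_Integration.integral_norm_bound_integral integrable_P_bounded[where B = "b * I"]) auto
    also have "\<dots> = (m * b) * I" by (simp add: m_def)
    finally show ?thesis by (simp add: I_def)
  qed
  then show ?thesis using that[of "m * b"] m b by simp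
qed

text \<open>On \<open>E k\<close> the mollifications are uniformly close to \<open>u\<close>; off
  \<open>E k\<close> the error is at most a bound for \<open>u\<close> times
  \<open>measure P (- E k)\<close>.\<close>

lemma tendsto_truncated_mollified:
  fixes u :: "'a \<Rightarrow> real"
  assumes u: "Cc u" and E[measurable]: "\<And>k. E k \<in> sets borel"
    and E0: "(\<lambda>k. measure P (- E k)) \<longlonglongrightarrow> 0" and \<delta>: "\<And>k. 0 < \<delta> k" "\<delta> \<longlonglongrightarrow> 0"
  shows "(\<lambda>k. LINT x|P. indicator (E k) x * corr (mollifier (\<delta> k)) u x) \<longlonglongrightarrow> (LINT x|P. u x)"
proof (rule LIMSEQ_I)
  fix e :: real assume e: "0 < e"
  define m where "m = measure P UNIV"
  have m: "0 \<le> m" by (simp add: m_def)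
  obtain B where B: "B > 0" "\<And>x. norm (u x) \<le> B" using u by (rule Cc_bounded) blast
  note um[measurable] = Cc_measurable[OF u]
  define e1 where "e1 = (e / 2) / (m + 1)"
  have "e1 > 0" using e m by (simp add: e1_def)
  then obtain d where d: "d > 0" "\<And>\<delta> x. 0 < \<delta> \<Longrightarrow> \<delta> < d \<Longrightarrow> norm (corr (mollifier \<delta>) u x - u x) \<le> e1"
    using Cc_corr_mollifier_uniform[OF u] by blast
  have "\<forall>\<^sub>F k in sequentially. \<delta> k < d" using \<delta>(2) d(1) by (rule order_tendstoD)
  moreover have "\<forall>\<^sub>F k in sequentially. measure P (- E k) < e / (2 * B)"
    using E0 by (rule order_tendstoD) (use e B in simp)
  ultimately have "\<forall>\<^sub>F k in sequentially. norm ((LINT x|P. indicator (E k) x * corr (mollifier (\<delta> k)) u x) - (LINT x|P. u x)) < e"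
  proof eventually_elim
    case (elim k)
    let ?c = "corr (mollifier (\<delta> k)) u"
    have c: "Cc ?c" by (rule Cc_corr[OF Cc_mollifier[OF \<delta>(1)] u])
    note [measurable] = Cc_measurable[OF c]
    obtain B' where B': "B' > 0" "\<And>x. norm (?c x) \<le> B'" using c by (rule Cc_bounded) blast
    have i1: "integrable P (\<lambda>x. indicator (E k) x * ?c x)"
      using B' by (intro integrable_P_bounded[where B = B']) (auto simp: indicator_def)
    have i2: "integrable P u" using B by (intro integrable_P_bounded[where B = B]) auto
    have "norm ((LINT x|P. indicator (E k) x * ?c x) - (LINT x|P. u x)) = norm (LINT x|P. indicator (E k) x * ?c x - u x)"
      using i1 i2 by simp
    also have "\<dots> \<le> (LINT x|P. e1 + B * indicator (- E k) x)"
    proof (rule Bochner_Integration.integral_norm_bound_integral)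
      show "integrable P (\<lambda>x. indicator (E k) x * ?c x - u x)" using i1 i2 by simp
      show "integrable P (\<lambda>x. e1 + B * indicator (- E k) x)"
        using B(1) \<open>e1 > 0\<close> by (intro integrable_P_bounded[where B = "e1 + B"]) (auto simp: indicator_def)
      show "norm (indicator (E k) x * ?c x - u x) \<le> e1 + B * indicator (- E k) x" for x
        using d(2)[OF \<delta>(1) elim(1), of x] B(2)[of x] \<open>e1 > 0\<close> B(1) by (auto simp: indicator_def)
    qed
    also have "\<dots> = m * e1 + B * measure P (- E k)"
    proof -
      have "integrable P (\<lambda>x. B * indicator (- E k) x)"
        using B(1) by (intro integrable_P_bounded[where B = B]) (auto simp: indicator_def)
      moreover have "- E k \<in> sets P" using E[of k] sets_P by auto
      ultimately show ?thesis by (simp add: m_def)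
    qed
    also have "\<dots> < e / 2 + e / 2"
    proof (rule add_strict_mono)
      show "m * e1 < e / 2" unfolding e1_def using mult_divide_add_1_less[OF m, of "e / 2"] e by simp
      show "B * measure P (- E k) < e / 2" using elim(2) B(1) by (simp add: field_simps)
    qed
    finally show ?case by simp
  qed
  then show "\<exists>no. \<forall>k\<ge>no. norm ((LINT x|P. indicator (E k) x * corr (mollifier (\<delta> k)) u x) - (LINT x|P. u x)) < e"
    by (simp add: eventually_sequentially)
qed

end

section \<open>Summation of the pieces and the representation of one variation\<close>

lemma AE_summable_norm:
  fixes f :: "nat \<Rightarrow> 'a \<Rightarrow> real"
  assumes f: "\<And>k. integrable M (f k)" and le: "\<And>k. (LINT x|M. \<bar>f k x\<bar>) \<le> N k" and N: "summable N"
  shows "AE x in M. summable (\<lambda>k. \<bar>f k x\<bar>)" "summable (\<lambda>k. LINT x|M. \<bar>f k x\<bar>)"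
proof -
  note [measurable] = borel_measurable_integrable[OF f]
  show sm: "summable (\<lambda>k. LINT x|M. \<bar>f k x\<bar>)"
    by (rule summable_comparison_test[OF _ N]) (use le in auto)
  have "(\<integral>\<^sup>+x. (\<Sum>k. ennreal \<bar>f k x\<bar>) \<partial>M) = (\<Sum>k. \<integral>\<^sup>+x. ennreal \<bar>f k x\<bar> \<partial>M)"
    by (rule nn_integral_suminf) measurable
  also have "\<dots> = (\<Sum>k. ennreal (LINT x|M. \<bar>f k x\<bar>))"
    by (intro suminf_cong nn_integral_eq_integral integrable_abs f) auto
  also have "\<dots> = ennreal (\<Sum>k. LINT x|M. \<bar>f k x\<bar>)"
    by (rule suminf_ennreal2[OF _ sm]) simp
  finally have "AE x in M. (\<Sum>k. ennreal \<bar>f k x\<bar>) \<noteq> \<infinity>"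
    by (intro nn_integral_PInf_AE) auto
  then show "AE x in M. summable (\<lambda>k. \<bar>f k x\<bar>)"
    by eventually_elim (rule summable_suminf_not_top, auto)
qed

lemma integrable_mult_Cc:
  fixes g u :: "'a::euclidean_space \<Rightarrow> real"
  assumes g: "integrable lborel g" and u: "Cc u"
  shows "integrable lborel (\<lambda>x. g x * u x)"
proof -
  obtain B where B: "B > 0" "\<And>x. norm (u x) \<le> B" using u by (rule Cc_bounded) blast
  note [measurable] = Cc_measurable[OF u] borel_measurable_integrable[OF g, simplified]
  show ?thesis
  proof (rule Bochner_Integration.integrable_bound)
    show "integrable lborel (\<lambda>x. B * g x)" using g by simp
    show "AE x in lborel. norm (g x * u x) \<le> norm (B * g x)"
      using B by (auto simp: abs_mult mult.commute[of B] intro!: mult_left_mono)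
  qed measurable
qed

text \<open>The Weierstrass M-test makes the sum of the fields continuous; summable L1 norms give
  the integrable sum \<open>F\<close> and justify integration term by term.\<close>

lemma series_representation:
  fixes V :: "nat \<Rightarrow> 'a::euclidean_space \<Rightarrow> 'a" and f :: "nat \<Rightarrow> 'a \<Rightarrow> real"
  assumes V: "\<And>k. continuous_on UNIV (V k)" and VM: "\<And>k x. norm (V k x) \<le> M k" and M: "summable M"
    and f: "\<And>k. integrable lborel (f k)" and fN: "\<And>k. (LINT x|lborel. \<bar>f k x\<bar>) \<le> N k" and N: "summable N"
  shows "\<exists>W F. continuous_on UNIV W \<and> integrable lborel F \<and> (LINT x|lborel. \<bar>F x\<bar>) \<le> suminf N \<and>
    (\<forall>u G. C1c u G \<longrightarrow> (\<lambda>k. (LINT x|lborel. V k x \<bullet> G x) + (LINT x|lborel. f k x * u x)) sums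
       ((LINT x|lborel. W x \<bullet> G x) + (LINT x|lborel. F x * u x)))"
proof -
  define W where "W x = (\<Sum>k. V k x)" for x
  define F where "F x = (\<Sum>k. f k x)" for x
  have sV: "summable (\<lambda>k. norm (V k x))" for x
    by (rule summable_comparison_test[OF _ M]) (use VM in auto)
  have "uniform_limit UNIV (\<lambda>n x. \<Sum>k<n. V k x) W sequentially"
    unfolding W_def[abs_def] by (rule Weierstrass_m_test[OF _ M]) (use VM in auto)
  then have Wc: "continuous_on UNIV W"
    by (rule uniform_limit_theorem[rotated]) (auto intro!: always_eventually continuous_on_sum V)
  note AE = AE_summable_norm[OF f fN N]
  have AEn: "AE x in lborel. summable (\<lambda>k. norm (f k x))" and sn: "summable (\<lambda>k. LINT x|lborel. norm (f k x))"
    using AE by simp_all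
  have Fi: "integrable lborel F"
    unfolding F_def[abs_def] by (rule integrable_suminf[OF f AEn sn])
  have "(LINT x|lborel. \<bar>F x\<bar>) \<le> (LINT x|lborel. (\<Sum>k. \<bar>f k x\<bar>))"
  proof (rule integral_mono_AE)
    show "integrable lborel (\<lambda>x. \<bar>F x\<bar>)" using Fi by simp
    show "integrable lborel (\<lambda>x. \<Sum>k. \<bar>f k x\<bar>)"
      by (rule integrable_suminf) (use AE in \<open>auto intro: integrable_abs f\<close>)
    show "AE x in lborel. \<bar>F x\<bar> \<le> (\<Sum>k. \<bar>f k x\<bar>)"
      using AE(1) unfolding F_def by eventually_elim (rule summable_rabs)
  qed
  also have "\<dots> = (\<Sum>k. LINT x|lborel. \<bar>f k x\<bar>)"
    by (rule integral_suminf) (use AE in \<open>auto intro: integrable_abs f\<close>)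
  also have "\<dots> \<le> suminf N"
    by (rule suminf_le[OF fN AE(2) N])
  finally have FN: "(LINT x|lborel. \<bar>F x\<bar>) \<le> suminf N" .
  have "(\<lambda>k. (LINT x|lborel. V k x \<bullet> G x) + (LINT x|lborel. f k x * u x)) sums
       ((LINT x|lborel. W x \<bullet> G x) + (LINT x|lborel. F x * u x))" if u: "C1c u G" for u G
  proof (rule sums_add)
    have uc: "Cc u" and Gc: "Cc G" using u by (auto simp: C1c_def)
    obtain B where B: "B > 0" "\<And>x. norm (u x) \<le> B" using uc by (rule Cc_bounded) blast
    note [measurable] = Cc_measurable[OF uc] borel_measurable_integrable[OF f, simplified]
    have iG: "integrable lborel (\<lambda>x. norm (G x))" by (rule Cc_integrable[OF Cc_norm[OF Gc]])
    have iV: "integrable lborel (\<lambda>x. V k x \<bullet> G x)" for k by (rule Cc_integrable[OF Cc_inner[OF Gc V]])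
    have le: "\<bar>V k x \<bullet> G x\<bar> \<le> M k * norm (G x)" for k x
      by (rule order_trans[OF Cauchy_Schwarz_ineq2 mult_right_mono[OF VM norm_ge_zero]])
    have "(LINT x|lborel. \<bar>V k x \<bullet> G x\<bar>) \<le> M k * (LINT x|lborel. norm (G x))" for k
    proof -
      have "(LINT x|lborel. \<bar>V k x \<bullet> G x\<bar>) \<le> (LINT x|lborel. M k * norm (G x))"
        by (intro integral_mono integrable_abs iV integrable_mult_right iG le)
      then show ?thesis by simp
    qed
    note AV = AE_summable_norm[OF iV this summable_mult2[OF M]]
    have "(\<lambda>k. LINT x|lborel. V k x \<bullet> G x) sums (LINT x|lborel. (\<Sum>k. V k x \<bullet> G x))"
      using AV by (intro sums_integral iV) auto
    moreover have "(\<Sum>k. V k x \<bullet> G x) = W x \<bullet> G x" for x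
      unfolding W_def by (rule bounded_linear.suminf[OF bounded_linear_inner_left summable_norm_cancel[OF sV], symmetric])
    ultimately show "(\<lambda>k. LINT x|lborel. V k x \<bullet> G x) sums (LINT x|lborel. W x \<bullet> G x)" by simp
    have fu_int: "integrable lborel (\<lambda>x. f k x * u x)" for k
      by (rule integrable_mult_Cc[OF f uc])
    have "(LINT x|lborel. \<bar>f k x * u x\<bar>) \<le> N k * B" for k
    proof -
      have "(LINT x|lborel. \<bar>f k x * u x\<bar>) \<le> (LINT x|lborel. \<bar>f k x\<bar> * B)"
        using B(2) by (intro integral_mono integrable_abs fu_int integrable_mult_left f) (auto simp: abs_mult intro!: mult_left_mono)
      also have "\<dots> \<le> N k * B" using fN[of k] B(1) by simp
      finally show ?thesis .
    qed
    note Af = AE_summable_norm[OF fu_int this summable_mult2[OF N]]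
    have "(\<lambda>k. LINT x|lborel. f k x * u x) sums (LINT x|lborel. (\<Sum>k. f k x * u x))"
      using Af by (intro sums_integral fu_int) auto
    moreover have "(LINT x|lborel. (\<Sum>k. f k x * u x)) = (LINT x|lborel. F x * u x)"
    proof (rule integral_cong_AE)
      show "AE x in lborel. (\<Sum>k. f k x * u x) = F x * u x"
        using AEn unfolding F_def
        by eventually_elim (rule suminf_mult2[symmetric], rule summable_norm_cancel)
    qed (use borel_measurable_integrable[OF Fi] in \<open>auto\<close>)
    ultimately show "(\<lambda>k. LINT x|lborel. f k x * u x) sums (LINT x|lborel. F x * u x)" by simp
  qed
  with Wc Fi FN show ?thesis by blast
qed

context finite_borel_measure
begin

theorem divergence_representation:
  assumes null: "\<And>A. A \<in> sets borel \<Longrightarrow> hausdorff_measure (real DIM('a) - 1) A < \<infinity> \<Longrightarrow> emeasure P A = 0"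
    and \<epsilon>: "0 < \<epsilon>"
  shows "\<exists>V f. continuous_on UNIV V \<and> integrable lborel f \<and> (LINT x|lborel. \<bar>f x\<bar>) \<le> \<epsilon> \<and>
    (\<forall>u G. C1c u G \<longrightarrow> (LINT x|P. u x) = - (LINT x|lborel. V x \<bullet> G x) + (LINT x|lborel. f x * u x))"
proof -
  define C where "C = trace_const TYPE('a)"
  have C: "0 < C" unfolding C_def by (rule trace_const_pos)
  \<comment> \<open>The factor \<open>2 ^ (N - 1)\<close> of
    \<open>measure_ball_low_density_le\<close> and the factor \<open>6 * C\<close> of
    \<open>trace_mollifier_diff\<close> are divided out, which leaves the bound
    \<open>(1 / 2) ^ k\<close> for the field with index \<open>k\<close>.\<close>
  define c where "c k = (1 / 2) ^ k / (6 * C * 2 ^ (DIM('a) - 1))" for k :: nat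
  have c: "0 < c k" for k using C by (simp add: c_def)
  \<comment> \<open>Budget: \<open>e 0\<close> for the first term and \<open>3 * e k\<close> for
    each difference, in total
    \<open>\<epsilon> / 16 + 3 * \<epsilon> / 8 \<le> \<epsilon>\<close>.\<close>
  define e where "e k = \<epsilon> / 16 * (1 / 2) ^ k" for k :: nat
  have e: "0 < e k" for k using \<epsilon> by (simp add: e_def)
  have fmP: "finite_measure P" by unfold_locales
  have "\<forall>k. \<exists>d>0. measure P (high_density P (c k) d) < e k"
    using exists_high_density_small[OF fmP sets_P null c e] by blast
  then obtain d where d: "\<And>k. 0 < d k" "\<And>k. measure P (high_density P (c k) (d k)) < e k" by metis
  define E where "E k = - high_density P (c k) (d k)" for k
  have E[measurable]: "E k \<in> sets borel" for k
    unfolding E_def using open_high_density[OF fmP sets_P, of "c k" "d k"] by auto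
  have EP[measurable]: "E k \<in> sets P" for k by (simp add: sets_P)
  have Ec: "measure P (- E k) < e k" for k using d(2) by (simp add: E_def)
  have wm[measurable]: "(indicator (E k) :: 'a \<Rightarrow> real) \<in> borel_measurable borel" for k by measurable
  \<comment> \<open>The minimum over \<open>j \<le> k\<close> puts both \<open>\<delta> k\<close>
    and \<open>\<delta> (Suc k)\<close> at or below \<open>d k / 4\<close>, as the difference with
    index \<open>k\<close> requires; the power of \<open>1 / 2\<close> forces
    \<open>\<delta>\<close> to tend to \<open>0\<close>.\<close>
  define \<delta> where "\<delta> k = (1 / 2) ^ k * Min ((\<lambda>j. d j / 4) ` {..k})" for k
  have minpos: "0 < Min ((\<lambda>j. d j / 4) ` {..k})" for k using d(1) by (subst Min_gr_iff) auto
  have \<delta>: "0 < \<delta> k" for k unfolding \<delta>_def using minpos by simp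
  have \<delta>le: "\<delta> k \<le> (1 / 2) ^ k * (d j / 4)" if "j \<le> k" for j k
    unfolding \<delta>_def using that by (intro mult_left_mono Min_le) auto
  have \<delta>4: "\<delta> k \<le> d j / 4" if "j \<le> k" for j k
  proof -
    have "(1 / 2) ^ k * (d j / 4) \<le> 1 * (d j / 4)"
      using d(1)[of j] by (intro mult_right_mono power_le_one) auto
    with \<delta>le[OF that] show ?thesis by simp
  qed
  have "(\<lambda>k. (1 / 2) ^ k * (d 0 / 4)) \<longlonglongrightarrow> 0"
    by (intro tendsto_mult_left_zero LIMSEQ_power_zero) simp
  then have \<delta>0: "\<delta> \<longlonglongrightarrow> 0"
    by (rule tendsto_sandwich[OF _ _ tendsto_const, rotated 2])
      (use \<delta>le[of 0] in \<open>auto intro!: always_eventually less_imp_le[OF \<delta>]\<close>)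
  have "e \<longlonglongrightarrow> 0"
    unfolding e_def by (intro tendsto_mult_right_zero LIMSEQ_power_zero) simp
  then have E0: "(\<lambda>k. measure P (- E k)) \<longlonglongrightarrow> 0"
    by (rule tendsto_sandwich[OF _ _ tendsto_const, rotated 2]) (auto intro!: always_eventually less_imp_le[OF Ec])
  let ?m = "\<lambda>k. mollifier (\<delta> k) :: 'a \<Rightarrow> real"
  note m = Cc_mollifier[OF \<delta>, where 'a='a]
  \<comment> \<open>The integral of the mollified \<open>u\<close> against the truncated measure; it
    converges to the integral of \<open>u\<close>, and its increments are telescoped.\<close>
  define S where "S k u = (LINT x|P. indicator (E k) x * corr (?m k) u x)" for k and u :: "'a \<Rightarrow> real"

  define R where "R k V h \<longleftrightarrow> continuous_on UNIV V \<and> (\<forall>x. norm (V x) \<le> (1 / 2) ^ k) \<and> integrable lborel h \<and>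
      (LINT x|lborel. \<bar>h x\<bar>) \<le> e k \<and> (\<forall>u G. C1c u G \<longrightarrow>
      (LINT x|P. indicator (E k) x * corr (\<lambda>z. ?m (Suc k) z - ?m k z) u x) = (LINT x|lborel. V x \<bullet> G x) + (LINT x|lborel. h x * u x))"
    for k and V :: "'a \<Rightarrow> 'a" and h :: "'a \<Rightarrow> real"
  have "\<exists>V h. R k V h" for k
    unfolding R_def
  proof (rule corr_functional_representation[OF wm _ Cc_diff[OF m m] _ e])
    fix u :: "'a \<Rightarrow> real" and G assume u: "C1c u G"
    have "\<bar>LINT x|P. indicator (E k) x * corr (\<lambda>z. ?m (Suc k) z - ?m k z) u x\<bar>
      \<le> (6 * ((c k * 2 ^ (DIM('a) - 1)) * trace_const TYPE('a))) * (LINT x|lborel. norm (G x))"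
    proof (rule trace_mollifier_diff[OF E _ _ _ \<delta> _ \<delta> _ u])
      show "0 < d k / 4" using d(1) by simp
      show "0 \<le> c k * 2 ^ (DIM('a) - 1)" using c[of k] by simp
      show "measure P (ball x r \<inter> E k) \<le> c k * 2 ^ (DIM('a) - 1) * r ^ (DIM('a) - 1)" if "0 < r" "r \<le> d k / 4" for x r
        unfolding E_def using c[of k] that by (intro measure_ball_low_density_le) auto
      show "\<delta> k \<le> d k / 4" "\<delta> (Suc k) \<le> d k / 4" using \<delta>4 by auto
    qed
    also have "6 * ((c k * 2 ^ (DIM('a) - 1)) * trace_const TYPE('a)) = (1 / 2) ^ k"
      using C by (simp add: c_def C_def[symmetric])
    finally show "\<bar>LINT x|P. indicator (E k) x * corr (\<lambda>z. ?m (Suc k) z - ?m k z) u x\<bar> \<le> (1 / 2) ^ k * (LINT x|lborel. norm (G x))" .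
  qed (auto simp: indicator_def)
  then obtain V h where R: "\<And>k. R k (V k) (h k)" by metis
  have V: "\<And>k. continuous_on UNIV (V k)" "\<And>k x. norm (V k x) \<le> (1 / 2) ^ k"
    and h: "\<And>k. integrable lborel (h k)" "\<And>k. (LINT x|lborel. \<bar>h k x\<bar>) \<le> e k"
    and Vh: "\<And>k u G. C1c u G \<Longrightarrow> (LINT x|P. indicator (E k) x * corr (\<lambda>z. ?m (Suc k) z - ?m k z) u x)
      = (LINT x|lborel. V k x \<bullet> G x) + (LINT x|lborel. h k x * u x)"
    using R unfolding R_def by blast+
  have i1: "\<bar>indicator (E 0) x\<bar> \<le> (1::real)" for x by (simp add: indicator_def)
  \<comment> \<open>No smallness is available for \<open>S 0\<close>; the constant \<open>c0\<close>
    may be large, as it bounds only a field.\<close>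
  obtain c0 where c0: "0 \<le> c0"
    "\<And>u G. C1c u G \<Longrightarrow> \<bar>LINT x|P. indicator (E 0) x * corr (?m 0) u x\<bar> \<le> c0 * (LINT x|lborel. norm (G x))"
    using corr_gradient_bound[OF wm[of 0] i1 m[of 0]] by blast
  obtain V0 h0 where V0: "continuous_on UNIV V0" and h0: "integrable lborel h0" "(LINT x|lborel. \<bar>h0 x\<bar>) \<le> e 0"
    and Vh0: "\<And>u G. C1c u G \<Longrightarrow> S 0 u = (LINT x|lborel. V0 x \<bullet> G x) + (LINT x|lborel. h0 x * u x)"
    using corr_functional_representation[OF wm[of 0] i1 m[of 0] c0(1) e[of 0] c0(2)] unfolding S_def by blast

  \<comment> \<open>\<open>w k\<close> records the change of the truncating set. It vanishes on
    \<open>E k \<inter> E (Suc k)\<close>, so its contribution goes into \<open>f\<close>, with norm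
    at most \<open>2 * e k\<close>.\<close>
  define w where "w k x = (indicator (E (Suc k)) x - indicator (E k) x :: real)" for k x
  have w: "w k \<in> borel_measurable borel" "\<bar>w k x\<bar> \<le> 1" for k x
    unfolding w_def by (measurable, auto simp: indicator_def)
  define a where "a k = mass_density P (w k) (?m (Suc k))" for k
  have "(\<integral>\<^sup>+y. ennreal \<bar>?m (Suc k) y\<bar> \<partial>lborel) * (\<integral>\<^sup>+x. ennreal \<bar>w k x\<bar> \<partial>P) \<le> ennreal (2 * e k)" for k
  proof -
    have "(\<integral>\<^sup>+x. ennreal \<bar>w k x\<bar> \<partial>P) \<le> (\<integral>\<^sup>+x. indicator (- E (Suc k)) x + indicator (- E k) x \<partial>P)"
      by (intro nn_integral_mono) (auto simp: w_def split: split_indicator)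
    also have "\<dots> = emeasure P (- E (Suc k)) + emeasure P (- E k)"
      by (subst nn_integral_add) (auto simp: sets_P)
    also have "\<dots> = ennreal (measure P (- E (Suc k)) + measure P (- E k))"
      by (simp add: emeasure_eq_measure)
    also have "\<dots> \<le> ennreal (2 * e k)"
    proof (rule ennreal_leI)
      have "e (Suc k) \<le> e k" using \<epsilon> by (simp add: e_def)
      then show "measure P (- E (Suc k)) + measure P (- E k) \<le> 2 * e k" using Ec[of k] Ec[of "Suc k"] by linarith
    qed
    finally show ?thesis by (simp add: nn_integral_mollifier[OF \<delta>])
  qed
  note a = mass_density_bound[OF w(1) w(2) m this, folded a_def]
  have ai: "integrable lborel (a k)" and al: "(LINT x|lborel. \<bar>a k x\<bar>) \<le> 2 * e k" for k
    using a less_imp_le[OF e[of k]] by auto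
  define f where "f k x = h k x + a k x" for k x
  have fi: "integrable lborel (f k)" for k unfolding f_def using h(1) ai by simp
  have fl: "(LINT x|lborel. \<bar>f k x\<bar>) \<le> 3 * e k" for k
  proof -
    have "(LINT x|lborel. \<bar>f k x\<bar>) \<le> (LINT x|lborel. \<bar>h k x\<bar> + \<bar>a k x\<bar>)"
      using fi[of k] h(1)[of k] ai[of k] by (intro integral_mono) (auto simp: f_def)
    also have "\<dots> = (LINT x|lborel. \<bar>h k x\<bar>) + (LINT x|lborel. \<bar>a k x\<bar>)"
      using h(1)[of k] ai[of k] by simp
    finally show ?thesis using h(2)[of k] al[of k] by linarith
  qed
  have sum_half: "summable (\<lambda>k. (1 / 2 :: real) ^ k)" by (rule summable_geometric) simp
  have e_sums: "(\<lambda>k. 3 * e k) sums (3 * (\<epsilon> / 16 * (1 / (1 - 1 / 2))))"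
    unfolding e_def by (intro sums_mult geometric_sums) simp
  obtain W F where W: "continuous_on UNIV W" and F: "integrable lborel F" "(LINT x|lborel. \<bar>F x\<bar>) \<le> (\<Sum>k. 3 * e k)"
    and sums: "\<And>u G. C1c u G \<Longrightarrow> (\<lambda>k. (LINT x|lborel. V k x \<bullet> G x) + (LINT x|lborel. f k x * u x)) sums
       ((LINT x|lborel. W x \<bullet> G x) + (LINT x|lborel. F x * u x))"
    using series_representation[OF V(1) V(2) sum_half fi fl sums_summable[OF e_sums]] by blast
  have F': "(LINT x|lborel. \<bar>F x\<bar>) \<le> 3 * \<epsilon> / 8" using F(2) sums_unique[OF e_sums] by simp

  \<comment> \<open>The kernel is changed while the set is still \<open>E k\<close>; the set is
    changed at the new scale \<open>\<delta> (Suc k)\<close>.\<close>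
  have step: "S (Suc k) u - S k u = (LINT x|lborel. V k x \<bullet> G x) + (LINT x|lborel. f k x * u x)" if u: "C1c u G" for k u G
  proof -
    have uc: "Cc u" using u by (simp add: C1c_def)
    have int: "integrable P (\<lambda>x. indicator (E j) x * corr (?m i) u x)" for i j
    proof -
      have cc: "Cc (corr (?m i) u)" by (rule Cc_corr[OF m uc])
      then obtain B where B: "B > 0" "\<And>x. norm (corr (?m i) u x) \<le> B" by (rule Cc_bounded) blast
      note [measurable] = Cc_measurable[OF cc]
      show ?thesis using B by (intro integrable_P_bounded[where B = B]) (auto simp: indicator_def)
    qed
    have "corr (\<lambda>z. ?m (Suc k) z - ?m k z) u x = corr (?m (Suc k)) u x - corr (?m k) u x" for x
      using corr_integrable[OF m Cc_continuous[OF uc], of _ x] by (simp add: corr_def left_diff_distrib)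
    then have 1: "(LINT x|P. indicator (E k) x * corr (?m (Suc k)) u x) - S k u
        = (LINT x|P. indicator (E k) x * corr (\<lambda>z. ?m (Suc k) z - ?m k z) u x)"
      using int by (simp add: S_def right_diff_distrib)
    have 2: "S (Suc k) u - (LINT x|P. indicator (E k) x * corr (?m (Suc k)) u x) = (LINT x|P. w k x * corr (?m (Suc k)) u x)"
      using int by (simp add: S_def w_def left_diff_distrib)
    have 3: "(LINT x|P. w k x * corr (?m (Suc k)) u x) = (LINT x|lborel. a k x * u x)"
      unfolding a_def by (rule integral_corr_eq_mass_density[OF w(1) w(2) m uc])
    have 4: "(LINT x|lborel. f k x * u x) = (LINT x|lborel. h k x * u x) + (LINT x|lborel. a k x * u x)"
      using integrable_mult_Cc[OF h(1) uc] integrable_mult_Cc[OF ai uc] by (simp add: f_def distrib_right)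
    show ?thesis using 1 2 3 4 Vh[OF u, of k] by linarith
  qed
  have main: "(LINT x|P. u x) = (LINT x|lborel. (V0 x + W x) \<bullet> G x) + (LINT x|lborel. (h0 x + F x) * u x)"
    if u: "C1c u G" for u G
  proof -
    have uc: "Cc u" and Gc: "Cc G" using u by (auto simp: C1c_def)
    have "(\<lambda>k. S k u) \<longlonglongrightarrow> (LINT x|P. u x)"
      unfolding S_def by (rule tendsto_truncated_mollified[OF uc E E0 \<delta> \<delta>0])
    from telescope_sums[OF this] have "(\<lambda>k. S (Suc k) u - S k u) sums ((LINT x|P. u x) - S 0 u)" .
    with sums[OF u] have "(LINT x|P. u x) - S 0 u = (LINT x|lborel. W x \<bullet> G x) + (LINT x|lborel. F x * u x)"
      unfolding step[OF u] by (rule sums_unique2[rotated])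
    then show ?thesis
      using Vh0[OF u] integrable_mult_Cc[OF h0(1) uc] integrable_mult_Cc[OF F(1) uc]
        Cc_integrable[OF Cc_inner[OF Gc V0]] Cc_integrable[OF Cc_inner[OF Gc W]]
      by (simp add: inner_add_left distrib_right)
  qed
  have "(LINT x|lborel. \<bar>h0 x + F x\<bar>) \<le> (LINT x|lborel. \<bar>h0 x\<bar> + \<bar>F x\<bar>)"
    using h0(1) F(1) by (intro integral_mono) auto
  also have "\<dots> = (LINT x|lborel. \<bar>h0 x\<bar>) + (LINT x|lborel. \<bar>F x\<bar>)" using h0(1) F(1) by simp
  also have "\<dots> \<le> \<epsilon>" using h0(2) F' \<epsilon> by (simp add: e_def)
  finally have "(LINT x|lborel. \<bar>h0 x + F x\<bar>) \<le> \<epsilon>" .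
  \<comment> \<open>The field is negated to match the sign of the divergence in the sense of
    distributions.\<close>
  moreover have "(LINT x|P. u x) = - (LINT x|lborel. (- (V0 x + W x)) \<bullet> G x) + (LINT x|lborel. (h0 x + F x) * u x)"
    if "C1c u G" for u G
    using main[OF that] by (simp only: inner_minus_left Bochner_Integration.integral_minus minus_minus)
  moreover have "continuous_on UNIV (\<lambda>x. - (V0 x + W x))" by (intro continuous_intros V0 W)
  moreover have "integrable lborel (\<lambda>x. h0 x + F x)" using h0(1) F(1) by simp
  ultimately show ?thesis by (intro exI[of _ "\<lambda>x. - (V0 x + W x)"] exI[of _ "\<lambda>x. h0 x + F x"]) blast
qed

end

section \<open>Signed measures\<close>

lemma finite_signed_measure_minus:
  "finite_signed_measure \<mu> \<Longrightarrow> finite_signed_measure (\<lambda>A. - \<mu> A)"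
  unfolding finite_signed_measure_def by (auto intro: sums_minus)

lemma hausdorff_measure_mono:
  assumes "A \<subseteq> B" shows "hausdorff_measure s A \<le> hausdorff_measure s B"
  unfolding hausdorff_measure_eq_SUP hausdorff_content_def
  using assms by (intro SUP_mono' INF_superset_mono) auto

text \<open>Every Borel subset of \<open>A\<close> has finite Hausdorff measure as well, so the
  supremum that defines the upper variation runs over zeros.\<close>

lemma emeasure_upper_variation_eq_0:
  assumes \<mu>: "finite_signed_measure \<mu>"
    and null: "\<And>A. A \<in> sets borel \<Longrightarrow> hausdorff_measure s A < \<infinity> \<Longrightarrow> \<mu> A = 0"
    and A: "A \<in> sets borel" "hausdorff_measure s A < \<infinity>"
  shows "emeasure (upper_variation \<mu>) A = 0"
proof -
  have "\<mu> B = 0" if "B \<in> sets borel" "B \<subseteq> A" for B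
    using that hausdorff_measure_mono[of B A s] A(2) by (intro null) (auto intro: le_less_trans)
  then have "(SUP B \<in> {B \<in> sets borel. B \<subseteq> A}. ennreal (\<mu> B)) = 0"
    by (intro antisym SUP_least) auto
  then show ?thesis using emeasure_upper_variation[OF \<mu> A(1)] by simp
qed

lemma C1c_test_function:
  fixes \<phi> :: "'a::euclidean_space \<Rightarrow> real"
  assumes "test_function \<phi>"
  shows "C1c \<phi> (gradient \<phi>)"
proof -
  have "Ck (Suc 0) \<phi>" and supp: "compact (closure {x. \<phi> x \<noteq> 0})"
    using assms by (auto simp: test_function_def)
  then have diff: "\<And>x. \<phi> differentiable (at x)"
    and cont: "\<And>b. b \<in> Basis \<Longrightarrow> continuous_on UNIV (\<lambda>x. frechet_derivative \<phi> (at x) b)"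
    by simp_all
  have deriv: "(\<phi> has_derivative (\<lambda>h. gradient \<phi> x \<bullet> h)) (at x)" for x
  proof -
    have D: "(\<phi> has_derivative frechet_derivative \<phi> (at x)) (at x)"
      using diff frechet_derivative_works by blast
    then interpret linear "frechet_derivative \<phi> (at x)" by (rule has_derivative_linear)
    have "frechet_derivative \<phi> (at x) h = gradient \<phi> x \<bullet> h" for h
    proof -
      have "frechet_derivative \<phi> (at x) h = frechet_derivative \<phi> (at x) (\<Sum>b\<in>Basis. (h \<bullet> b) *\<^sub>R b)"
        by (simp add: euclidean_representation)
      also have "\<dots> = gradient \<phi> x \<bullet> h"
        by (simp add: sum scale gradient_def inner_sum_left inner_commute[of h] mult.commute)
      finally show ?thesis .
    qed
    then have eq: "frechet_derivative \<phi> (at x) = (\<lambda>h. gradient \<phi> x \<bullet> h)" by (rule ext)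
    from D show ?thesis unfolding eq .
  qed
  have gc: "continuous_on UNIV (gradient \<phi>)"
    unfolding gradient_def[abs_def] by (intro continuous_intros cont)
  have "bounded {x. \<phi> x \<noteq> 0}" using compact_imp_bounded[OF supp] bounded_subset closure_subset by blast
  then obtain R where "\<And>x. \<phi> x \<noteq> 0 \<Longrightarrow> norm x \<le> R" unfolding bounded_iff by blast
  then have R: "\<phi> x = 0" if "R < norm x" for x using that by (metis not_less)
  have "gradient \<phi> x = 0" if x: "R < norm x" for x
  proof -
    \<comment> \<open>Outside the closed ball of radius \<open>R\<close> the function vanishes on an
      open set, which forces its derivative to vanish there.\<close>
    have "open {x::'a. R < norm x}" by (intro open_Collect_less continuous_intros)
    from has_derivative_transform_within_open[OF has_derivative_const[of 0 "at x"] this, of \<phi>]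
    have "(\<phi> has_derivative (\<lambda>h. 0)) (at x)" using R x by simp
    then have "(\<lambda>h. gradient \<phi> x \<bullet> h) = (\<lambda>h. 0)" by (rule has_derivative_unique[OF deriv])
    then show ?thesis by (metis inner_eq_zero_iff)
  qed
  then show ?thesis
    unfolding C1c_def C1_grad_def using deriv gc R
    by (auto intro!: CcI[of \<phi> R] CcI[of _ R] differentiable_imp_continuous_on simp: diff
        differentiable_on_def differentiable_at_withinI)
qed

theorem theorem1p4:
  fixes \<mu> :: "(real ^ 'n::finite) set \<Rightarrow> real" and \<epsilon> :: real
  assumes "finite_signed_measure \<mu>"
    and "\<And>A. A \<in> sets borel \<Longrightarrow> hausdorff_measure (real CARD('n) - 1) A < \<infinity> \<Longrightarrow> \<mu> A = 0"
    and "\<epsilon> > 0"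
  shows "\<exists>(V :: real ^ 'n \<Rightarrow> real ^ 'n) (f :: real ^ 'n \<Rightarrow> real).
           continuous_on UNIV V \<and> integrable lborel f \<and>
           eq_div_plus \<mu> V f \<and> (LINT x|lborel. \<bar>f x\<bar>) \<le> \<epsilon>"
proof -
  \<comment> \<open>Both \<open>\<mu>\<close> and \<open>- \<mu>\<close> satisfy the hypotheses.
    Each upper variation receives half of \<open>\<epsilon>\<close>, and the two representations are
    subtracted, as in \<open>signed_integral\<close>.\<close>
  have rep: "\<exists>V f. continuous_on UNIV V \<and> integrable lborel f \<and> (LINT x|lborel. \<bar>f x\<bar>) \<le> \<epsilon> / 2 \<and>
    (\<forall>u G. C1c u G \<longrightarrow> (LINT x|upper_variation \<nu>. u x) = - (LINT x|lborel. V x \<bullet> G x) + (LINT x|lborel. f x * u x))"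
    if \<nu>: "finite_signed_measure \<nu>"
      and null: "\<And>A. A \<in> sets borel \<Longrightarrow> hausdorff_measure (real CARD('n) - 1) A < \<infinity> \<Longrightarrow> \<nu> A = 0"
    for \<nu> :: "(real ^ 'n) set \<Rightarrow> real"
  proof -
    interpret finite_borel_measure "upper_variation \<nu>"
      using finite_measure_upper_variation[OF \<nu>]
      by (simp add: finite_borel_measure_def finite_borel_measure_axioms_def)
    show ?thesis
      using emeasure_upper_variation_eq_0[OF \<nu> null] \<open>\<epsilon> > 0\<close>
      by (intro divergence_representation) auto
  qed
  obtain V f where V: "continuous_on UNIV V" and f: "integrable lborel f" "(LINT x|lborel. \<bar>f x\<bar>) \<le> \<epsilon> / 2"
    and Vf: "\<And>u G. C1c u G \<Longrightarrow> (LINT x|upper_variation \<mu>. u x) = - (LINT x|lborel. V x \<bullet> G x) + (LINT x|lborel. f x * u x)"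
    using rep[OF assms(1,2)] by blast
  have null': "\<And>A. A \<in> sets borel \<Longrightarrow> hausdorff_measure (real CARD('n) - 1) A < \<infinity> \<Longrightarrow> - \<mu> A = 0"
    using assms(2) by simp
  obtain W g where W: "continuous_on UNIV W" and g: "integrable lborel g" "(LINT x|lborel. \<bar>g x\<bar>) \<le> \<epsilon> / 2"
    and Wg: "\<And>u G. C1c u G \<Longrightarrow> (LINT x|upper_variation (\<lambda>A. - \<mu> A). u x) = - (LINT x|lborel. W x \<bullet> G x) + (LINT x|lborel. g x * u x)"
    using rep[OF finite_signed_measure_minus[OF assms(1)] null'] by blast
  have "eq_div_plus \<mu> (\<lambda>x. V x - W x) (\<lambda>x. f x - g x)"
    unfolding eq_div_plus_def
  proof (intro allI impI)
    fix \<phi> :: "real ^ 'n \<Rightarrow> real" assume "test_function \<phi>"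
    then have \<phi>: "C1c \<phi> (gradient \<phi>)" by (rule C1c_test_function)
    then have c: "Cc \<phi>" "Cc (gradient \<phi>)" by (auto simp: C1c_def)
    have "(LINT x|lborel. (V x - W x) \<bullet> gradient \<phi> x) = (LINT x|lborel. V x \<bullet> gradient \<phi> x) - (LINT x|lborel. W x \<bullet> gradient \<phi> x)"
      using Cc_integrable[OF Cc_inner[OF c(2) V]] Cc_integrable[OF Cc_inner[OF c(2) W]] by (simp add: inner_diff_left)
    moreover have "(LINT x|lborel. (f x - g x) * \<phi> x) = (LINT x|lborel. f x * \<phi> x) - (LINT x|lborel. g x * \<phi> x)"
      using integrable_mult_Cc[OF f(1) c(1)] integrable_mult_Cc[OF g(1) c(1)] by (simp add: left_diff_distrib)
    ultimately show "signed_integral \<mu> \<phi> =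
          - (LINT x|lborel. (V x - W x) \<bullet> gradient \<phi> x) + (LINT x|lborel. (f x - g x) * \<phi> x)"
      using Vf[OF \<phi>] Wg[OF \<phi>] by (simp add: signed_integral_def)
  qed
  moreover have "(LINT x|lborel. \<bar>f x - g x\<bar>) \<le> \<epsilon>"
  proof -
    have "(LINT x|lborel. \<bar>f x - g x\<bar>) \<le> (LINT x|lborel. \<bar>f x\<bar> + \<bar>g x\<bar>)"
      using f(1) g(1) by (intro integral_mono) auto
    also have "\<dots> = (LINT x|lborel. \<bar>f x\<bar>) + (LINT x|lborel. \<bar>g x\<bar>)" using f(1) g(1) by simp
    finally show ?thesis using f(2) g(2) by simp
  qed
  moreover have "continuous_on UNIV (\<lambda>x. V x - W x)" by (intro continuous_intros V W)
  moreover have "integrable lborel (\<lambda>x. f x - g x)" using f(1) g(1) by simp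
  ultimately show ?thesis by blast
qed

end
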